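(* Let $m\ge1$ and let $\Lambda=(\lambda_1,\ldots,\lambda_n)\subset\mathbb{R}^{4m}$ be an admissible configuration whose affine span is $\mathbb{R}^{4m}$. The $\mathbb{R}^{4m}$-action $\Phi$ on $\mathcal{S}_\Lambda$ descends to $V_\Lambda=\mathcal{S}_\Lambda/\mathbb{H}^*\subset\mathbb{H}P^{n-1}$, and $$V_\Lambda\cong N_{\mathbb H}(\Lambda)\times\mathbb{R}^{4m}$$ (diffeomorphism). In particular $$V_\Lambda/\mathbb{R}^{4m}\cong N_{\mathbb H}(\Lambda).$$
   Context: $\mathbb{H}$ denotes the quaternions, $\mathbb{H}^*=\mathbb{H}\setminus\{0\}$, and $\operatorname{Sp}(1)$ the unit quaternions. A configuration $\Lambda=(\lambda_1,\ldots,\lambda_n)\subset\mathbb{R}^{4m}$ is admissible if $0\in\operatorname{conv}\{\lambda_1,\ldots,\lambda_n\}$ and, for every $I\subset\{1,\ldots,n\}$, $0\in\operatorname{conv}\{\lambda_i:i\in I\}$ implies $|I|>4m$. Define $$\mathcal{S}_\Lambda=\{q\in\mathbb{H}^n:\ 0\in\operatorname{conv}\{\lambda_i:q_i\ne0\}\},\qquad \Phi_T(q_1,\ldots,q_n)=\big(e^{\langle\lambda_1,T\rangle}q_1,\ldots,e^{\langle\lambda_n,T\rangle}q_n\big)\quad(T\in\mathbb{R}^{4m}),$$ $$Z_{\mathbb H}(\Lambda)=\Big\{q\in\mathbb{H}^n:\ \sum_i\lambda_i|q_i|^2=0,\ \sum_i|q_i|^2=1\Big\}.$$ The group $\operatorname{Sp}(1)$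 acts freely on the compact smooth manifold $Z_{\mathbb H}(\Lambda)$ by diagonal left multiplication $a\cdot(q_1,\ldots,q_n)=(aq_1,\ldots,aq_n)$, and $N_{\mathbb H}(\Lambda)=Z_{\mathbb H}(\Lambda)/\operatorname{Sp}(1)$. Quaternionic projective space is $\mathbb{H}P^{n-1}=(\mathbb{H}^n\setminus\{0\})/\mathbb{H}^*$ for left scalar multiplication. *)

theory Defs
  imports "HOL-Analysis.Analysis"
begin

section \<open>Quaternions\<close>

text \<open>\<open>Quat a b c d\<close> stands for \<open>a + b i + c j + d k\<close>.\<close>

datatype quat = Quat (qRe: real) (qIm1: real) (qIm2: real) (qIm3: real)

lemma quat_eqI [intro?]:
  "\<lbrakk>qRe x = qRe y; qIm1 x = qIm1 y; qIm2 x = qIm2 y; qIm3 x = qIm3 y\<rbrakk> \<Longrightarrow> x = y"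
  by (rule quat.expand) simp

lemma quat_eq_iff:
  "x = y \<longleftrightarrow> qRe x = qRe y \<and> qIm1 x = qIm1 y \<and> qIm2 x = qIm2 y \<and> qIm3 x = qIm3 y"
  by (auto intro: quat_eqI)

instantiation quat :: real_vector
begin

definition "0 = Quat 0 0 0 0"
definition "x + y = Quat (qRe x + qRe y) (qIm1 x + qIm1 y) (qIm2 x + qIm2 y) (qIm3 x + qIm3 y)"
definition "- x = Quat (- qRe x) (- qIm1 x) (- qIm2 x) (- qIm3 x)"
definition "x - y = Quat (qRe x - qRe y) (qIm1 x - qIm1 y) (qIm2 x - qIm2 y) (qIm3 x - qIm3 y)"
definition "r *\<^sub>R x = Quat (r * qRe x) (r * qIm1 x) (r * qIm2 x) (r * qIm3 x)"

instance
  by standard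
    (simp_all add: quat_eq_iff zero_quat_def plus_quat_def uminus_quat_def minus_quat_def
      scaleR_quat_def algebra_simps)

end

lemmas quat_vector_defs =
  zero_quat_def plus_quat_def uminus_quat_def minus_quat_def scaleR_quat_def

instantiation quat :: real_algebra_1
begin

definition "1 = Quat 1 0 0 0"

definition "x * y = Quat
  (qRe x * qRe y - qIm1 x * qIm1 y - qIm2 x * qIm2 y - qIm3 x * qIm3 y)
  (qRe x * qIm1 y + qIm1 x * qRe y + qIm2 x * qIm3 y - qIm3 x * qIm2 y)
  (qRe x * qIm2 y - qIm1 x * qIm3 y + qIm2 x * qRe y + qIm3 x * qIm1 y)
  (qRe x * qIm3 y + qIm1 x * qIm2 y - qIm2 x * qIm1 y + qIm3 x * qRe y)"

instance
  by standard
    (simp_all add: quat_eq_iff quat_vector_defs one_quat_def times_quat_def algebra_simps)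

end

instantiation quat :: real_inner
begin

definition "inner x y = qRe x * qRe y + qIm1 x * qIm1 y + qIm2 x * qIm2 y + qIm3 x * qIm3 y"
definition "norm (x :: quat) = sqrt (inner x x)"
definition "sgn (x :: quat) = x /\<^sub>R norm x"
definition "dist (x :: quat) y = norm (x - y)"
definition "(uniformity :: (quat \<times> quat) filter) = (INF e\<in>{0<..}. principal {(x, y). dist x y < e})"
definition "open (U :: quat set) \<longleftrightarrow>
  (\<forall>x\<in>U. eventually (\<lambda>(x', y). x' = x \<longrightarrow> y \<in> U) uniformity)"

instance
proof
  fix x y z :: quat and r :: real and U :: "quat set"
  show "dist x y = norm (x - y)" "sgn x = x /\<^sub>R norm x" "norm x = sqrt (inner x x)"
    by (simp_all add: dist_quat_def sgn_quat_def norm_quat_def)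
  show "(uniformity :: (quat \<times> quat) filter) = (INF e\<in>{0<..}. principal {(x, y). dist x y < e})"
    by (rule uniformity_quat_def)
  show "open U \<longleftrightarrow> (\<forall>x\<in>U. eventually (\<lambda>(x', y). x' = x \<longrightarrow> y \<in> U) uniformity)"
    by (rule open_quat_def)
  show "inner x y = inner y x" "inner (x + y) z = inner x z + inner y z"
    "inner (r *\<^sub>R x) y = r * inner x y"
    by (simp_all add: inner_quat_def quat_vector_defs algebra_simps)
  show "0 \<le> inner x x"
    by (simp add: inner_quat_def)
  show "inner x x = 0 \<longleftrightarrow> x = 0"
  proof
    assume "inner x x = 0"
    then have "(qRe x)\<^sup>2 + (qIm1 x)\<^sup>2 + (qIm2 x)\<^sup>2 + (qIm3 x)\<^sup>2 = 0"
      by (simp add: inner_quat_def power2_eq_square)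
    then have "(qRe x)\<^sup>2 = 0 \<and> (qIm1 x)\<^sup>2 = 0 \<and> (qIm2 x)\<^sup>2 = 0 \<and> (qIm3 x)\<^sup>2 = 0"
      using zero_le_power2[of "qRe x"] zero_le_power2[of "qIm1 x"]
        zero_le_power2[of "qIm2 x"] zero_le_power2[of "qIm3 x"] by linarith
    then show "x = 0"
      by (simp add: quat_eq_iff zero_quat_def)
  qed (simp add: inner_quat_def zero_quat_def)
qed

end

instantiation quat :: real_normed_div_algebra
begin

definition "inverse (x :: quat) =
  Quat (qRe x) (- qIm1 x) (- qIm2 x) (- qIm3 x) /\<^sub>R (norm x)\<^sup>2"
definition "x div (y :: quat) = x * inverse y"

instance
proof
  fix x y :: quat
  have n: "(norm x)\<^sup>2 = (qRe x)\<^sup>2 + (qIm1 x)\<^sup>2 + (qIm2 x)\<^sup>2 + (qIm3 x)\<^sup>2" for x :: quat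
    by (simp add: norm_quat_def inner_quat_def power2_eq_square)
  show "inverse x * x = 1" "x * inverse x = 1" if "x \<noteq> 0"
  proof -
    let ?c = "Quat (qRe x) (- qIm1 x) (- qIm2 x) (- qIm3 x)"
    have "?c * x = (norm x)\<^sup>2 *\<^sub>R 1" "x * ?c = (norm x)\<^sup>2 *\<^sub>R 1"
      unfolding n by (simp_all add: times_quat_def scaleR_quat_def one_quat_def power2_eq_square)
    then show "inverse x * x = 1" "x * inverse x = 1"
      using that by (simp_all add: inverse_quat_def)
  qed
  show "inverse (0 :: quat) = 0"
    by (simp add: inverse_quat_def zero_quat_def scaleR_quat_def)
  show "x div y = x * inverse y"
    by (rule divide_quat_def)
  have "(norm (x * y))\<^sup>2 = (norm x * norm y)\<^sup>2"
    unfolding power_mult_distrib n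
    by (simp add: times_quat_def power2_eq_square algebra_simps)
  then show "norm (x * y) = norm x * norm y"
    by (metis mult_nonneg_nonneg norm_ge_zero power2_eq_imp_eq)
qed

end

instantiation quat :: euclidean_space
begin

definition "Basis = {Quat 1 0 0 0, Quat 0 1 0 0, Quat 0 0 1 0, Quat 0 0 0 1}"

instance
proof
  show "(Basis :: quat set) \<noteq> {}" "finite (Basis :: quat set)"
    by (simp_all add: Basis_quat_def)
  show "inner u v = (if u = v then 1 else 0)" if "u \<in> Basis" "v \<in> Basis" for u v :: quat
    using that unfolding Basis_quat_def by (elim insertE emptyE) (simp_all add: inner_quat_def)
  show "(\<forall>u\<in>Basis. inner x u = 0) \<longleftrightarrow> x = 0" for x :: quat
    unfolding quat_eq_iff[of x] by (simp add: Basis_quat_def inner_quat_def zero_quat_def)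
qed

end


section \<open>Smooth manifolds\<close>

primrec Ck_on :: "nat \<Rightarrow> 'a::euclidean_space set \<Rightarrow> ('a \<Rightarrow> 'b::real_normed_vector) \<Rightarrow> bool" where
  "Ck_on 0 U f \<longleftrightarrow> continuous_on U f"
| "Ck_on (Suc k) U f \<longleftrightarrow> (\<forall>x\<in>U. f differentiable (at x)) \<and>
     (\<forall>v. Ck_on k U (\<lambda>x. frechet_derivative f (at x) v))"

text \<open>Smoothness on an arbitrary subset of a Euclidean space: locally the restriction of a
  \<open>C\<^sup>\<infinity>\<close> function defined on an open set.\<close>

definition smooth_on :: "'a::euclidean_space set \<Rightarrow> ('a \<Rightarrow> 'b::real_normed_vector) \<Rightarrow> bool" where
  "smooth_on S f \<longleftrightarrow> (\<forall>x\<in>S. \<exists>U g. open U \<and> x \<in> U \<and> (\<forall>k. Ck_on k U g) \<and> (\<forall>y\<in>S \<inter> U. f y = g y))"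

text \<open>A topological space together with an atlas. The space \<open>\<real>\<^sup>d\<close> for a computed
  number \<open>d\<close> is not available as a type, hence charts map homeomorphically onto relatively open
  subsets of \<open>d\<close>-dimensional linear subspaces of a Euclidean space.\<close>

record ('p, 'e) charted_space =
  mtop :: "'p topology"
  charts :: "('p set \<times> ('p \<Rightarrow> 'e)) set"

definition is_chart :: "nat \<Rightarrow> 'p topology \<Rightarrow> 'p set \<Rightarrow> ('p \<Rightarrow> 'e::euclidean_space) \<Rightarrow> bool" where
  "is_chart d X U \<phi> \<longleftrightarrow> openin X U \<and>
     (\<exists>W. subspace W \<and> dim W = d \<and> openin (top_of_set W) (\<phi> ` U)) \<and>
     homeomorphic_map (subtopology X U) (top_of_set (\<phi> ` U)) \<phi>"

definition smooth_manifold :: "('p, 'e::euclidean_space) charted_space \<Rightarrow> bool" where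
  "smooth_manifold M \<longleftrightarrow>
     Hausdorff_space (mtop M) \<and> second_countable (mtop M) \<and>
     (\<exists>d. \<forall>(U, \<phi>)\<in>charts M. is_chart d (mtop M) U \<phi>) \<and>
     (\<Union>(U, \<phi>)\<in>charts M. U) = topspace (mtop M) \<and>
     (\<forall>(U, \<phi>)\<in>charts M. \<forall>(V, \<psi>)\<in>charts M. smooth_on (\<phi> ` (U \<inter> V)) (\<psi> \<circ> inv_into U \<phi>))"

definition smooth_map ::
  "('p, 'e::euclidean_space) charted_space \<Rightarrow> ('q, 'f::euclidean_space) charted_space
    \<Rightarrow> ('p \<Rightarrow> 'q) \<Rightarrow> bool" where
  "smooth_map M N f \<longleftrightarrow>
     continuous_map (mtop M) (mtop N) f \<and>
     (\<forall>(U, \<phi>)\<in>charts M. \<forall>(V, \<psi>)\<in>charts N.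
        smooth_on (\<phi> ` (U \<inter> f -` V)) (\<psi> \<circ> f \<circ> inv_into U \<phi>))"

definition diffeomorphism ::
  "('p, 'e::euclidean_space) charted_space \<Rightarrow> ('q, 'f::euclidean_space) charted_space
    \<Rightarrow> ('p \<Rightarrow> 'q) \<Rightarrow> bool" where
  "diffeomorphism M N f \<longleftrightarrow>
     bij_betw f (topspace (mtop M)) (topspace (mtop N)) \<and>
     smooth_map M N f \<and> smooth_map N M (inv_into (topspace (mtop M)) f)"

definition diffeomorphic ::
  "('p, 'e::euclidean_space) charted_space \<Rightarrow> ('q, 'f::euclidean_space) charted_space \<Rightarrow> bool"
  where
  "diffeomorphic M N \<longleftrightarrow> smooth_manifold M \<and> smooth_manifold N \<and> (\<exists>f. diffeomorphism M N f)"

text \<open>For a chart \<open>(U, \<phi>)\<close> with \<open>U\<close> nonempty, \<open>span (\<phi> ` U)\<close> is the linear subspace in which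
  \<open>\<phi> ` U\<close> is open, that is, the tangent space in that chart. The last clause says that the
  differential of \<open>f\<close> is surjective between the tangent spaces; outside of \<open>span (\<phi> ` U)\<close> the map
  \<open>D\<close> carries no information.\<close>

definition submersion ::
  "('p, 'e::euclidean_space) charted_space \<Rightarrow> ('q, 'f::euclidean_space) charted_space
    \<Rightarrow> ('p \<Rightarrow> 'q) \<Rightarrow> bool" where
  "submersion M N f \<longleftrightarrow> smooth_map M N f \<and>
     (\<forall>(U, \<phi>)\<in>charts M. \<forall>(V, \<psi>)\<in>charts N. \<forall>x\<in>U \<inter> f -` V.
        \<exists>D. ((\<psi> \<circ> f \<circ> inv_into U \<phi>) has_derivative D) (at (\<phi> x) within \<phi> ` (U \<inter> f -` V)) \<and>
            D ` span (\<phi> ` U) = span (\<psi> ` V))"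

definition euclidean_manifold :: "('e::euclidean_space, 'e) charted_space" where
  "euclidean_manifold = \<lparr>mtop = euclidean, charts = {(UNIV, id)}\<rparr>"

text \<open>The structure of an embedded submanifold on \<open>S\<close>: all diffeomorphisms from relatively open
  subsets of \<open>S\<close> onto relatively open subsets of linear subspaces.\<close>

definition embedded_submanifold :: "'e::euclidean_space set \<Rightarrow> ('e, 'e) charted_space" where
  "embedded_submanifold S = \<lparr>mtop = top_of_set S,
     charts = {(U, \<phi>). (\<exists>d. is_chart d (top_of_set S) U \<phi>) \<and>
                       smooth_on U \<phi> \<and> smooth_on (\<phi> ` U) (inv_into U \<phi>)}\<rparr>"

definition open_submanifold :: "('p, 'e) charted_space \<Rightarrow> 'p set \<Rightarrow> ('p, 'e) charted_space" where
  "open_submanifold M P = \<lparr>mtop = subtopology (mtop M) P,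
     charts = (\<lambda>(U, \<phi>). (U \<inter> P, \<phi>)) ` charts M\<rparr>"

definition product_manifold ::
  "('p, 'e) charted_space \<Rightarrow> ('q, 'f) charted_space \<Rightarrow> ('p \<times> 'q, 'e \<times> 'f) charted_space" where
  "product_manifold M N = \<lparr>mtop = prod_topology (mtop M) (mtop N),
     charts = {(U \<times> V, map_prod \<phi> \<psi>) | U \<phi> V \<psi>. (U, \<phi>) \<in> charts M \<and> (V, \<psi>) \<in> charts N}\<rparr>"

definition quotient_topology :: "'p topology \<Rightarrow> ('p \<times> 'p) set \<Rightarrow> 'p set topology" where
  "quotient_topology X R = topology (\<lambda>G. G \<subseteq> topspace X // R \<and>
     openin X {x \<in> topspace X. R `` {x} \<in> G})"

lemma openin_quotient_topology:
  "openin (quotient_topology X R) G \<longleftrightarrow>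
     G \<subseteq> topspace X // R \<and> openin X {x \<in> topspace X. R `` {x} \<in> G}"
proof -
  have "istopology (\<lambda>G. G \<subseteq> topspace X // R \<and> openin X {x \<in> topspace X. R `` {x} \<in> G})"
    unfolding istopology_def
  proof (intro conjI allI impI)
    fix S T
    assume "S \<subseteq> topspace X // R \<and> openin X {x \<in> topspace X. R `` {x} \<in> S}"
      and "T \<subseteq> topspace X // R \<and> openin X {x \<in> topspace X. R `` {x} \<in> T}"
    moreover have "{x \<in> topspace X. R `` {x} \<in> S \<inter> T} =
      {x \<in> topspace X. R `` {x} \<in> S} \<inter> {x \<in> topspace X. R `` {x} \<in> T}" by blast
    ultimately show "S \<inter> T \<subseteq> topspace X // R" "openin X {x \<in> topspace X. R `` {x} \<in> S \<inter> T}"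
      by auto
  next
    fix \<K>
    assume *: "\<forall>K\<in>\<K>. K \<subseteq> topspace X // R \<and> openin X {x \<in> topspace X. R `` {x} \<in> K}"
    then show "\<Union> \<K> \<subseteq> topspace X // R" by blast
    have "{x \<in> topspace X. R `` {x} \<in> \<Union> \<K>} = (\<Union>K\<in>\<K>. {x \<in> topspace X. R `` {x} \<in> K})" by blast
    then show "openin X {x \<in> topspace X. R `` {x} \<in> \<Union> \<K>}" using * by auto
  qed
  then show ?thesis
    by (simp add: quotient_topology_def topology_inverse')
qed

lemma topspace_quotient_topology: "topspace (quotient_topology X R) = topspace X // R"
proof
  show "topspace (quotient_topology X R) \<subseteq> topspace X // R"
    by (metis openin_quotient_topology openin_topspace)
  have "{x \<in> topspace X. R `` {x} \<in> topspace X // R} = topspace X"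
    by (auto intro: quotientI)
  then have "openin (quotient_topology X R) (topspace X // R)"
    by (simp add: openin_quotient_topology)
  then show "topspace X // R \<subseteq> topspace (quotient_topology X R)"
    by (rule openin_subset)
qed

text \<open>The smooth structure on the space of \<open>R\<close>-classes for which the projection is a submersion.
  There is at most one such structure; its maximal atlas consists of all charts whose
  composition with the projection is a submersion onto the image of the chart.\<close>

definition quotient_manifold ::
  "('p, 'e::euclidean_space) charted_space \<Rightarrow> ('p \<times> 'p) set \<Rightarrow> ('p set, 'e) charted_space" where
  "quotient_manifold M R = \<lparr>mtop = quotient_topology (mtop M) R,
     charts = {(U, \<phi>). (\<exists>d. is_chart d (quotient_topology (mtop M) R) U \<phi>) \<and>
       submersion (open_submanifold M {x \<in> topspace (mtop M). R `` {x} \<in> U})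
         \<lparr>mtop = top_of_set (\<phi> ` U), charts = {(\<phi> ` U, id)}\<rparr> (\<lambda>x. \<phi> (R `` {x}))}\<rparr>"

definition smooth_vector_action ::
  "('p, 'e::euclidean_space) charted_space \<Rightarrow> ('v::euclidean_space \<Rightarrow> 'p \<Rightarrow> 'p) \<Rightarrow> bool" where
  "smooth_vector_action M \<Psi> \<longleftrightarrow>
     smooth_map (product_manifold euclidean_manifold M) M (\<lambda>(T, x). \<Psi> T x) \<and>
     (\<forall>x\<in>topspace (mtop M). \<Psi> 0 x = x) \<and>
     (\<forall>S T. \<forall>x\<in>topspace (mtop M). \<Psi> (S + T) x = \<Psi> S (\<Psi> T x))"


section \<open>Admissible configurations\<close>

definition admissible :: "('n::finite \<Rightarrow> real ^ 'd) \<Rightarrow> bool" where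
  "admissible \<Lambda> \<longleftrightarrow> 0 \<in> convex hull (range \<Lambda>) \<and>
     (\<forall>I. 0 \<in> convex hull (\<Lambda> ` I) \<longrightarrow> card I > CARD('d))"

definition S_set :: "('n::finite \<Rightarrow> real ^ 'd) \<Rightarrow> (quat ^ 'n) set" where
  "S_set \<Lambda> = {q. 0 \<in> convex hull (\<Lambda> ` {i. q $ i \<noteq> 0})}"

definition \<Phi> :: "('n::finite \<Rightarrow> real ^ 'd) \<Rightarrow> real ^ 'd \<Rightarrow> quat ^ 'n \<Rightarrow> quat ^ 'n" where
  "\<Phi> \<Lambda> T q = (\<chi> i. exp (\<Lambda> i \<bullet> T) *\<^sub>R q $ i)"

definition Z_set :: "('n::finite \<Rightarrow> real ^ 'd) \<Rightarrow> (quat ^ 'n) set" where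
  "Z_set \<Lambda> = {q. (\<Sum>i\<in>UNIV. (norm (q $ i))\<^sup>2 *\<^sub>R \<Lambda> i) = 0 \<and> (\<Sum>i\<in>UNIV. (norm (q $ i))\<^sup>2) = 1}"

definition Sp1_rel :: "((quat ^ 'n) \<times> (quat ^ 'n)) set" where
  "Sp1_rel = {(p, q). \<exists>a. norm a = 1 \<and> q = a *s p}"

definition Hstar_rel :: "((quat ^ 'n) \<times> (quat ^ 'n)) set" where
  "Hstar_rel = {(p, q). \<exists>a. a \<noteq> 0 \<and> q = a *s p}"

definition action_rel :: "('v \<Rightarrow> 'p \<Rightarrow> 'p) \<Rightarrow> ('p \<times> 'p) set" where
  "action_rel \<Psi> = {(x, y). \<exists>T. y = \<Psi> T x}"

definition N_manifold :: "('n::finite \<Rightarrow> real ^ 'd) \<Rightarrow> ((quat ^ 'n) set, quat ^ 'n) charted_space"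
  where "N_manifold \<Lambda> = quotient_manifold (embedded_submanifold (Z_set \<Lambda>)) Sp1_rel"

definition HP :: "((quat ^ 'n::finite) set, quat ^ 'n) charted_space" where
  "HP = quotient_manifold (embedded_submanifold (UNIV - {0})) Hstar_rel"

definition V_manifold :: "('n::finite \<Rightarrow> real ^ 'd) \<Rightarrow> ((quat ^ 'n) set, quat ^ 'n) charted_space"
  where "V_manifold \<Lambda> = open_submanifold HP (S_set \<Lambda> // Hstar_rel)"

end

theory Submission
  imports Defs
begin

text \<open>
  For \<open>q\<close> in \<open>S_set \<Lambda>\<close> the strictly convex, coercive function
  \<open>T \<mapsto> \<Sum>i. e\<^bsup>2\<langle>\<Lambda> i, T\<rangle>\<^esup> |q i|\<^sup>2\<close> has a unique critical point \<open>time q\<close>, which depends smoothly on \<open>q\<close>;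
  flowing \<open>q\<close> for this time and rescaling gives a smooth retraction \<open>retr\<close> onto \<open>Z_set \<Lambda>\<close>.
  On classes, \<open>q \<mapsto> (retr q, time q)\<close> is the diffeomorphism of \<open>V\<close> onto \<open>N \<times> \<real>\<^sup>d\<close>.

  To avoid charts, every manifold involved is presented as a quotient map from an open set of
  \<open>\<bbbH>\<^sup>n\<close> (or of \<open>\<bbbH>\<^sup>n \<times> \<real>\<^sup>d\<close>) that has smooth local sections through every point: \<open>Z\<close>, \<open>N\<close>, \<open>V\<close> and
  \<open>V / \<real>\<^sup>d\<close> are all quotients of \<open>S_set \<Lambda>\<close>. A map is then smooth as soon as it lifts to a smooth map
  of the open sets. That an arbitrary chart of a quotient admits such sections follows by comparison
  with a slice, using invariance of dimension and the inverse function theorem.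
\<close>

section \<open>Smooth maps between subsets of Euclidean spaces\<close>

text \<open>The atlas of \<open>quotient_manifold\<close> is implicit: it contains every
  homeomorphism onto a relatively open subset of a linear subspace, of any dimension, for which the
  projection is a submersion. Smoothness therefore has to be established for charts about which
  nothing else is known. A smooth section through each prescribed point of the covering open set
  handles this: it yields openness of the projection, surjectivity of its differential and
  smoothness of descended maps.

  The slices rest on one linear fact: for \<open>q\<close> in \<open>S_set \<Lambda>\<close> an
  affine functional vanishing on the weights in the support of \<open>q\<close> is zero, so the
  support contains \<open>d + 1\<close> affinely independent weights. The \<open>d + 1\<close> real
  parameters of positive scaling and of the action are then found by taking logarithms, which gives
  codimension \<open>d + 1\<close> for \<open>Z\<close>. Replacing positive scaling by all of
  \<bbbH>* raises this to \<open>4 + d\<close>, the codimension for both \<open>N\<close> and the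
  quotient of \<open>V\<close> by the action. These two have the same fibres over
  \<open>S_set \<Lambda>\<close>.\<close>

lemma Ck_on_cong:
  assumes "open U" "\<And>x. x \<in> U \<Longrightarrow> f x = g x" "Ck_on k U f"
  shows "Ck_on k U g"
  using assms(2,3)
proof (induction k arbitrary: f g)
  case 0
  then show ?case by (simp cong: continuous_on_cong)
next
  case (Suc k)
  have *: "(g has_derivative frechet_derivative f (at x)) (at x)" if x: "x \<in> U" for x
  proof (rule has_derivative_transform_within_open[OF _ assms(1) x Suc.prems(1)])
    show "(f has_derivative frechet_derivative f (at x)) (at x)"
      using Suc.prems(2) x by (simp add: frechet_derivative_works)
  qed
  have "Ck_on k U (\<lambda>x. frechet_derivative g (at x) v)" for v
  proof (rule Suc.IH)
    show "Ck_on k U (\<lambda>x. frechet_derivative f (at x) v)" using Suc.prems(2) by simp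
  qed (simp add: frechet_derivative_at[OF *, symmetric])
  then show ?case using * by (auto simp: differentiable_def)
qed

text \<open>Any explicit derivative formula may stand in for \<open>frechet_derivative\<close>,
  since derivatives at a point are unique. The closure rules below are this rule combined with the
  matching differentiation rule and induction on \<open>k\<close>.\<close>

lemma Ck_on_Suc_intro:
  assumes "open U" "\<And>x. x \<in> U \<Longrightarrow> (f has_derivative f' x) (at x)" "\<And>v. Ck_on k U (\<lambda>x. f' x v)"
  shows "Ck_on (Suc k) U f"
proof -
  have "f' x = frechet_derivative f (at x)" if "x \<in> U" for x
    using assms(2)[OF that] by (rule frechet_derivative_at)
  then have "Ck_on k U (\<lambda>x. frechet_derivative f (at x) v)" for v
    by (intro Ck_on_cong[OF assms(1) _ assms(3)[of v]]) simp
  then show ?thesis using assms(2) by (auto simp: differentiable_def)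
qed

lemma Ck_on_Suc_derivative:
  "Ck_on (Suc k) U f \<Longrightarrow> x \<in> U \<Longrightarrow> (f has_derivative frechet_derivative f (at x)) (at x)"
  by (auto simp: frechet_derivative_works)

lemma Ck_on_Suc_imp: "Ck_on (Suc k) U f \<Longrightarrow> Ck_on k U f"
proof (induction k arbitrary: f)
  case 0
  then show ?case
    by (auto simp: differentiable_imp_continuous_within intro!: continuous_at_imp_continuous_on)
next
  case (Suc k)
  then show ?case by (metis Ck_on.simps(2))
qed

lemma Ck_on_subset: "Ck_on k U f \<Longrightarrow> V \<subseteq> U \<Longrightarrow> Ck_on k V f"
  by (induction k arbitrary: f) (auto intro: continuous_on_subset)

lemma Ck_on_local:
  assumes "\<And>x. x \<in> U \<Longrightarrow> \<exists>V. open V \<and> x \<in> V \<and> Ck_on k V f"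
  shows "Ck_on k U f"
  using assms
proof (induction k arbitrary: f)
  case 0
  then show ?case
    by (metis Ck_on.simps(1) continuous_at_imp_continuous_on continuous_on_eq_continuous_at)
next
  case (Suc k)
  show ?case unfolding Ck_on.simps
  proof (intro conjI ballI allI)
    fix x assume "x \<in> U" then show "f differentiable (at x)" using Suc.prems by fastforce
  next
    fix v show "Ck_on k U (\<lambda>x. frechet_derivative f (at x) v)"
      using Suc.prems by (intro Suc.IH) (metis Ck_on.simps(2))
  qed
qed

lemma Ck_on_const: "Ck_on k U (\<lambda>x. c)"
proof (induction k arbitrary: c)
  case 0 then show ?case by simp
next
  case (Suc k) then show ?case by (simp add: frechet_derivative_const)
qed

lemma Ck_on_bounded_linear_compose:
  assumes "bounded_linear L" "open U" "Ck_on k U f" shows "Ck_on k U (\<lambda>x. L (f x))"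
  using assms(3)
proof (induction k arbitrary: f)
  case 0 then show ?case using assms(1)
    by (auto intro: bounded_linear.continuous_on)
next
  case (Suc k)
  show ?case
    by (rule Ck_on_Suc_intro[OF assms(2) bounded_linear.has_derivative[OF assms(1)]
          Suc.IH, OF Ck_on_Suc_derivative]) (use Suc.prems in auto)
qed

lemma Ck_on_bounded_linear: "bounded_linear L \<Longrightarrow> Ck_on k UNIV L"
proof (cases k)
  case (Suc n)
  assume L: "bounded_linear L"
  show ?thesis unfolding Suc
    by (rule Ck_on_Suc_intro[OF open_UNIV bounded_linear_imp_has_derivative[OF L]])
      (rule Ck_on_const)
qed (simp add: linear_continuous_on)

lemma Ck_on_add:
  assumes "open U" "Ck_on k U f" "Ck_on k U g" shows "Ck_on k U (\<lambda>x. f x + g x)"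
  using assms(2,3)
proof (induction k arbitrary: f g)
  case 0 then show ?case by (auto intro: continuous_intros)
next
  case (Suc k)
  show ?case
    by (rule Ck_on_Suc_intro[OF assms(1) has_derivative_add Suc.IH, OF Ck_on_Suc_derivative
          Ck_on_Suc_derivative]) (use Suc.prems in auto)
qed

lemma Ck_on_sum:
  assumes "open U" "\<And>i. i \<in> I \<Longrightarrow> Ck_on k U (f i)" shows "Ck_on k U (\<lambda>x. \<Sum>i\<in>I. f i x)"
  using assms(2)
  by (induction I rule: infinite_finite_induct) (auto intro: Ck_on_const Ck_on_add[OF assms(1)])

lemma Ck_on_bounded_bilinear:
  assumes "bounded_bilinear B" "open U" "Ck_on k U f" "Ck_on k U g"
  shows "Ck_on k U (\<lambda>x. B (f x) (g x))"
  using assms(3,4)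
proof (induction k arbitrary: f g)
  case 0 then show ?case using assms(1) by (auto intro: bounded_bilinear.continuous_on)
next
  case (Suc k)
  note imp = Suc.prems[THEN Ck_on_Suc_imp]
  show ?case
    by (rule Ck_on_Suc_intro[OF assms(2) bounded_bilinear.FDERIV[OF assms(1)] Ck_on_add[OF assms(2)],
          OF Ck_on_Suc_derivative Ck_on_Suc_derivative Suc.IH Suc.IH]) (use Suc.prems imp in auto)
qed

lemma linear_eq_sum_Basis:
  fixes L :: "'a::euclidean_space \<Rightarrow> 'b::real_vector"
  assumes "linear L" shows "L v = (\<Sum>b\<in>Basis. (v \<bullet> b) *\<^sub>R L b)"
proof -
  have "L v = L (\<Sum>b\<in>Basis. (v \<bullet> b) *\<^sub>R b)" by (simp add: euclidean_representation)
  then show ?thesis using assms by (simp add: linear_sum linear_scale)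
qed

text \<open>Dependence of a linear map on \<open>x\<close> is tested vector by vector, without a
  norm on the space of linear maps. Expanding \<open>u x\<close> in the basis turns evaluation at a
  moving vector into a finite sum of products.\<close>

lemma Ck_on_apply:
  fixes u :: "'a::euclidean_space \<Rightarrow> 'b::euclidean_space" and A :: "'a \<Rightarrow> 'b \<Rightarrow> 'c::real_normed_vector"
  assumes "open U" "\<And>x. x \<in> U \<Longrightarrow> linear (A x)" "\<And>v. Ck_on k U (\<lambda>x. A x v)" "Ck_on k U u"
  shows "Ck_on k U (\<lambda>x. A x (u x))"
proof (rule Ck_on_cong[OF assms(1)])
  show "Ck_on k U (\<lambda>x. \<Sum>b\<in>Basis. (u x \<bullet> b) *\<^sub>R A x b)"
    by (intro Ck_on_sum assms Ck_on_bounded_bilinear[OF bounded_bilinear_scaleR]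
        Ck_on_bounded_linear_compose[OF bounded_linear_inner_left])
qed (simp add: linear_eq_sum_Basis[OF assms(2), symmetric])

text \<open>Induction on \<open>k\<close> with \<open>f\<close> fixed and \<open>g\<close> varying:
  the chain rule writes the derivative as the linear map \<open>Dg (f x)\<close> applied to
  \<open>Df x v\<close>. The induction hypothesis covers each \<open>y \<mapsto> Dg y w\<close>, and
  \<open>Ck_on_apply\<close> assembles the two.\<close>

lemma Ck_on_compose:
  fixes f :: "'a::euclidean_space \<Rightarrow> 'b::euclidean_space" and g :: "'b \<Rightarrow> 'c::real_normed_vector"
  assumes "open U" "open V" "f ` U \<subseteq> V" "Ck_on k U f" "Ck_on k V g"
  shows "Ck_on k U (\<lambda>x. g (f x))"
  using assms(4,5)
proof (induction k arbitrary: g)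
  case 0 then show ?case using assms(3) by (auto intro: continuous_on_compose2)
next
  case (Suc k)
  have g: "(g has_derivative frechet_derivative g (at (f x))) (at (f x))" if "x \<in> U" for x
    using Suc.prems(2) assms(3) that by (intro Ck_on_Suc_derivative) auto
  show ?case
  proof (rule Ck_on_Suc_intro[OF assms(1)])
    show "((\<lambda>x. g (f x)) has_derivative
        (\<lambda>v. frechet_derivative g (at (f x)) (frechet_derivative f (at x) v))) (at x)" if "x \<in> U" for x
      using has_derivative_compose[OF Ck_on_Suc_derivative[OF Suc.prems(1) that] g[OF that]]
      by (simp add: o_def)
    show "Ck_on k U (\<lambda>x. frechet_derivative g (at (f x)) (frechet_derivative f (at x) v))" for v
    proof (rule Ck_on_apply[OF assms(1)])
      show "linear (frechet_derivative g (at (f x)))" if "x \<in> U" for x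
        using g[OF that] by (rule has_derivative_linear)
      show "Ck_on k U (\<lambda>x. frechet_derivative g (at (f x)) w)" for w
        using Suc.IH[of "\<lambda>y. frechet_derivative g (at y) w"] Suc.prems Ck_on_Suc_imp by auto
    qed (use Suc.prems in auto)
  qed
qed

section \<open>Smoothness on arbitrary subsets, through local extensions\<close>

lemma smooth_onI:
  "(\<And>x. x \<in> S \<Longrightarrow> \<exists>U g. open U \<and> x \<in> U \<and> (\<forall>k. Ck_on k U g) \<and> (\<forall>y\<in>S \<inter> U. f y = g y)) \<Longrightarrow> smooth_on S f"
  by (simp add: smooth_on_def)

lemma smooth_onE:
  assumes "smooth_on S f" "x \<in> S"
  obtains U g where "open U" "x \<in> U" "\<And>k. Ck_on k U g" "\<And>y. y \<in> S \<Longrightarrow> y \<in> U \<Longrightarrow> f y = g y"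
proof -
  from assms have "\<exists>U g. open U \<and> x \<in> U \<and> (\<forall>k. Ck_on k U g) \<and> (\<forall>y\<in>S \<inter> U. f y = g y)"
    by (simp add: smooth_on_def)
  then obtain U g where *: "open U" "x \<in> U" "\<forall>k. Ck_on k U g" "\<forall>y\<in>S \<inter> U. f y = g y"
    by (elim exE conjE)
  show thesis
    by (rule that[of U g]) (use * in simp_all)
qed

lemma smooth_on_open_Ck: "open S \<Longrightarrow> smooth_on S f \<longleftrightarrow> (\<forall>k. Ck_on k S f)"
proof
  assume S: "open S" and f: "smooth_on S f"
  show "\<forall>k. Ck_on k S f"
  proof (intro allI Ck_on_local)
    fix k x assume "x \<in> S"
    with f obtain U g where "open U" "x \<in> U" "\<And>k. Ck_on k U g" "\<And>y. y \<in> S \<Longrightarrow> y \<in> U \<Longrightarrow> f y = g y"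
      by (rule smooth_onE) blast
    then show "\<exists>V. open V \<and> x \<in> V \<and> Ck_on k V f"
      using S \<open>x \<in> S\<close> Ck_on_cong[of "S \<inter> U" g f k] Ck_on_subset[of k U g "S \<inter> U"] by (intro exI[of _ "S \<inter> U"]) auto
  qed
qed (auto simp: smooth_on_def)

lemma smooth_on_cong: "smooth_on S f \<Longrightarrow> (\<And>x. x \<in> S \<Longrightarrow> f x = g x) \<Longrightarrow> smooth_on S g"
  unfolding smooth_on_def by (metis IntD1)

lemma smooth_on_subset: "smooth_on S f \<Longrightarrow> T \<subseteq> S \<Longrightarrow> smooth_on T f"
proof (rule smooth_onI)
  fix x assume S: "smooth_on S f" "T \<subseteq> S" and "x \<in> T"
  then have "x \<in> S" by auto
  with S(1) obtain U g where U: "open U" "x \<in> U" "\<And>k. Ck_on k U g" "\<And>y. y \<in> S \<Longrightarrow> y \<in> U \<Longrightarrow> f y = g y"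
    by (rule smooth_onE) blast
  show "\<exists>U g. open U \<and> x \<in> U \<and> (\<forall>k. Ck_on k U g) \<and> (\<forall>y\<in>T \<inter> U. f y = g y)"
    by (rule exI[of _ U], rule exI[of _ g]) (use U S(2) in auto)
qed

lemma smooth_on_local:
  assumes "\<And>x. x \<in> S \<Longrightarrow> \<exists>A. openin (top_of_set S) A \<and> x \<in> A \<and> smooth_on A f"
  shows "smooth_on S f"
proof (rule smooth_onI)
  fix x assume "x \<in> S"
  then obtain A where A: "openin (top_of_set S) A" "x \<in> A" "smooth_on A f" using assms by blast
  from A(1) obtain V where V: "open V" "A = S \<inter> V" by (auto simp: openin_open)
  from A(3,2) obtain U g where "open U" "x \<in> U" "\<And>k. Ck_on k U g" "\<And>y. y \<in> A \<Longrightarrow> y \<in> U \<Longrightarrow> f y = g y"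
    by (rule smooth_onE) blast
  then show "\<exists>U g. open U \<and> x \<in> U \<and> (\<forall>k. Ck_on k U g) \<and> (\<forall>y\<in>S \<inter> U. f y = g y)"
    using V A(2) Ck_on_subset[of _ U g "U \<inter> V"] by (intro exI[of _ "U \<inter> V"] exI[of _ g]) auto
qed

lemma smooth_on_continuous: "smooth_on S f \<Longrightarrow> continuous_on S f"
  unfolding continuous_on_eq_continuous_within
proof
  fix x assume "smooth_on S f" "x \<in> S"
  then obtain U g where U: "open U" "x \<in> U" "\<And>k. Ck_on k U g" "\<And>y. y \<in> S \<Longrightarrow> y \<in> U \<Longrightarrow> f y = g y"
    by (rule smooth_onE) blast
  then have "continuous (at x within S) g"
    by (metis Ck_on.simps(1) continuous_at_imp_continuous_at_within continuous_on_eq_continuous_at)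
  moreover have "eventually (\<lambda>y. f y = g y) (at x within S)"
    using U by (auto simp: eventually_at_topological)
  ultimately show "continuous (at x within S) f"
    using U(2,4) \<open>x \<in> S\<close> by (simp add: continuous_within tendsto_cong)
qed

lemma smooth_on_has_derivative_within:
  assumes "smooth_on S f" "x \<in> S"
  obtains D where "(f has_derivative D) (at x within S)"
proof -
  from assms obtain U g where U: "open U" "x \<in> U" "\<And>k. Ck_on k U g" "\<And>y. y \<in> S \<Longrightarrow> y \<in> U \<Longrightarrow> f y = g y"
    by (rule smooth_onE) blast
  then have "(g has_derivative frechet_derivative g (at x)) (at x within S)"
    by (meson Ck_on_Suc_derivative has_derivative_at_withinI)
  moreover obtain e where "e > 0" "ball x e \<subseteq> U" using U by (meson openE)
  ultimately have "(f has_derivative frechet_derivative g (at x)) (at x within S)"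
    using U(4) assms(2)
    by (elim has_derivative_transform_within[of _ _ _ _ e]) (auto simp: subset_eq dist_commute)
  then show thesis by (rule that)
qed

lemma smooth_on_has_derivative:
  assumes "smooth_on S f" "open S" "x \<in> S"
  shows "(f has_derivative frechet_derivative f (at x)) (at x)"
  using assms Ck_on_Suc_derivative[of 0 S f x] smooth_on_open_Ck by blast

lemma smooth_on_compose:
  fixes f :: "'a::euclidean_space \<Rightarrow> 'b::euclidean_space" and g :: "'b \<Rightarrow> 'c::real_normed_vector"
  assumes "smooth_on T g" "smooth_on S f" "f ` S \<subseteq> T"
  shows "smooth_on S (\<lambda>x. g (f x))"
proof (rule smooth_onI)
  fix x assume x: "x \<in> S"
  with assms(2) obtain U f' where U: "open U" "x \<in> U" "\<And>k. Ck_on k U f'" "\<And>y. y \<in> S \<Longrightarrow> y \<in> U \<Longrightarrow> f y = f' y"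
    by (rule smooth_onE) blast
  from x assms(3) have "f x \<in> T" by auto
  with assms(1) obtain V g' where V: "open V" "f x \<in> V" "\<And>k. Ck_on k V g'" "\<And>y. y \<in> T \<Longrightarrow> y \<in> V \<Longrightarrow> g y = g' y"
    by (rule smooth_onE) blast
  have op: "open (U \<inter> f' -` V)"
    using U(3)[of 0] U(1) V(1) by (simp add: continuous_open_preimage)
  show "\<exists>U h. open U \<and> x \<in> U \<and> (\<forall>k. Ck_on k U h) \<and> (\<forall>y\<in>S \<inter> U. g (f y) = h y)"
  proof (intro exI conjI allI ballI)
    show "Ck_on k (U \<inter> f' -` V) (\<lambda>x. g' (f' x))" for k
      by (rule Ck_on_compose[OF op V(1) _ Ck_on_subset[OF U(3)] V(3)]) auto
  qed (use op x U V assms(3) in auto)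
qed

lemma smooth_on_const: "smooth_on S (\<lambda>x. c)"
  using Ck_on_const by (intro smooth_onI exI[of _ UNIV]) auto

lemma smooth_on_bounded_linear: "bounded_linear L \<Longrightarrow> smooth_on S L"
  using Ck_on_bounded_linear by (intro smooth_onI exI[of _ UNIV]) auto

lemma smooth_on_linear:
  fixes L :: "'a::euclidean_space \<Rightarrow> 'b::real_normed_vector"
  shows "linear L \<Longrightarrow> smooth_on S L"
  by (intro smooth_on_bounded_linear) (simp add: linear_conv_bounded_linear)

lemma smooth_on_id: "smooth_on S (\<lambda>x. x)" "smooth_on S id"
  using smooth_on_bounded_linear[OF bounded_linear_ident] by (auto simp: id_def)

lemma smooth_on_linear_compose:
  fixes L :: "'b::euclidean_space \<Rightarrow> 'c::real_normed_vector"
  shows "linear L \<Longrightarrow> smooth_on S f \<Longrightarrow> smooth_on S (\<lambda>x. L (f x))"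
  by (rule smooth_on_compose[OF smooth_on_linear[of L UNIV]]) auto

text \<open>The local extensions of \<open>f\<close> and \<open>g\<close> live on different
  neighbourhoods; on the intersection the rule for open sets applies. Sums, products and pairs are
  all instances.\<close>

lemma smooth_on_binary:
  fixes f :: "'a::euclidean_space \<Rightarrow> 'b::real_normed_vector" and g :: "'a \<Rightarrow> 'c::real_normed_vector"
    and B :: "'b \<Rightarrow> 'c \<Rightarrow> 'd::real_normed_vector"
  assumes "smooth_on S f" "smooth_on S g"
    and B: "\<And>k (U :: 'a set) f g. open U \<Longrightarrow> Ck_on k U f \<Longrightarrow> Ck_on k U g \<Longrightarrow> Ck_on k U (\<lambda>x. B (f x) (g x))"
  shows "smooth_on S (\<lambda>x. B (f x) (g x))"
proof (rule smooth_onI)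
  fix x assume x: "x \<in> S"
  with assms(1) obtain U f' where U: "open U" "x \<in> U" "\<And>k. Ck_on k U f'" "\<And>y. y \<in> S \<Longrightarrow> y \<in> U \<Longrightarrow> f y = f' y"
    by (rule smooth_onE) blast
  from assms(2) x obtain V g' where V: "open V" "x \<in> V" "\<And>k. Ck_on k V g'" "\<And>y. y \<in> S \<Longrightarrow> y \<in> V \<Longrightarrow> g y = g' y"
    by (rule smooth_onE) blast
  show "\<exists>U h. open U \<and> x \<in> U \<and> (\<forall>k. Ck_on k U h) \<and> (\<forall>y\<in>S \<inter> U. B (f y) (g y) = h y)"
  proof (intro exI conjI allI ballI)
    show "Ck_on k (U \<inter> V) (\<lambda>x. B (f' x) (g' x))" for k
      by (rule B[OF open_Int[OF U(1) V(1)] Ck_on_subset[OF U(3)] Ck_on_subset[OF V(3)]]) auto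
  qed (use x U V in auto)
qed

lemma smooth_on_add: "smooth_on S f \<Longrightarrow> smooth_on S g \<Longrightarrow> smooth_on S (\<lambda>x. f x + g x)"
  by (rule smooth_on_binary) (auto intro: Ck_on_add)

lemma smooth_on_bilinear:
  "bounded_bilinear B \<Longrightarrow> smooth_on S f \<Longrightarrow> smooth_on S g \<Longrightarrow> smooth_on S (\<lambda>x. B (f x) (g x))"
  by (rule smooth_on_binary) (auto intro: Ck_on_bounded_bilinear)

lemma smooth_on_minus: "smooth_on S f \<Longrightarrow> smooth_on S (\<lambda>x. - f x)"
  using smooth_on_bilinear[OF bounded_bilinear_scaleR smooth_on_const, of S f "- 1"] by simp

lemma smooth_on_diff: "smooth_on S f \<Longrightarrow> smooth_on S g \<Longrightarrow> smooth_on S (\<lambda>x. f x - g x)"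
  using smooth_on_add[OF _ smooth_on_minus[of S g], of f] by simp

lemma smooth_on_sum: "(\<And>i. i \<in> I \<Longrightarrow> smooth_on S (f i)) \<Longrightarrow> smooth_on S (\<lambda>x. \<Sum>i\<in>I. f i x)"
  by (induction I rule: infinite_finite_induct) (auto intro: smooth_on_const smooth_on_add)

lemma Ck_on_Pair:
  assumes "open U" "Ck_on k U f" "Ck_on k U g" shows "Ck_on k U (\<lambda>x. (f x, g x))"
proof -
  have "Ck_on k U (\<lambda>x. (f x, 0) + (0, g x))"
    by (intro Ck_on_add Ck_on_bounded_linear_compose[of "\<lambda>x. (x, 0)"] assms
      Ck_on_bounded_linear_compose[of "\<lambda>x. (0, x)"] bounded_linear_Pair bounded_linear_ident bounded_linear_zero)
  then show ?thesis by simp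
qed

lemma smooth_on_Pair: "smooth_on S f \<Longrightarrow> smooth_on S g \<Longrightarrow> smooth_on S (\<lambda>x. (f x, g x))"
  by (rule smooth_on_binary[of S f g Pair]) (auto intro: Ck_on_Pair)

lemma smooth_on_fst:
  fixes f :: "'a::euclidean_space \<Rightarrow> 'b::euclidean_space \<times> 'c::euclidean_space"
  shows "smooth_on S f \<Longrightarrow> smooth_on S (\<lambda>x. fst (f x))"
  by (rule smooth_on_linear_compose[OF linear_fst])

lemma smooth_on_snd:
  fixes f :: "'a::euclidean_space \<Rightarrow> 'b::euclidean_space \<times> 'c::euclidean_space"
  shows "smooth_on S f \<Longrightarrow> smooth_on S (\<lambda>x. snd (f x))"
  by (rule smooth_on_linear_compose[OF linear_snd])

lemma smooth_on_vec_nth: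
  fixes f :: "'a::euclidean_space \<Rightarrow> 'b::euclidean_space ^ 'n::finite"
  shows "smooth_on S f \<Longrightarrow> smooth_on S (\<lambda>x. f x $ i)"
  by (rule smooth_on_linear_compose) (simp_all add: linear_iff)

lemma smooth_on_vec_lambda:
  fixes f :: "'n::finite \<Rightarrow> 'a::euclidean_space \<Rightarrow> 'b::euclidean_space"
  assumes "\<And>i. smooth_on S (f i)"
  shows "smooth_on S (\<lambda>x. \<chi> i. f i x)"
proof -
  have "smooth_on S (\<lambda>x. \<Sum>i\<in>UNIV. axis i (f i x))"
    by (intro smooth_on_sum smooth_on_linear_compose[of "axis _"] assms)
      (simp add: linear_iff axis_def vec_eq_iff)
  moreover have "(\<Sum>i\<in>UNIV. axis i (f i x)) = (\<chi> i. f i x)" for x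
    by (simp add: vec_eq_iff axis_def)
  ultimately show ?thesis by simp
qed

lemmas smooth_on_scaleR = smooth_on_bilinear[OF bounded_bilinear_scaleR]
  and smooth_on_mult = smooth_on_bilinear[OF bounded_bilinear_mult]
  and smooth_on_inner = smooth_on_bilinear[OF bounded_bilinear_inner]

section \<open>Elementary functions: exponential, reciprocal, logarithm, norm, quaternionic
  inverse\<close>

lemma Ck_on_exp: "Ck_on k UNIV (exp :: real \<Rightarrow> real)"
proof (induction k)
  case (Suc k)
  show ?case
  proof (rule Ck_on_Suc_intro)
    show "(exp has_derivative (\<lambda>v. exp x * v)) (at x)" for x :: real
      using DERIV_exp[of x] by (simp add: has_field_derivative_def)
    show "Ck_on k UNIV (\<lambda>x. exp x * v)" for v :: real
      by (rule Ck_on_bounded_linear_compose[OF bounded_linear_mult_left open_UNIV Suc])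
  qed simp
qed (simp add: continuous_on_exp)

lemma Ck_on_inverse: "Ck_on k (- {0}) (inverse :: real \<Rightarrow> real)"
proof (induction k)
  case (Suc k)
  show ?case
  proof (rule Ck_on_Suc_intro)
    show "(inverse has_derivative (\<lambda>v. - (inverse x * v * inverse x))) (at x)" if "x \<in> - {0}" for x :: real
      using that by (auto intro!: derivative_eq_intros)
    have "Ck_on k (- {0}) (\<lambda>x. (inverse x * inverse x) * - v)" for v :: real
      by (intro Ck_on_bounded_bilinear[OF bounded_bilinear_mult] Suc Ck_on_const) auto
    then show "Ck_on k (- {0}) (\<lambda>x. - (inverse x * v * inverse x))" for v :: real
      by (simp add: mult_ac)
  qed auto
qed (auto intro!: continuous_intros)

lemma Ck_on_ln: "Ck_on k {0<..} (ln :: real \<Rightarrow> real)"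
proof (cases k)
  case (Suc n)
  show ?thesis unfolding Suc
  proof (rule Ck_on_Suc_intro)
    show "(ln has_derivative (\<lambda>v. inverse x * v)) (at x)" if "x \<in> {0<..}" for x :: real
      using that by (auto intro!: derivative_eq_intros)
    show "Ck_on n {0<..} (\<lambda>x. inverse x * v)" for v :: real
      using Ck_on_subset[OF Ck_on_inverse] by (intro Ck_on_bounded_linear_compose[OF bounded_linear_mult_left]) auto
  qed simp
qed (auto intro!: continuous_intros)

lemma smooth_on_exp: "smooth_on S f \<Longrightarrow> smooth_on S (\<lambda>x. exp (f x :: real))"
  by (rule smooth_on_compose[of UNIV exp]) (auto simp: smooth_on_open_Ck intro: Ck_on_exp)

lemma smooth_on_inverse: "smooth_on S f \<Longrightarrow> (\<And>x. x \<in> S \<Longrightarrow> f x \<noteq> 0) \<Longrightarrow> smooth_on S (\<lambda>x. inverse (f x :: real))"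
  by (rule smooth_on_compose[of "- {0}" inverse])
    (auto simp: smooth_on_open_Ck[OF open_Compl[OF closed_singleton]] intro: Ck_on_inverse)

lemma smooth_on_ln: "smooth_on S f \<Longrightarrow> (\<And>x. x \<in> S \<Longrightarrow> f x > 0) \<Longrightarrow> smooth_on S (\<lambda>x. ln (f x :: real))"
  by (rule smooth_on_compose[of "{0<..}" ln]) (auto simp: smooth_on_open_Ck intro: Ck_on_ln)

lemma smooth_on_norm:
  fixes f :: "'a::euclidean_space \<Rightarrow> 'b::euclidean_space"
  assumes "smooth_on S f" "\<And>x. x \<in> S \<Longrightarrow> f x \<noteq> 0"
  shows "smooth_on S (\<lambda>x. norm (f x))"
proof (rule smooth_on_cong)
  \<comment> \<open>The square root is written through \<open>exp\<close> and \<open>ln\<close>,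
    whose smoothness is already known.\<close>
  show "smooth_on S (\<lambda>x. exp (1/2 * ln (f x \<bullet> f x)))"
    using assms by (intro smooth_on_exp smooth_on_mult smooth_on_const smooth_on_ln smooth_on_inner) auto
  show "exp (1/2 * ln (f x \<bullet> f x)) = norm (f x)" if "x \<in> S" for x
    using assms(2)[OF that] by (simp add: dot_square_norm ln_realpow)
qed

lemma smooth_on_quat_inverse:
  fixes f :: "'a::euclidean_space \<Rightarrow> quat"
  assumes "smooth_on S f" "\<And>x. x \<in> S \<Longrightarrow> f x \<noteq> 0"
  shows "smooth_on S (\<lambda>x. inverse (f x))"
proof -
  \<comment> \<open>The conjugate of a quaternion \<open>q\<close> is \<open>2 Re q - q\<close>,
    with \<open>Re q = q \<bullet> 1\<close>; dividing it by the squared norm expresses the inverse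
    through real-bilinear operations and one real reciprocal.\<close>
  have "smooth_on S (\<lambda>x. inverse (f x \<bullet> f x) *\<^sub>R (2 * (f x \<bullet> 1)) *\<^sub>R 1 - inverse (f x \<bullet> f x) *\<^sub>R f x)"
    using assms by (intro smooth_on_diff smooth_on_scaleR smooth_on_inverse smooth_on_inner
        smooth_on_mult smooth_on_const) auto
  moreover have "inverse q = inverse (q \<bullet> q) *\<^sub>R (2 * (q \<bullet> 1)) *\<^sub>R 1 - inverse (q \<bullet> q) *\<^sub>R q" for q :: quat
    by (simp add: inverse_quat_def quat_eq_iff quat_vector_defs one_quat_def inner_quat_def
        norm_quat_def algebra_simps)
  ultimately show ?thesis by simp
qed

section \<open>Smoothness of inverse maps\<close>

text \<open>The pointwise inverses are packed into one map:
  \<open>\<Psi> (x, u) = (x, A x u)\<close> is injective on an open set with inverse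
  \<open>G (x, v) = (x, B x v)\<close>, so differentiability of \<open>B\<close> follows from that
  of an inverse map, with no continuity of \<open>B\<close> assumed. The resulting formula,
  derivative of \<open>B\<close> equal to \<open>- B A' B\<close>, contains only \<open>B\<close>
  and the smooth \<open>A'\<close>, and hence raises the order of differentiability of
  \<open>B\<close> step by step.\<close>

lemma Ck_on_linear_inverse:
  fixes A B :: "'a::euclidean_space \<Rightarrow> 'b::euclidean_space \<Rightarrow> 'b"
  assumes U: "open U" and lin: "\<And>x. x \<in> U \<Longrightarrow> linear (A x)"
    and smooth: "\<And>v k. Ck_on k U (\<lambda>x. A x v)"
    and BA: "\<And>x v. x \<in> U \<Longrightarrow> B x (A x v) = v" and AB: "\<And>x v. x \<in> U \<Longrightarrow> A x (B x v) = v"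
  shows "Ck_on k U (\<lambda>x. B x v)"
proof -
  define A' where "A' x h b = frechet_derivative (\<lambda>x. A x b) (at x) h" for x h b
  have dA: "((\<lambda>x. A x b) has_derivative (\<lambda>h. A' x h b)) (at x)" if "x \<in> U" for x b
    unfolding A'_def using Ck_on_Suc_derivative[OF smooth that] .
  have linB: "linear (B x)" if "x \<in> U" for x
  proof (rule linearI)
    show "B x (u + v) = B x u + B x v" for u v
      using BA[OF that, of "B x u + B x v"] by (simp add: AB[OF that] linear_add[OF lin[OF that]])
    show "B x (c *\<^sub>R v) = c *\<^sub>R B x v" for c v
      using BA[OF that, of "c *\<^sub>R B x v"] by (simp add: AB[OF that] linear_scale[OF lin[OF that]])
  qed
  define \<Psi> where "\<Psi> p = (fst p, A (fst p) (snd p))" for p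
  define \<Psi>' where "\<Psi>' x u = (\<lambda>p. (fst p, (\<Sum>b\<in>Basis. (u \<bullet> b) *\<^sub>R A' x (fst p) b) + A x (snd p)))" for x u
  define G where "G p = (fst p, B (fst p) (snd p))" for p
  have d\<Psi>: "(\<Psi> has_derivative \<Psi>' x u) (at (x, u))" if x: "x \<in> U" for x u
  proof (rule has_derivative_transform_within_open)
    have d: "((\<lambda>p. A (fst p) b) has_derivative (\<lambda>h. A' x (fst h) b)) (at (x, u))" for b
      using has_derivative_compose[OF has_derivative_fst[OF has_derivative_ident], of "\<lambda>x. A x b" _ "(x, u)" UNIV] dA[OF x, of b]
      by auto
    have "((\<lambda>p. (fst p, \<Sum>b\<in>Basis. (snd p \<bullet> b) *\<^sub>R A (fst p) b)) has_derivative
      (\<lambda>p. (fst p, \<Sum>b\<in>Basis. (u \<bullet> b) *\<^sub>R A' x (fst p) b + (snd p \<bullet> b) *\<^sub>R A x b))) (at (x, u))"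
      by (auto intro!: derivative_eq_intros d)
    then show "((\<lambda>p. (fst p, \<Sum>b\<in>Basis. (snd p \<bullet> b) *\<^sub>R A (fst p) b)) has_derivative \<Psi>' x u) (at (x, u))"
      by (simp add: \<Psi>'_def sum.distrib linear_eq_sum_Basis[OF lin[OF x], symmetric])
    show "open (U \<times> (UNIV :: 'b set))" "(x, u) \<in> U \<times> UNIV" using U x by (auto intro: open_Times)
    show "(fst p, \<Sum>b\<in>Basis. (snd p \<bullet> b) *\<^sub>R A (fst p) b) = \<Psi> p" if "p \<in> U \<times> UNIV" for p
      using that linear_eq_sum_Basis[OF lin, of "fst p" "snd p"] by (auto simp: \<Psi>_def)
  qed
  have dB: "((\<lambda>x. B x v) has_derivative (\<lambda>h. - B x (\<Sum>b\<in>Basis. (B x v \<bullet> b) *\<^sub>R A' x h b))) (at x)"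
    if x: "x \<in> U" for x v
  proof -
    let ?u = "B x v"
    let ?G' = "\<lambda>p. (fst p, B x (snd p - (\<Sum>b\<in>Basis. (?u \<bullet> b) *\<^sub>R A' x (fst p) b)))"
    have "(G has_derivative ?G') (at (\<Psi> (x, ?u)))"
    proof (rule has_derivative_inverse_strong[where f = \<Psi> and x = "(x, ?u)"])
      show "open (U \<times> (UNIV :: 'b set))" "(x, ?u) \<in> U \<times> UNIV" using U x by (auto intro: open_Times)
      show "continuous_on (U \<times> UNIV) \<Psi>"
        by (intro continuous_at_imp_continuous_on ballI)
          (use d\<Psi> has_derivative_continuous in fastforce)
      show "G (\<Psi> p) = p" if "p \<in> U \<times> UNIV" for p
        using that by (auto simp: G_def \<Psi>_def BA)
      show "(\<Psi> has_derivative \<Psi>' x ?u) (at (x, ?u))" by (rule d\<Psi>[OF x])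
      show "\<Psi>' x ?u \<circ> ?G' = id" by (auto simp: \<Psi>'_def AB[OF x])
    qed
    then have "(G has_derivative ?G') (at (x, v))" by (simp add: \<Psi>_def AB[OF x])
    then have "((\<lambda>x. snd (G (x, v))) has_derivative (\<lambda>h. snd (?G' (h, 0)))) (at x)"
      by (intro has_derivative_snd has_derivative_compose[of "\<lambda>x. (x, v)" "\<lambda>h. (h, 0)" _ _ G])
        (auto intro!: derivative_eq_intros)
    then show ?thesis by (simp add: G_def linear_diff[OF linB[OF x]] linear_0[OF linB[OF x]]
      linear_neg[OF linB[OF x]])
  qed
  show ?thesis
  proof (induction k arbitrary: v)
    case 0
    have "isCont (\<lambda>x. B x v) x" if "x \<in> U" for x using dB[OF that] by (rule has_derivative_continuous)
    then show ?case by (simp add: continuous_at_imp_continuous_on)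
  next
    case (Suc k)
    show ?case
    proof (rule Ck_on_Suc_intro[OF U dB])
      fix h
      have A': "Ck_on k U (\<lambda>x. A' x h b)" for b
        using smooth[of "Suc k" b] unfolding A'_def by simp
      have "Ck_on k U (\<lambda>x. B x (\<Sum>b\<in>Basis. (B x v \<bullet> b) *\<^sub>R A' x h b))"
        by (rule Ck_on_apply[OF U linB Suc], assumption)
          (intro Ck_on_sum U Ck_on_bounded_bilinear[OF bounded_bilinear_scaleR]
            Ck_on_bounded_linear_compose[OF bounded_linear_inner_left] Suc A')
      then show "Ck_on k U (\<lambda>x. - B x (\<Sum>b\<in>Basis. (B x v \<bullet> b) *\<^sub>R A' x h b))"
        by (rule Ck_on_bounded_linear_compose[OF bounded_linear_minus[OF bounded_linear_ident] U])
    qed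
  qed
qed

text \<open>Injectivity is given globally by the left inverse \<open>g\<close>, so invariance of
  domain gives openness. The derivative of \<open>g\<close> at \<open>y\<close> is
  \<open>B (g y)\<close>, where \<open>B\<close> inverts the derivative of \<open>f\<close>; as
  \<open>B\<close> is smooth, \<open>g\<close> of class \<open>C^k\<close> makes its derivative of
  class \<open>C^k\<close>, and the order increases.\<close>

lemma smooth_on_inverse_map:
  fixes f :: "'a::euclidean_space \<Rightarrow> 'a"
  assumes U: "open U" and f: "smooth_on U f" and gf: "\<And>x. x \<in> U \<Longrightarrow> g (f x) = x"
    and inj: "\<And>x. x \<in> U \<Longrightarrow> inj (frechet_derivative f (at x))"
  shows "open (f ` U)" "smooth_on (f ` U) g"
proof -
  have "inj_on f U" using gf by (rule inj_on_inverseI)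
  with U f show op: "open (f ` U)"
    by (intro invariance_of_domain smooth_on_continuous)
  let ?f' = "\<lambda>x. frechet_derivative f (at x)"
  have df: "(f has_derivative ?f' x) (at x)" if "x \<in> U" for x
    using f U that by (rule smooth_on_has_derivative)
  have lin: "linear (?f' x)" if "x \<in> U" for x
    using df[OF that] by (rule has_derivative_linear)
  define B where "B x = inv (?f' x)" for x
  have BA: "B x (?f' x v) = v" if "x \<in> U" for x v
    unfolding B_def using inj[OF that] by simp
  have AB: "?f' x (B x v) = v" if "x \<in> U" for x v
    unfolding B_def using linear_inj_imp_surj[OF lin[OF that] inj[OF that]] by (simp add: surj_f_inv_f)
  have B: "Ck_on k U (\<lambda>x. B x v)" for k v
  proof (rule Ck_on_linear_inverse[OF U lin _ BA AB])
    show "Ck_on k U (\<lambda>x. ?f' x v)" for k v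
      using f smooth_on_open_Ck[OF U, of f] Ck_on.simps(2) by blast
  qed
  have dg: "(g has_derivative B (g y)) (at y)" if "y \<in> f ` U" for y
  proof -
    from that obtain x where x: "x \<in> U" "y = f x" by auto
    have "(g has_derivative B x) (at (f x))"
      by (rule has_derivative_inverse_strong[OF U x(1) smooth_on_continuous[OF f] gf df[OF x(1)]])
        (auto simp: AB x)
    then show ?thesis using x gf by simp
  qed
  have "Ck_on k (f ` U) g" for k
  proof (induction k)
    case 0
    have "isCont g x" if "x \<in> f ` U" for x using dg[OF that] by (rule has_derivative_continuous)
    then show ?case by (simp add: continuous_at_imp_continuous_on)
  next
    case (Suc k)
    show ?case
      by (rule Ck_on_Suc_intro[OF op dg Ck_on_compose[OF op U _ Suc B]]) (use gf in auto)
  qed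
  then show "smooth_on (f ` U) g" by (simp add: smooth_on_open_Ck[OF op])
qed

section \<open>Derivatives and inverse maps along linear subspaces\<close>

lemma orthogonal_projection:
  fixes W :: "'a::euclidean_space set"
  assumes "subspace W"
  obtains P where "linear P" "\<And>x. P x \<in> W" "\<And>x. x \<in> W \<Longrightarrow> P x = x"
    "\<And>x w. w \<in> W \<Longrightarrow> (x - P x) \<bullet> w = 0"
proof -
  obtain B where B: "B \<subseteq> W" "pairwise orthogonal B" "\<And>x. x \<in> B \<Longrightarrow> norm x = 1"
    "independent B" "span B = W"
    using orthonormal_basis_subspace[OF assms] by metis
  have fin: "finite B" using B(4) independent_imp_finite by blast
  define P where "P x = (\<Sum>b\<in>B. (x \<bullet> b) *\<^sub>R b)" for x
  have PW: "P x \<in> W" for x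
    unfolding P_def using B(1) assms by (intro subspace_sum subspace_scale) auto
  have orth: "(x - P x) \<bullet> w = 0" if "w \<in> W" for x w
  proof -
    have "(x - P x) \<bullet> b = 0" if b: "b \<in> B" for b
    proof -
      have "P x \<bullet> b = (\<Sum>c\<in>B. if c = b then x \<bullet> b else 0)"
        unfolding P_def inner_sum_left
      proof (rule sum.cong[OF refl])
        fix c assume c: "c \<in> B"
        show "(x \<bullet> c) *\<^sub>R c \<bullet> b = (if c = b then x \<bullet> b else 0)"
          using B(2)[unfolded pairwise_def] B(3)[OF b] b c
          by (auto simp: orthogonal_def dot_square_norm)
      qed
      then show ?thesis using b fin by (simp add: inner_diff_left)
    qed
    then have "span B \<subseteq> {w. (x - P x) \<bullet> w = 0}"
      by (intro span_minimal subspace_hyperplane) auto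
    then show ?thesis using that B(5) by auto
  qed
  show thesis
  proof (rule that[of P])
    show "linear P"
      by (rule linearI) (simp_all add: P_def inner_add_left scaleR_left_distrib sum.distrib scaleR_sum_right)
    show "P x = x" if "x \<in> W" for x
      using orth[of "x - P x" x] that PW assms subspace_diff by fastforce
  qed (use PW orth in auto)
qed

text \<open>Composing with the projection onto \<open>W\<close> does not change \<open>f\<close>
  near \<open>x\<close>, so uniqueness of derivatives gives \<open>D = P \<circ> D\<close>.\<close>

lemma has_derivative_in_subspace:
  fixes f :: "'a::real_normed_vector \<Rightarrow> 'b::euclidean_space"
  assumes "(f has_derivative D) (at x)" "open G" "x \<in> G" "\<And>y. y \<in> G \<Longrightarrow> f y \<in> W" "subspace W"
  shows "D v \<in> W"
proof -
  obtain P where P: "linear P" "\<And>x. P x \<in> W" "\<And>x. x \<in> W \<Longrightarrow> P x = x"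
    by (rule orthogonal_projection[OF assms(5)]) blast
  have "((\<lambda>x. P (f x)) has_derivative (\<lambda>v. P (D v))) (at x)"
    by (rule bounded_linear.has_derivative[OF _ assms(1)])
      (use P(1) in \<open>simp add: linear_conv_bounded_linear\<close>)
  then have "(f has_derivative (\<lambda>v. P (D v))) (at x)"
    by (rule has_derivative_transform_within_open[OF _ assms(2,3)]) (simp add: assms(4) P(3))
  then have "D = (\<lambda>v. P (D v))" by (rule has_derivative_unique[OF assms(1)])
  then show ?thesis by (metis P(2))
qed

text \<open>A derivative within a subset of \<open>W\<close> is determined only in the directions of
  \<open>W\<close>. For such \<open>v\<close> the line \<open>w + t v\<close> stays in
  \<open>A\<close> for small \<open>t\<close>, and restriction to it reduces the claim to uniqueness
  on the real line.\<close>

lemma has_derivative_within_subspace_unique: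
  fixes f :: "'a::euclidean_space \<Rightarrow> 'b::real_normed_vector"
  assumes "(f has_derivative D) (at w within A)" "(f has_derivative D') (at w within A)"
    and "openin (top_of_set W) A" "subspace W" "w \<in> A" "v \<in> W"
  shows "D v = D' v"
proof -
  obtain e where e: "e > 0" "ball w e \<inter> W \<subseteq> A"
    using assms(3,5) by (auto simp: openin_contains_ball)
  have wW: "w \<in> W" using assms(3,5) openin_imp_subset by blast
  define c where "c t = w + t *\<^sub>R v" for t :: real
  \<comment> \<open>The summand 1 keeps the quotient meaningful when \<open>v = 0\<close>.\<close>
  define \<delta> where "\<delta> = e / (norm v + 1)"
  have \<delta>: "\<delta> > 0" using e by (simp add: \<delta>_def add_nonneg_pos)
  have cA: "c t \<in> A" if "t \<in> ball 0 \<delta>" for t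
  proof -
    have "\<bar>t\<bar> * (norm v + 1) < e"
      using that by (simp add: \<delta>_def pos_less_divide_eq add_nonneg_pos)
    then have "\<bar>t\<bar> * norm v < e" by (simp add: algebra_simps)
    moreover have "c t \<in> W" unfolding c_def using assms(4,6) wW by (intro subspace_add subspace_scale)
    ultimately show ?thesis using e(2) by (auto simp: c_def dist_norm)
  qed
  have *: "((\<lambda>t. f (c t)) has_derivative (\<lambda>t. E (t *\<^sub>R v))) (at 0)"
    if "(f has_derivative E) (at w within A)" for E
  proof -
    have "(c has_derivative (\<lambda>t. t *\<^sub>R v)) (at 0 within ball 0 \<delta>)"
      unfolding c_def by (auto intro!: derivative_eq_intros)
    moreover have "(f has_derivative E) (at (c 0) within c ` ball 0 \<delta>)"
    proof -
      have "c 0 = w" by (simp add: c_def)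
      moreover have "c ` ball 0 \<delta> \<subseteq> A" using cA by blast
      ultimately show ?thesis using has_derivative_subset[OF that, of "c ` ball 0 \<delta>"] by simp
    qed
    ultimately have "((\<lambda>t. f (c t)) has_derivative (\<lambda>t. E (t *\<^sub>R v))) (at 0 within ball 0 \<delta>)"
      by (rule has_derivative_in_compose)
    then show ?thesis using \<delta> at_within_open[of "0 :: real" "ball 0 \<delta>"] by simp
  qed
  have "(\<lambda>t. D (t *\<^sub>R v)) = (\<lambda>t. D' (t *\<^sub>R v))"
    using *[OF assms(1)] *[OF assms(2)] by (rule has_derivative_unique)
  then show ?thesis by (metis scaleR_one)
qed

lemma at_within_openin:
  fixes w :: "'a::topological_space"
  assumes "openin (top_of_set S) A" "w \<in> A"
  shows "at w within A = at w within S"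
proof -
  obtain T where "open T" "A = S \<inter> T" using assms(1) by (auto simp: openin_open)
  then show ?thesis using assms(2) at_within_nhd[of w T A S] by auto
qed

text \<open>Both subspaces have the same dimension in one ambient space, hence so have their
  orthogonal complements. An isometry \<open>L\<close> between the complements extends
  \<open>\<tau>\<close> to a map \<open>\<Theta>\<close> of open sets, to which the inverse function
  theorem applies; its inverse restricts to \<open>\<kappa>\<close>.\<close>

lemma smooth_on_inverse_map_subspace:
  fixes \<tau> :: "'a::euclidean_space \<Rightarrow> 'a"
  assumes W: "subspace W" "subspace W'" "dim W = dim W'" and A: "openin (top_of_set W) A"
    and \<tau>: "smooth_on A \<tau>" "\<tau> ` A \<subseteq> W'" "\<And>w. w \<in> A \<Longrightarrow> \<kappa> (\<tau> w) = w"
    and D: "\<And>w. w \<in> A \<Longrightarrow> \<exists>D. (\<tau> has_derivative D) (at w within A) \<and> W' \<subseteq> D ` W"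
  shows "smooth_on (\<tau> ` A) \<kappa>"
proof -
  obtain P where P: "linear P" "\<And>x. P x \<in> W" "\<And>x. x \<in> W \<Longrightarrow> P x = x"
    "\<And>x w. w \<in> W \<Longrightarrow> (x - P x) \<bullet> w = 0" by (rule orthogonal_projection[OF W(1)]) blast
  obtain P' where P': "linear P'" "\<And>x. P' x \<in> W'" "\<And>x. x \<in> W' \<Longrightarrow> P' x = x"
    "\<And>x w. w \<in> W' \<Longrightarrow> (x - P' x) \<bullet> w = 0" by (rule orthogonal_projection[OF W(2)]) blast
  define K where "K = {y \<in> UNIV. \<forall>x \<in> W. orthogonal x y}"
  define K' where "K' = {y \<in> UNIV. \<forall>x \<in> W'. orthogonal x y}"
  have K: "subspace K" "subspace K'"
    by (auto simp: K_def K'_def subspace_def orthogonal_clauses)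
  have "dim K + dim W = DIM('a)" "dim K' + dim W' = DIM('a)"
    unfolding K_def K'_def
    using dim_subspace_orthogonal_to_vectors[OF W(1) subspace_UNIV]
      dim_subspace_orthogonal_to_vectors[OF W(2) subspace_UNIV] by auto
  then have "dim K = dim K'" using W(3) by simp
  then obtain L L' where L: "linear L" "linear L'" "L ` K = K'" "L' ` K' = K" "\<And>x. x \<in> K \<Longrightarrow> L' (L x) = x"
    using isometries_subspaces[OF K] by metis
  have PK: "x - P x \<in> K" for x using P(4) by (auto simp: K_def orthogonal_def inner_commute)
  have PK': "x - P' x \<in> K'" for x using P'(4) by (auto simp: K'_def orthogonal_def inner_commute)
  have P'0: "P' y = 0" if "y \<in> K'" for y
  proof -
    have "(y - P' y) \<bullet> P' y = 0" "P' y \<bullet> y = 0" using P'(2,4) that by (auto simp: K'_def orthogonal_def)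
    then have "P' y \<bullet> P' y = 0" by (simp only: inner_diff_left inner_commute[of y])
    then show ?thesis by simp
  qed
  have P0: "P y = 0" if "y \<in> K" for y
  proof -
    have "(y - P y) \<bullet> P y = 0" "P y \<bullet> y = 0" using P(2,4) that by (auto simp: K_def orthogonal_def)
    then have "P y \<bullet> P y = 0" by (simp only: inner_diff_left inner_commute[of y])
    then show ?thesis by simp
  qed
  \<comment> \<open>The open cylinder over \<open>A\<close> in the direction of the
    complement.\<close>
  define U where "U = P -` A"
  define \<Theta> where "\<Theta> z = \<tau> (P z) + L (z - P z)" for z
  define g where "g y = \<kappa> (P' y) + L' (y - P' y)" for y
  obtain T where T: "open T" "A = W \<inter> T" using A by (auto simp: openin_open)
  have U: "open U"
  proof -
    have "U = P -` T" unfolding U_def T(2) using P(2) by auto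
    then show ?thesis using T(1) P(1) by (simp add: linear_continuous_at linear_conv_bounded_linear open_vimage linear_continuous_on)
  qed
  have linP: "linear (\<lambda>x. x - P x)" using P(1) by (simp add: linear_compose_sub linear_id[unfolded id_def])
  have \<Theta>: "smooth_on U \<Theta>" unfolding \<Theta>_def
    by (intro smooth_on_add smooth_on_compose[OF \<tau>(1)] smooth_on_linear[OF P(1)]
        smooth_on_linear_compose[OF L(1)] smooth_on_linear[OF linP]) (auto simp: U_def)
  have P'\<Theta>: "P' (\<Theta> z) = \<tau> (P z)" if "z \<in> U" for z
  proof -
    have "P' (L (z - P z)) = 0" using P'0 L(3) PK by blast
    moreover have "\<tau> (P z) \<in> W'" using that \<tau>(2) by (auto simp: U_def)
    ultimately show ?thesis by (simp add: \<Theta>_def linear_add[OF P'(1)] P'(3))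
  qed
  have g\<Theta>: "g (\<Theta> z) = z" if "z \<in> U" for z
  proof -
    have "\<Theta> z - P' (\<Theta> z) = L (z - P z)" by (simp add: P'\<Theta>[OF that]) (simp add: \<Theta>_def)
    then show ?thesis using that by (simp add: g_def P'\<Theta> L(5)[OF PK] \<tau>(3) U_def)
  qed
  have inj: "inj (frechet_derivative \<Theta> (at z))" if z: "z \<in> U" for z
  proof -
    have "P z \<in> A" using z by (simp add: U_def)
    then obtain D where D: "(\<tau> has_derivative D) (at (P z) within A)" "W' \<subseteq> D ` W" using D by blast
    let ?\<Theta>' = "\<lambda>h. D (P h) + L (h - P h)"
    have dP: "(P has_derivative P) (at z within U)"
      using P(1) by (intro bounded_linear_imp_has_derivative) (simp add: linear_conv_bounded_linear)
    have "((\<lambda>z. \<tau> (P z)) has_derivative (\<lambda>h. D (P h))) (at z within U)"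
      by (rule has_derivative_in_compose[OF dP]) (rule has_derivative_subset[OF D(1)], auto simp: U_def)
    then have "(\<Theta> has_derivative ?\<Theta>') (at z within U)"
      unfolding \<Theta>_def using L(1) P(1)
      by (intro has_derivative_add bounded_linear.has_derivative[of L]
           has_derivative_diff has_derivative_ident dP) (simp_all add: linear_conv_bounded_linear)
    then have d: "(\<Theta> has_derivative ?\<Theta>') (at z)" by (simp only: at_within_open[OF z U])
    \<comment> \<open>The part of \<open>y\<close> in \<open>W'\<close> is hit by \<open>D\<close>
      on \<open>W\<close>, the complementary part by \<open>L\<close> on \<open>K\<close>.
      Surjectivity of an endomorphism then gives injectivity.\<close>
    have "\<exists>h. y = ?\<Theta>' h" for y
    proof -
      obtain w where w: "w \<in> W" "D w = P' y" using D(2) P'(2)[of y] by (metis imageE subsetD)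
      obtain v where v: "v \<in> K" "L v = y - P' y" using PK'[of y] L(3) by (metis imageE)
      have "P (w + v) = w" using w v by (simp add: linear_add[OF P(1)] P(3) P0)
      then have "y = ?\<Theta>' (w + v)" using w v by simp
      then show ?thesis ..
    qed
    then have "surj ?\<Theta>'" unfolding surj_def by (rule allI)
    moreover have "linear ?\<Theta>'" using d by (rule has_derivative_linear)
    ultimately have "inj ?\<Theta>'" by (rule linear_surj_imp_inj[rotated])
    then show ?thesis using frechet_derivative_at[OF d] by simp
  qed
  have "smooth_on (\<Theta> ` U) g" by (rule smooth_on_inverse_map(2)[OF U \<Theta> g\<Theta> inj])
  moreover have "\<tau> ` A \<subseteq> \<Theta> ` U"
  proof
    fix y assume "y \<in> \<tau> ` A"
    then obtain a where a: "a \<in> A" "y = \<tau> a" by auto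
    then have "P a = a" using P(3) T by auto
    then have "\<Theta> a = y" "a \<in> U" using a by (auto simp: \<Theta>_def U_def linear_0[OF L(1)])
    then show "y \<in> \<Theta> ` U" by blast
  qed
  ultimately have "smooth_on (\<tau> ` A) g" by (rule smooth_on_subset)
  then show ?thesis
    by (rule smooth_on_cong) (use \<tau>(2) P'(3) in \<open>auto simp: g_def linear_0[OF L(2)]\<close>)
qed

section \<open>Charts\<close>

lemma is_chartE:
  assumes "is_chart d X U \<phi>"
  obtains W where "openin X U" "subspace W" "dim W = d" "openin (top_of_set W) (\<phi> ` U)" "inj_on \<phi> U"
    "continuous_map (subtopology X U) euclidean \<phi>" "continuous_map (top_of_set (\<phi> ` U)) X (inv_into U \<phi>)"
    "\<And>V. openin X V \<Longrightarrow> V \<subseteq> U \<Longrightarrow> openin (top_of_set (\<phi> ` U)) (\<phi> ` V)"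
proof -
  from assms obtain W where U: "openin X U" and W: "subspace W" "dim W = d" "openin (top_of_set W) (\<phi> ` U)"
    and h: "homeomorphic_map (subtopology X U) (top_of_set (\<phi> ` U)) \<phi>"
    by (auto simp: is_chart_def)
  have ts: "topspace (subtopology X U) = U" using openin_subset[OF U] by auto
  have inj: "inj_on \<phi> U" using homeomorphic_imp_injective_map[OF h] by (simp only: ts)
  show thesis
  proof (rule that[OF U W inj])
    show "continuous_map (subtopology X U) euclidean \<phi>"
      using homeomorphic_imp_continuous_map[OF h] continuous_map_in_subtopology by blast
    obtain g where g: "homeomorphic_maps (subtopology X U) (top_of_set (\<phi> ` U)) \<phi> g"
      using h homeomorphic_map_maps by blast
    then have "continuous_map (top_of_set (\<phi> ` U)) X g"
      by (auto simp: homeomorphic_maps_def continuous_map_in_subtopology)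
    then show "continuous_map (top_of_set (\<phi> ` U)) X (inv_into U \<phi>)"
    proof (rule continuous_map_eq)
      show "g y = inv_into U \<phi> y" if "y \<in> topspace (top_of_set (\<phi> ` U))" for y
        using that g inj unfolding homeomorphic_maps_def ts by auto
    qed
    show "openin (top_of_set (\<phi> ` U)) (\<phi> ` V)" if "openin X V" "V \<subseteq> U" for V
      using homeomorphic_imp_open_map[OF h] that U by (simp add: open_map_def openin_open_subtopology)
  qed
qed

lemma is_chartI:
  assumes "openin X U" "subspace W" "dim W = d" "openin (top_of_set W) (\<phi> ` U)" "inj_on \<phi> U"
    "continuous_map (subtopology X U) euclidean \<phi>" "continuous_map (top_of_set (\<phi> ` U)) X (inv_into U \<phi>)"
  shows "is_chart d X U \<phi>"
proof -
  have ts: "topspace (subtopology X U) = U" using openin_subset[OF assms(1)] by auto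
  have "homeomorphic_maps (subtopology X U) (top_of_set (\<phi> ` U)) \<phi> (inv_into U \<phi>)"
    unfolding homeomorphic_maps_def ts
    using assms(5-7) by (auto simp: continuous_map_in_subtopology inv_into_into f_inv_into_f ts)
  then show ?thesis
    unfolding is_chart_def using assms(1-4) homeomorphic_map_maps by blast
qed

text \<open>The change of coordinates is continuous and injective on a nonempty relatively open
  subset of one subspace and takes values in the other; invariance of dimension compares
  them.\<close>

lemma is_chart_dim_le:
  assumes U: "is_chart d X U \<phi>" and V: "is_chart d' X V \<psi>" and x: "x \<in> U" "x \<in> V"
  shows "d \<le> d'"
proof -
  obtain W where W: "openin X U" "subspace W" "dim W = d" "openin (top_of_set W) (\<phi> ` U)" "inj_on \<phi> U"
    "continuous_map (top_of_set (\<phi> ` U)) X (inv_into U \<phi>)"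
    "\<And>V. openin X V \<Longrightarrow> V \<subseteq> U \<Longrightarrow> openin (top_of_set (\<phi> ` U)) (\<phi> ` V)"
    using U by (rule is_chartE) blast
  obtain W' where W': "openin X V" "subspace W'" "dim W' = d'" "openin (top_of_set W') (\<psi> ` V)" "inj_on \<psi> V"
    "continuous_map (subtopology X V) euclidean \<psi>"
    using V by (rule is_chartE) blast
  let ?A = "\<phi> ` (U \<inter> V)" and ?\<tau> = "\<lambda>w. \<psi> (inv_into U \<phi> w)"
  have inv: "inv_into U \<phi> (\<phi> u) = u" if "u \<in> U" for u using that W(5) by simp
  have "dim W \<le> dim W'"
  proof (rule invariance_of_dimension_subspaces)
    show "openin (top_of_set W) ?A"
      using W(7)[of "U \<inter> V"] W(1,4) W'(1) openin_trans by blast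
    have "continuous_map (top_of_set ?A) (subtopology X V) (inv_into U \<phi>)"
      using W(6) inv by (auto simp: continuous_map_in_subtopology
        intro: continuous_map_from_subtopology_mono)
    then have "continuous_map (top_of_set ?A) euclidean ?\<tau>"
      using continuous_map_compose[OF _ W'(6)] unfolding o_def by blast
    then show "continuous_on ?A ?\<tau>" by simp
    show "?\<tau> \<in> ?A \<rightarrow> W'" using W'(4) openin_imp_subset inv by fastforce
    show "inj_on ?\<tau> ?A" using inv W'(5) by (auto simp: inj_on_def)
    show "?A \<noteq> {}" using x by auto
  qed (use W W' in auto)
  then show ?thesis using W W' by simp
qed

text \<open>The atlases of submanifolds and quotients do not fix the dimension of their charts; at a
  point shared with a chart of dimension \<open>d'\<close> it is forced. An empty chart has no such
  point, and \<open>W\<close> serves to give it the dimension \<open>d'\<close>.\<close>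

lemma is_chart_change_dim:
  fixes \<phi> :: "'p \<Rightarrow> 'e::euclidean_space" and W :: "'e set"
  assumes "is_chart d X U \<phi>" and "subspace W" "dim W = d'"
    and "\<And>x. x \<in> U \<Longrightarrow> \<exists>V (\<psi> :: 'p \<Rightarrow> 'e). x \<in> V \<and> is_chart d' X V \<psi>"
  shows "is_chart d' X U \<phi>"
proof (cases "U = {}")
  case True
  then show ?thesis using assms(2,3) by (intro is_chartI[of _ _ W]) auto
next
  case False
  then obtain x where x: "x \<in> U" by auto
  then obtain V and \<psi> :: "'p \<Rightarrow> 'e" where V: "x \<in> V" "is_chart d' X V \<psi>" using assms(4) by metis
  have "d = d'"
    using is_chart_dim_le[OF assms(1) V(2) x V(1)] is_chart_dim_le[OF V(2) assms(1) V(1) x] by simp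
  then show ?thesis using assms(1) by simp
qed

section \<open>Manifolds presented by open sets\<close>

text \<open>This expresses that \<open>p\<close> is a surjective submersion from an open set, by
  means of sections. The last equation matters: there is a section through every point
  \<open>x\<close> of \<open>S\<close>, not only one over every point of the manifold. That is what
  makes \<open>p\<close> open and its differential surjective at each \<open>x\<close>.\<close>

definition presented ::
  "('p, 'e::euclidean_space) charted_space \<Rightarrow> 'a::euclidean_space set \<Rightarrow> ('a \<Rightarrow> 'p) \<Rightarrow> nat \<Rightarrow> bool"
  where
  "presented M S p d \<longleftrightarrow> open S \<and> continuous_map (top_of_set S) (mtop M) p \<and>
     p ` S = topspace (mtop M) \<and> (\<Union>(U, \<phi>)\<in>charts M. U) = topspace (mtop M) \<and>
     (\<forall>(U, \<phi>)\<in>charts M. is_chart d (mtop M) U \<phi> \<and> smooth_on (S \<inter> p -` U) (\<lambda>x. \<phi> (p x)) \<and>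
       (\<forall>x\<in>S \<inter> p -` U. \<exists>A \<sigma>. openin (top_of_set (\<phi> ` U)) A \<and> \<phi> (p x) \<in> A \<and>
          smooth_on A \<sigma> \<and> \<sigma> ` A \<subseteq> S \<and> (\<forall>w\<in>A. p (\<sigma> w) = inv_into U \<phi> w) \<and> \<sigma> (\<phi> (p x)) = x))"

lemma presentedI:
  assumes "open S" "continuous_map (top_of_set S) (mtop M) p" "p ` S = topspace (mtop M)"
    and "\<And>y. y \<in> topspace (mtop M) \<Longrightarrow> \<exists>U \<phi>. (U, \<phi>) \<in> charts M \<and> y \<in> U"
    and "\<And>U \<phi>. (U, \<phi>) \<in> charts M \<Longrightarrow> is_chart d (mtop M) U \<phi>"
    and "\<And>U \<phi>. (U, \<phi>) \<in> charts M \<Longrightarrow> smooth_on (S \<inter> p -` U) (\<lambda>x. \<phi> (p x))"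
    and "\<And>U \<phi> x. (U, \<phi>) \<in> charts M \<Longrightarrow> x \<in> S \<Longrightarrow> p x \<in> U \<Longrightarrow>
      \<exists>A \<sigma>. openin (top_of_set (\<phi> ` U)) A \<and> \<phi> (p x) \<in> A \<and>
          smooth_on A \<sigma> \<and> \<sigma> ` A \<subseteq> S \<and> (\<forall>w\<in>A. p (\<sigma> w) = inv_into U \<phi> w) \<and> \<sigma> (\<phi> (p x)) = x"
  shows "presented M S p d"
proof -
  have "U \<subseteq> topspace (mtop M)" if "(U, \<phi>) \<in> charts M" for U \<phi>
    using assms(5)[OF that] by (auto simp: is_chart_def dest: openin_subset)
  then have "(\<Union>(U, \<phi>)\<in>charts M. U) = topspace (mtop M)" using assms(4) by fastforce
  then show ?thesis
    unfolding presented_def using assms by (intro conjI ballI) auto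
qed

lemma presented_chart:
  assumes "presented M S p d" "(U, \<phi>) \<in> charts M"
  shows "is_chart d (mtop M) U \<phi> \<and> smooth_on (S \<inter> p -` U) (\<lambda>x. \<phi> (p x)) \<and>
       (\<forall>x\<in>S \<inter> p -` U. \<exists>A \<sigma>. openin (top_of_set (\<phi> ` U)) A \<and> \<phi> (p x) \<in> A \<and>
          smooth_on A \<sigma> \<and> \<sigma> ` A \<subseteq> S \<and> (\<forall>w\<in>A. p (\<sigma> w) = inv_into U \<phi> w) \<and> \<sigma> (\<phi> (p x)) = x)"
  using assms(1) unfolding presented_def
  by (elim conjE) (drule bspec[OF _ assms(2)], unfold prod.case)

lemma presentedD:
  assumes "presented M S p d"
  shows "open S" "continuous_map (top_of_set S) (mtop M) p" "p ` S = topspace (mtop M)"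
    and "\<And>y. y \<in> topspace (mtop M) \<Longrightarrow> \<exists>U \<phi>. (U, \<phi>) \<in> charts M \<and> y \<in> U"
    and "\<And>U \<phi>. (U, \<phi>) \<in> charts M \<Longrightarrow> is_chart d (mtop M) U \<phi>"
    and "\<And>U \<phi>. (U, \<phi>) \<in> charts M \<Longrightarrow> smooth_on (S \<inter> p -` U) (\<lambda>x. \<phi> (p x))"
proof -
  note * = assms[unfolded presented_def]
  from * show "open S" by (elim conjE)
  from * show "continuous_map (top_of_set S) (mtop M) p" by (elim conjE)
  from * show "p ` S = topspace (mtop M)" by (elim conjE)
  show "\<exists>U \<phi>. (U, \<phi>) \<in> charts M \<and> y \<in> U" if "y \<in> topspace (mtop M)" for y
  proof -
    have "y \<in> (\<Union>(U, \<phi>)\<in>charts M. U)" using * that by simp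
    then show ?thesis by auto
  qed
  fix U \<phi> assume "(U, \<phi>) \<in> charts M"
  from presented_chart[OF assms this]
  show "is_chart d (mtop M) U \<phi>" and "smooth_on (S \<inter> p -` U) (\<lambda>x. \<phi> (p x))"
    by (simp_all only: simp_thms)
qed

lemma presented_chart_open:
  assumes "presented M S p d" "(U, \<phi>) \<in> charts M"
  shows "openin (mtop M) U" "inj_on \<phi> U" "U \<subseteq> p ` S"
proof -
  show U: "openin (mtop M) U" "inj_on \<phi> U"
    using presentedD(5)[OF assms] by (auto elim: is_chartE)
  show "U \<subseteq> p ` S" using openin_subset[OF U(1)] presentedD(3)[OF assms(1)] by simp
qed

lemma presented_section:
  assumes "presented M S p d" "(U, \<phi>) \<in> charts M" "x \<in> S" "p x \<in> U"
  obtains A \<sigma> where "openin (top_of_set (\<phi> ` U)) A" "\<phi> (p x) \<in> A" "smooth_on A \<sigma>" "\<sigma> ` A \<subseteq> S"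
    "\<And>w. w \<in> A \<Longrightarrow> p (\<sigma> w) = inv_into U \<phi> w" "\<sigma> (\<phi> (p x)) = x"
proof -
  have "\<forall>x\<in>S \<inter> p -` U. \<exists>A \<sigma>. openin (top_of_set (\<phi> ` U)) A \<and> \<phi> (p x) \<in> A \<and>
      smooth_on A \<sigma> \<and> \<sigma> ` A \<subseteq> S \<and> (\<forall>w\<in>A. p (\<sigma> w) = inv_into U \<phi> w) \<and> \<sigma> (\<phi> (p x)) = x"
    using presented_chart[OF assms(1,2)] by (elim conjE)
  moreover have "x \<in> S \<inter> p -` U" using assms(3,4) by simp
  ultimately have "\<exists>A \<sigma>. openin (top_of_set (\<phi> ` U)) A \<and> \<phi> (p x) \<in> A \<and>
      smooth_on A \<sigma> \<and> \<sigma> ` A \<subseteq> S \<and> (\<forall>w\<in>A. p (\<sigma> w) = inv_into U \<phi> w) \<and> \<sigma> (\<phi> (p x)) = x"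
    by (rule bspec)
  then show thesis using that by (elim exE conjE) blast
qed

lemma presented_open_preimage:
  assumes "presented M S p d" "openin (mtop M) P"
  shows "open (S \<inter> p -` P)"
proof -
  have "openin (top_of_set S) {x \<in> topspace (top_of_set S). p x \<in> P}"
    using presentedD(2)[OF assms(1)] assms(2) by (rule openin_continuous_map_preimage)
  moreover have "{x \<in> topspace (top_of_set S). p x \<in> P} = S \<inter> p -` P" by auto
  ultimately show ?thesis using presentedD(1)[OF assms(1)] openin_open_eq by metis
qed

text \<open>The section through \<open>x\<close> pulls \<open>G\<close> back to a neighbourhood of
  the chart value of \<open>p x\<close>, and the points of the manifold with chart values there are
  images of points of \<open>G\<close>.\<close>

lemma presented_open_image:
  assumes pr: "presented M S p d" and G: "open G" "G \<subseteq> S"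
  shows "openin (mtop M) (p ` G)"
proof (subst openin_subopen, intro ballI)
  fix y assume "y \<in> p ` G"
  then obtain x where x: "x \<in> G" "y = p x" by auto
  then have y: "y \<in> topspace (mtop M)" using presentedD(3)[OF pr] G by auto
  then obtain U \<phi> where U: "(U, \<phi>) \<in> charts M" "y \<in> U" using presentedD(4)[OF pr] by blast
  have "x \<in> S" "p x \<in> U" using x U(2) G by auto
  then obtain A \<sigma> where A: "openin (top_of_set (\<phi> ` U)) A" "\<phi> (p x) \<in> A" "smooth_on A \<sigma>" "\<sigma> ` A \<subseteq> S"
    "\<And>w. w \<in> A \<Longrightarrow> p (\<sigma> w) = inv_into U \<phi> w" "\<sigma> (\<phi> (p x)) = x"
    using presented_section[OF pr U(1)] by blast
  obtain W where W: "openin (mtop M) U" "inj_on \<phi> U" "continuous_map (subtopology (mtop M) U) euclidean \<phi>"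
    using presentedD(5)[OF pr U(1)] by (rule is_chartE) blast
  have "openin (top_of_set A) (A \<inter> \<sigma> -` G)"
    using continuous_openin_preimage_gen[OF smooth_on_continuous[OF A(3)] G(1)] .
  then have B: "openin (top_of_set (\<phi> ` U)) (A \<inter> \<sigma> -` G)" using A(1) openin_trans by blast
  then obtain T where T: "open T" "A \<inter> \<sigma> -` G = \<phi> ` U \<inter> T" by (auto simp: openin_open)
  have tsU: "topspace (subtopology (mtop M) U) = U" using openin_subset[OF W(1)] by auto
  have "openin (subtopology (mtop M) U) {u \<in> topspace (subtopology (mtop M) U). \<phi> u \<in> T}"
    using W(3) T(1) by (intro openin_continuous_map_preimage) auto
  then have "openin (mtop M) {u \<in> U. \<phi> u \<in> T}"
    unfolding tsU using W(1) by (simp add: openin_open_subtopology)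
  moreover have "y \<in> {u \<in> U. \<phi> u \<in> T}" using A(2,6) x U T by auto
  moreover have "{u \<in> U. \<phi> u \<in> T} \<subseteq> p ` G"
  proof clarify
    fix u assume u: "u \<in> U" "\<phi> u \<in> T"
    then have "\<phi> u \<in> A \<inter> \<sigma> -` G" using T by blast
    then have "p (\<sigma> (\<phi> u)) = u" "\<sigma> (\<phi> u) \<in> G" using A(5) W(2) u by auto
    then show "u \<in> p ` G" by (metis imageI)
  qed
  ultimately show "\<exists>T. openin (mtop M) T \<and> y \<in> T \<and> T \<subseteq> p ` G" by blast
qed

lemma presented_open_map:
  assumes "presented M S p d" shows "open_map (top_of_set S) (mtop M) p"
proof -
  have "openin (mtop M) (p ` G)" if "openin (top_of_set S) G" for G
    using that presented_open_image[OF assms] openin_open_eq[OF presentedD(1)[OF assms]] by blast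
  then show ?thesis by (simp add: open_map_def)
qed

text \<open>An open continuous surjection is a quotient map, so continuity descends. In charts,
  \<open>f\<close> is locally \<open>\<psi> \<circ> p' \<circ> F \<circ> \<sigma>\<close> for a
  section \<sigma>, a composition of smooth maps.\<close>

lemma smooth_map_lift:
  assumes M: "presented M S p d" and N: "presented N S' p' d'"
    and F: "smooth_on S F" "F ` S \<subseteq> S'" "\<And>x. x \<in> S \<Longrightarrow> f (p x) = p' (F x)"
  shows "smooth_map M N f"
proof -
  have "continuous_map (top_of_set S) (mtop N) (\<lambda>x. p' (F x))"
  proof -
    have "continuous_map (top_of_set S) (top_of_set S') F"
      using smooth_on_continuous[OF F(1)] F(2) by (simp add: continuous_map_in_subtopology image_subset_iff_funcset)
    from continuous_map_compose[OF this presentedD(2)[OF N]] show ?thesis by (simp add: o_def)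
  qed
  then have "continuous_map (top_of_set S) (mtop N) (f \<circ> p)"
    by (rule continuous_map_eq) (simp add: F(3))
  moreover have "quotient_map (top_of_set S) (mtop M) p"
    using presentedD(2,3)[OF M] presented_open_map[OF M]
    by (intro continuous_open_imp_quotient_map) auto
  ultimately have cont: "continuous_map (mtop M) (mtop N) f"
    using continuous_compose_quotient_map by blast
  have "smooth_on (\<phi> ` (U \<inter> f -` V)) (\<psi> \<circ> f \<circ> inv_into U \<phi>)"
    if U: "(U, \<phi>) \<in> charts M" and V: "(V, \<psi>) \<in> charts N" for U \<phi> V \<psi>
  proof (rule smooth_on_local)
    fix w assume "w \<in> \<phi> ` (U \<inter> f -` V)"
    then obtain u where u: "u \<in> U" "f u \<in> V" "w = \<phi> u" by auto
    note Uo = presented_chart_open[OF M U]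
    from u Uo(3) obtain x where x: "x \<in> S" "p x = u" by auto
    then have "p x \<in> U" using u by simp
    with x(1) obtain A \<sigma> where A: "openin (top_of_set (\<phi> ` U)) A" "\<phi> (p x) \<in> A" "smooth_on A \<sigma>" "\<sigma> ` A \<subseteq> S"
      "\<And>w. w \<in> A \<Longrightarrow> p (\<sigma> w) = inv_into U \<phi> w" "\<sigma> (\<phi> (p x)) = x"
      using presented_section[OF M U] by blast
    let ?A = "A \<inter> \<phi> ` (U \<inter> f -` V)"
    have inv: "p (\<sigma> a) \<in> U" "f (p (\<sigma> a)) \<in> V" "\<sigma> a \<in> S" "p (\<sigma> a) = inv_into U \<phi> a" if "a \<in> ?A" for a
      using that A(4,5) Uo(2) by auto
    have "smooth_on ?A (\<lambda>a. \<psi> (p' (F (\<sigma> a))))"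
    proof (rule smooth_on_compose[OF presentedD(6)[OF N V]])
      show "smooth_on ?A (\<lambda>a. F (\<sigma> a))"
        using A(3) inv by (intro smooth_on_compose[OF F(1)] smooth_on_subset[OF A(3)]) auto
      show "(\<lambda>a. F (\<sigma> a)) ` ?A \<subseteq> S' \<inter> p' -` V"
      proof (rule image_subsetI)
        fix a assume "a \<in> ?A"
        then have "f (p (\<sigma> a)) \<in> V" "\<sigma> a \<in> S" by (rule inv)+
        then show "F (\<sigma> a) \<in> S' \<inter> p' -` V" using F(2) F(3)[of "\<sigma> a"] by auto
      qed
    qed
    then have "smooth_on ?A (\<psi> \<circ> f \<circ> inv_into U \<phi>)"
    proof (rule smooth_on_cong)
      show "\<psi> (p' (F (\<sigma> a))) = (\<psi> \<circ> f \<circ> inv_into U \<phi>) a" if "a \<in> ?A" for a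
        using inv(4)[OF that] F(3)[OF inv(3)[OF that]] by simp
    qed
    moreover have "openin (top_of_set (\<phi> ` (U \<inter> f -` V))) ?A"
      using A(1) by (auto simp: openin_open)
    moreover have "w \<in> ?A" using A(2) x u by auto
    ultimately show "\<exists>A. openin (top_of_set (\<phi> ` (U \<inter> f -` V))) A \<and> w \<in> A \<and> smooth_on A (\<psi> \<circ> f \<circ> inv_into U \<phi>)"
      by blast
  qed
  then show ?thesis unfolding smooth_map_def using cont by auto
qed

lemma second_countable_euclidean:
  "second_countable (euclidean :: 'a::second_countable_topology topology)"
proof -
  obtain \<B> :: "'a set set" where \<B>: "countable \<B>" "topological_basis \<B>"
    using ex_countable_basis by blast
  have "\<forall>V\<in>\<B>. openin euclidean V" using topological_basis_open[OF \<B>(2)] by simp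
  moreover have "\<exists>V\<in>\<B>. x \<in> V \<and> V \<subseteq> U" if "openin euclidean U \<and> x \<in> U" for U x
    using that topological_basisE[OF \<B>(2), of U x] by (metis open_openin)
  ultimately show ?thesis using \<B>(1) unfolding second_countable_def by blast
qed

text \<open>Smoothness of all transition maps is smoothness of the identity, which lifts to the
  identity of \<open>S\<close>. Second countability passes along the open map
  \<open>p\<close>.\<close>

lemma presented_smooth_manifold:
  assumes M: "presented M S p d" and "Hausdorff_space (mtop M)"
  shows "smooth_manifold M"
proof -
  have "second_countable (mtop M)"
    using second_countable_open_map_image[OF presentedD(2)[OF M] presented_open_map[OF M]]
      presentedD(3)[OF M] second_countable_subtopology second_countable_euclidean by auto
  moreover have "smooth_map M M id"
    by (rule smooth_map_lift[OF M M, of "\<lambda>x. x"]) (auto intro: smooth_on_id)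
  moreover have "(\<Union>(U, \<phi>)\<in>charts M. U) = topspace (mtop M)" using M by (simp add: presented_def)
  moreover have "\<forall>(U, \<phi>)\<in>charts M. is_chart d (mtop M) U \<phi>" using presentedD(5)[OF M] by auto
  ultimately show ?thesis
    unfolding smooth_manifold_def using assms(2) by (auto simp: smooth_map_def)
qed

section \<open>Differentials of charts and submersions, read on the covering open set\<close>

text \<open>Differentiating \<open>f \<circ> \<sigma> = id\<close> along \<open>W\<close> exhibits
  the derivative of \<sigma> as a right inverse on \<open>W\<close> of the derivative of
  \<open>f\<close>.\<close>

lemma section_derivative:
  fixes f :: "'a::euclidean_space \<Rightarrow> 'b::euclidean_space"
  assumes f: "smooth_on G f" "open G" and A: "openin (top_of_set W) A" "subspace W"
    and \<sigma>: "smooth_on A \<sigma>" "\<sigma> ` A \<subseteq> G" "\<And>w. w \<in> A \<Longrightarrow> f (\<sigma> w) = w" and w: "w \<in> A" "y = \<sigma> w"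
  shows "W \<subseteq> range (frechet_derivative f (at y))"
proof
  fix v assume v: "v \<in> W"
  let ?E = "frechet_derivative f (at y)"
  obtain D where D: "(\<sigma> has_derivative D) (at w within A)"
    using smooth_on_has_derivative_within[OF \<sigma>(1) w(1)] by blast
  have "(f has_derivative ?E) (at (\<sigma> w) within \<sigma> ` A)"
    using smooth_on_has_derivative[OF f, of y] w \<sigma>(2) by (auto intro: has_derivative_at_withinI)
  from has_derivative_in_compose[OF D this]
  have 1: "((\<lambda>w. f (\<sigma> w)) has_derivative (\<lambda>v. ?E (D v))) (at w within A)" .
  have "((\<lambda>w. f (\<sigma> w)) has_derivative (\<lambda>v. v)) (at w within A)"
    by (rule has_derivative_transform[OF w(1) \<sigma>(3)]) (auto intro: has_derivative_ident)
  then have "?E (D v) = v"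
    using has_derivative_within_subspace_unique[OF 1 _ A w(1) v] by blast
  then show "v \<in> range ?E" by (metis rangeI)
qed

lemma span_openin:
  fixes A :: "'a::euclidean_space set"
  assumes "openin (top_of_set W) A" "subspace W" "A \<noteq> {}" shows "span A = W"
proof -
  have "A \<subseteq> W" using assms(1) openin_imp_subset by blast
  moreover have "dim A = dim W" using assms dim_openin by blast
  ultimately show ?thesis using dim_eq_span assms(2) by (metis order_refl span_eq_iff)
qed

lemma presented_chart_derivative:
  assumes M: "presented M S p d" and U: "(U, \<phi>) \<in> charts M" and x: "x \<in> S" "p x \<in> U"
  shows "range (frechet_derivative (\<lambda>x. \<phi> (p x)) (at x)) = span (\<phi> ` U)"
proof
  obtain W where W: "openin (mtop M) U" "subspace W" "openin (top_of_set W) (\<phi> ` U)" "inj_on \<phi> U"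
    using presentedD(5)[OF M U] by (rule is_chartE) blast
  let ?G = "S \<inter> p -` U"
  have G: "open ?G" using presented_open_preimage[OF M W(1)] .
  have sm: "smooth_on ?G (\<lambda>x. \<phi> (p x))" using presentedD(6)[OF M U] .
  show "range (frechet_derivative (\<lambda>x. \<phi> (p x)) (at x)) \<subseteq> span (\<phi> ` U)"
    using has_derivative_in_subspace[OF smooth_on_has_derivative[OF sm G], of x ?G "span (\<phi> ` U)"] G x
    by (auto intro: span_base)
  obtain A \<sigma> where A: "openin (top_of_set (\<phi> ` U)) A" "\<phi> (p x) \<in> A" "smooth_on A \<sigma>" "\<sigma> ` A \<subseteq> S"
    "\<And>w. w \<in> A \<Longrightarrow> p (\<sigma> w) = inv_into U \<phi> w" "\<sigma> (\<phi> (p x)) = x"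
    using presented_section[OF M U x] by blast
  have AU: "inv_into U \<phi> w \<in> U" "\<phi> (inv_into U \<phi> w) = w" if "w \<in> A" for w
    using that openin_imp_subset[OF A(1)] by (auto intro: inv_into_into f_inv_into_f)
  have "span (\<phi> ` U) = W" using span_openin[OF W(3,2)] x by auto
  moreover have "W \<subseteq> range (frechet_derivative (\<lambda>x. \<phi> (p x)) (at x))"
  proof (rule section_derivative[OF sm G _ W(2) A(3)])
    show "openin (top_of_set W) A" using A(1) W(3) openin_trans by blast
  qed (use A AU in auto)
  ultimately show "span (\<phi> ` U) \<subseteq> range (frechet_derivative (\<lambda>x. \<phi> (p x)) (at x))" by simp
qed

text \<open>With \<open>submersionI_lift\<close> as its converse, this moves the submersion
  condition from charts of \<open>M\<close> to the single map \<open>f \<circ> p\<close> on an open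
  set. Since \<open>\<phi> \<circ> p\<close> has differential onto the tangent space of the chart,
  composing with it does not change the range.\<close>

lemma submersion_lift:
  assumes M: "presented M S p d" and f: "submersion M \<lparr>mtop = top_of_set Y, charts = {(Y, id)}\<rparr> f"
  shows "smooth_on S (\<lambda>x. f (p x))" "\<And>x. x \<in> S \<Longrightarrow> f (p x) \<in> Y"
    "\<And>x. x \<in> S \<Longrightarrow> range (frechet_derivative (\<lambda>x. f (p x)) (at x)) = span Y"
proof -
  have cont: "continuous_map (mtop M) (top_of_set Y) f"
    and sm: "\<And>U \<phi>. (U, \<phi>) \<in> charts M \<Longrightarrow> smooth_on (\<phi> ` (U \<inter> f -` Y)) (f \<circ> inv_into U \<phi>)"
    and D: "\<And>U \<phi> u. (U, \<phi>) \<in> charts M \<Longrightarrow> u \<in> U \<inter> f -` Y \<Longrightarrow>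
      \<exists>D. ((f \<circ> inv_into U \<phi>) has_derivative D) (at (\<phi> u) within \<phi> ` (U \<inter> f -` Y)) \<and> D ` span (\<phi> ` U) = span Y"
    using f by (auto simp: submersion_def smooth_map_def)
  show fY: "f (p x) \<in> Y" if "x \<in> S" for x
    using that cont presentedD(3)[OF M] by (auto simp: continuous_map_def)
  have *: "open (S \<inter> p -` U)" "U \<subseteq> f -` Y" "inj_on \<phi> U" if "(U, \<phi>) \<in> charts M" for U \<phi>
  proof -
    note Uo = presented_chart_open[OF M that]
    show "open (S \<inter> p -` U)" by (rule presented_open_preimage[OF M Uo(1)])
    show "U \<subseteq> f -` Y" using Uo(3) fY by auto
    show "inj_on \<phi> U" by (rule Uo(2))
  qed
  have smU: "smooth_on (S \<inter> p -` U) (\<lambda>x. f (p x))" if U: "(U, \<phi>) \<in> charts M" for U \<phi>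
  proof -
    have "smooth_on (S \<inter> p -` U) (\<lambda>x. (f \<circ> inv_into U \<phi>) (\<phi> (p x)))"
      using *(2)[OF U] by (intro smooth_on_compose[OF sm[OF U] presentedD(6)[OF M U]]) auto
    then show ?thesis by (rule smooth_on_cong) (use *(3)[OF U] in auto)
  qed
  have cov: "\<exists>U \<phi>. (U, \<phi>) \<in> charts M \<and> p x \<in> U" if "x \<in> S" for x
    using that presentedD(3,4)[OF M] by blast
  show smS: "smooth_on S (\<lambda>x. f (p x))"
  proof (rule smooth_on_local)
    fix x assume x: "x \<in> S"
    then obtain U \<phi> where U: "(U, \<phi>) \<in> charts M" "p x \<in> U" using cov by blast
    then show "\<exists>A. openin (top_of_set S) A \<and> x \<in> A \<and> smooth_on A (\<lambda>x. f (p x))"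
      using *(1)[OF U(1)] smU[OF U(1)] x presentedD(1)[OF M]
      by (intro exI[of _ "S \<inter> p -` U"]) (auto intro: openin_subtopology_Int2 open_subset)
  qed
  fix x assume x: "x \<in> S"
  then obtain U \<phi> where U: "(U, \<phi>) \<in> charts M" "p x \<in> U" using cov by blast
  let ?G = "S \<inter> p -` U" and ?B = "\<phi> ` (U \<inter> f -` Y)"
  have xG: "x \<in> ?G" using x U by auto
  obtain D where D: "((f \<circ> inv_into U \<phi>) has_derivative D) (at (\<phi> (p x)) within ?B)" "D ` span (\<phi> ` U) = span Y"
    using D[OF U(1), of "p x"] U(2) fY[OF x] by blast
  let ?E = "frechet_derivative (\<lambda>x. \<phi> (p x)) (at x)"
  have E: "((\<lambda>x. \<phi> (p x)) has_derivative ?E) (at x within ?G)"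
    using smooth_on_has_derivative[OF presentedD(6)[OF M U(1)] *(1)[OF U(1)] xG] by (rule has_derivative_at_withinI)
  have "((\<lambda>x. (f \<circ> inv_into U \<phi>) (\<phi> (p x))) has_derivative (\<lambda>v. D (?E v))) (at x within ?G)"
    by (rule has_derivative_in_compose[OF E has_derivative_subset[OF D(1)]]) (use *(2)[OF U(1)] in auto)
  then have "((\<lambda>x. (f \<circ> inv_into U \<phi>) (\<phi> (p x))) has_derivative (\<lambda>v. D (?E v))) (at x)"
    by (simp only: at_within_open[OF xG *(1)[OF U(1)]])
  then have "((\<lambda>x. f (p x)) has_derivative (\<lambda>v. D (?E v))) (at x)"
    by (rule has_derivative_transform_within_open[OF _ *(1)[OF U(1)] xG]) (use *(3)[OF U(1)] in auto)
  then have "frechet_derivative (\<lambda>x. f (p x)) (at x) = (\<lambda>v. D (?E v))"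
    using frechet_derivative_at by metis
  then have "range (frechet_derivative (\<lambda>x. f (p x)) (at x)) = D ` range ?E" by (simp add: image_image)
  then show "range (frechet_derivative (\<lambda>x. f (p x)) (at x)) = span Y"
    using presented_chart_derivative[OF M U(1) x U(2)] D(2) by simp
qed

lemma submersionI_lift:
  fixes f :: "'p \<Rightarrow> 'f::euclidean_space"
  assumes M: "presented M S p d" and sm: "smooth_on S (\<lambda>x. f (p x))" and fY: "\<And>x. x \<in> S \<Longrightarrow> f (p x) \<in> Y"
    and range: "\<And>x. x \<in> S \<Longrightarrow> span Y \<subseteq> range (frechet_derivative (\<lambda>x. f (p x)) (at x))"
  shows "submersion M \<lparr>mtop = top_of_set Y, charts = {(Y, id)}\<rparr> f"
proof -
  have fY': "f y \<in> Y" if "y \<in> topspace (mtop M)" for y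
    using that fY unfolding presentedD(3)[OF M, symmetric] by auto
  have S: "open S" using presentedD(1)[OF M] .
  have "continuous_map (top_of_set S) (top_of_set Y) (f \<circ> p)"
    using smooth_on_continuous[OF sm] fY by (auto simp: continuous_map_in_subtopology o_def)
  moreover have "quotient_map (top_of_set S) (mtop M) p"
    using presentedD(2,3)[OF M] presented_open_map[OF M]
    by (intro continuous_open_imp_quotient_map) auto
  ultimately have cont: "continuous_map (mtop M) (top_of_set Y) f"
    using continuous_compose_quotient_map by blast
  have UfY: "U \<inter> f -` Y = U" if "(U, \<phi>) \<in> charts M" for U \<phi>
  proof -
    show ?thesis using presented_chart_open(3)[OF M that] fY by auto
  qed
  have loc: "\<exists>A \<sigma>. openin (top_of_set (\<phi> ` U)) A \<and> \<phi> u \<in> A \<and> smooth_on A \<sigma> \<and> \<sigma> ` A \<subseteq> S \<and>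
      (\<forall>w\<in>A. f (p (\<sigma> w)) = (f \<circ> inv_into U \<phi>) w) \<and> p (\<sigma> (\<phi> u)) = u"
    if U: "(U, \<phi>) \<in> charts M" and u: "u \<in> U" for U \<phi> u
  proof -
    note Uo = presented_chart_open[OF M U]
    from u Uo(3) obtain x where x: "x \<in> S" "p x = u" by auto
    then have "p x \<in> U" using u by simp
    with x(1) obtain A \<sigma> where A: "openin (top_of_set (\<phi> ` U)) A" "\<phi> (p x) \<in> A" "smooth_on A \<sigma>" "\<sigma> ` A \<subseteq> S"
      "\<And>w. w \<in> A \<Longrightarrow> p (\<sigma> w) = inv_into U \<phi> w" "\<sigma> (\<phi> (p x)) = x"
      using presented_section[OF M U] by blast
    show ?thesis by (rule exI[of _ A], rule exI[of _ \<sigma>]) (use A x in auto)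
  qed
  have "smooth_on (\<phi> ` (U \<inter> f -` Y)) (f \<circ> inv_into U \<phi>)" if U: "(U, \<phi>) \<in> charts M" for U \<phi>
    unfolding UfY[OF U]
  proof (rule smooth_on_local)
    fix w assume "w \<in> \<phi> ` U"
    then obtain u where u: "u \<in> U" "w = \<phi> u" by auto
    obtain A \<sigma> where A: "openin (top_of_set (\<phi> ` U)) A" "\<phi> u \<in> A" "smooth_on A \<sigma>" "\<sigma> ` A \<subseteq> S"
      "\<forall>w\<in>A. f (p (\<sigma> w)) = (f \<circ> inv_into U \<phi>) w" using loc[OF U u(1)] by blast
    have "smooth_on A (f \<circ> inv_into U \<phi>)"
      by (rule smooth_on_cong[OF smooth_on_compose[OF sm A(3,4)]]) (use A(5) in auto)
    then show "\<exists>A. openin (top_of_set (\<phi> ` U)) A \<and> w \<in> A \<and> smooth_on A (f \<circ> inv_into U \<phi>)"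
      using A u by blast
  qed
  moreover have "\<exists>D. ((f \<circ> inv_into U \<phi>) has_derivative D) (at (\<phi> u) within \<phi> ` (U \<inter> f -` Y)) \<and>
      D ` span (\<phi> ` U) = span Y" if U: "(U, \<phi>) \<in> charts M" and u: "u \<in> U" for U \<phi> u
  proof -
    obtain W where W: "openin (mtop M) U" "inj_on \<phi> U"
      using presentedD(5)[OF M U] by (rule is_chartE) blast
    obtain A \<sigma> where A: "openin (top_of_set (\<phi> ` U)) A" "\<phi> u \<in> A" "smooth_on A \<sigma>" "\<sigma> ` A \<subseteq> S"
      "\<forall>w\<in>A. f (p (\<sigma> w)) = (f \<circ> inv_into U \<phi>) w" "p (\<sigma> (\<phi> u)) = u" using loc[OF U u] by blast
    define x where "x = \<sigma> (\<phi> u)"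
    have x: "x \<in> S" "p x = u" using A by (auto simp: x_def)
    let ?F = "frechet_derivative (\<lambda>x. f (p x)) (at x)"
    have F: "((\<lambda>x. f (p x)) has_derivative ?F) (at x)" using sm S x(1) by (rule smooth_on_has_derivative)
    obtain D\<sigma> where D\<sigma>: "(\<sigma> has_derivative D\<sigma>) (at (\<phi> u) within A)"
      using smooth_on_has_derivative_within[OF A(3,2)] by blast
    define D where "D = (\<lambda>v. ?F (D\<sigma> v))"
    have "((\<lambda>w. f (p (\<sigma> w))) has_derivative D) (at (\<phi> u) within A)"
      unfolding D_def by (rule has_derivative_in_compose[OF D\<sigma>])
        (use F in \<open>auto simp: x_def intro: has_derivative_at_withinI\<close>)
    then have "((f \<circ> inv_into U \<phi>) has_derivative D) (at (\<phi> u) within A)"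
      by (rule has_derivative_transform[rotated 2]) (use A(2,5) in auto)
    then have D: "((f \<circ> inv_into U \<phi>) has_derivative D) (at (\<phi> u) within \<phi> ` U)"
      by (simp only: at_within_openin[OF A(1,2)])
    let ?G = "S \<inter> p -` U" and ?E = "frechet_derivative (\<lambda>x. \<phi> (p x)) (at x)"
    have G: "open ?G" "x \<in> ?G" using presented_open_preimage[OF M W(1)] x u by auto
    have E: "((\<lambda>x. \<phi> (p x)) has_derivative ?E) (at x within ?G)"
      using smooth_on_has_derivative[OF presentedD(6)[OF M U] G] by (rule has_derivative_at_withinI)
    have "((\<lambda>x. (f \<circ> inv_into U \<phi>) (\<phi> (p x))) has_derivative (\<lambda>v. D (?E v))) (at x within ?G)"
      by (rule has_derivative_in_compose[OF E]) (rule has_derivative_subset[OF D[folded x(2)]], auto)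
    then have "((\<lambda>x. (f \<circ> inv_into U \<phi>) (\<phi> (p x))) has_derivative (\<lambda>v. D (?E v))) (at x)"
      by (simp only: at_within_open[OF G(2,1)])
    then have "((\<lambda>x. f (p x)) has_derivative (\<lambda>v. D (?E v))) (at x)"
      by (rule has_derivative_transform_within_open[OF _ G]) (use W(2) in auto)
    \<comment> \<open>\<open>D\<close> was built as \<open>?F\<close> after the derivative of a
      section, so its range on the tangent space is not yet known to be all that \<open>?F\<close>
      reaches. The factorisation of \<open>?F\<close> through \<open>D\<close> settles this, because
      \<open>?E\<close> maps onto the tangent space of the chart.\<close>
    then have "?F = (\<lambda>v. D (?E v))" using F has_derivative_unique by blast
    then have "range ?F = D ` range ?E" by (metis image_image)
    then have rF: "range ?F = D ` span (\<phi> ` U)"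
      using presented_chart_derivative[OF M U x(1)] x(2) u by simp
    have "range ?F \<subseteq> span Y"
      using has_derivative_in_subspace[OF F S x(1), of "span Y"] fY by (auto intro: span_base)
    then have "D ` span (\<phi> ` U) = span Y" using rF range[OF x(1)] by auto
    then show ?thesis using D UfY[OF U] by auto
  qed
  ultimately show ?thesis
    unfolding submersion_def smooth_map_def using cont by auto
qed

section \<open>Presentations of open submanifolds, Euclidean space, products and embedded
  submanifolds\<close>

lemma presented_open_submanifold:
  assumes M: "presented M S p d" and P: "openin (mtop M) P"
  shows "presented (open_submanifold M P) (S \<inter> p -` P) p d"
proof (rule presentedI)
  let ?N = "open_submanifold M P"
  have top: "mtop ?N = subtopology (mtop M) P" by (simp add: open_submanifold_def)
  have PM: "P \<subseteq> topspace (mtop M)" using P by (rule openin_subset)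
  show "open (S \<inter> p -` P)" by (rule presented_open_preimage[OF M P])
  show "continuous_map (top_of_set (S \<inter> p -` P)) (mtop ?N) p"
    unfolding top continuous_map_in_subtopology
    using continuous_map_from_subtopology[OF presentedD(2)[OF M], of "p -` P"]
    by (auto simp: subtopology_subtopology)
  show "p ` (S \<inter> p -` P) = topspace (mtop ?N)"
    unfolding top topspace_subtopology presentedD(3)[OF M, symmetric] by auto
  show "\<exists>U \<phi>. (U, \<phi>) \<in> charts ?N \<and> y \<in> U" if "y \<in> topspace (mtop ?N)" for y
  proof -
    have y: "y \<in> topspace (mtop M)" "y \<in> P" using that by (auto simp: top)
    then obtain U \<phi> where U: "(U, \<phi>) \<in> charts M" "y \<in> U" using presentedD(4)[OF M] by blast
    then have "(U \<inter> P, \<phi>) \<in> charts ?N" by (force simp: open_submanifold_def)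
    then show ?thesis using U y by blast
  qed
  fix V \<phi> assume "(V, \<phi>) \<in> charts ?N"
  then obtain U where U: "(U, \<phi>) \<in> charts M" "V = U \<inter> P" by (auto simp: open_submanifold_def)
  obtain W where W: "openin (mtop M) U" "subspace W" "dim W = d" "openin (top_of_set W) (\<phi> ` U)" "inj_on \<phi> U"
    "continuous_map (subtopology (mtop M) U) euclidean \<phi>"
    "continuous_map (top_of_set (\<phi> ` U)) (mtop M) (inv_into U \<phi>)"
    "\<And>V. openin (mtop M) V \<Longrightarrow> V \<subseteq> U \<Longrightarrow> openin (top_of_set (\<phi> ` U)) (\<phi> ` V)"
    using presentedD(5)[OF M U(1)] by (rule is_chartE) blast
  have VU: "V \<subseteq> U" "openin (mtop M) V" using U W(1) P by auto
  have injV: "inj_on \<phi> V" using W(5) VU(1) inj_on_subset by blast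
  have inv: "inv_into V \<phi> w = inv_into U \<phi> w" if "w \<in> \<phi> ` V" for w
    using that injV W(5) VU(1) by auto
  have V: "openin (top_of_set (\<phi> ` U)) (\<phi> ` V)" using W(8) VU by blast
  show "is_chart d (mtop ?N) V \<phi>"
  proof (rule is_chartI[OF _ W(2,3) _ injV])
    show "openin (mtop ?N) V" unfolding top using U W(1) by (simp add: openin_subtopology_Int)
    show "openin (top_of_set W) (\<phi> ` V)" using V W(4) openin_trans by blast
    have "subtopology (mtop ?N) V = subtopology (subtopology (mtop M) U) V"
      unfolding top subtopology_subtopology U(2) by (simp add: Int_ac)
    then show "continuous_map (subtopology (mtop ?N) V) euclidean \<phi>"
      using W(6) by (simp add: continuous_map_from_subtopology)
    have "continuous_map (top_of_set (\<phi> ` V)) (mtop M) (inv_into U \<phi>)"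
      using W(7) VU(1) by (meson continuous_map_from_subtopology_mono image_mono)
    then have "continuous_map (top_of_set (\<phi> ` V)) (mtop M) (inv_into V \<phi>)"
      by (rule continuous_map_eq) (simp add: inv)
    then show "continuous_map (top_of_set (\<phi> ` V)) (mtop ?N) (inv_into V \<phi>)"
      unfolding top continuous_map_in_subtopology using U(2) inv_into_into[of _ \<phi> V] by auto
  qed
  show "smooth_on (S \<inter> p -` P \<inter> p -` V) (\<lambda>x. \<phi> (p x))"
    by (rule smooth_on_subset[OF presentedD(6)[OF M U(1)]]) (use U(2) in auto)
  fix x assume x: "x \<in> S \<inter> p -` P" "p x \<in> V"
  then have "x \<in> S" "p x \<in> U" using U(2) by auto
  then obtain A \<sigma> where A: "openin (top_of_set (\<phi> ` U)) A" "\<phi> (p x) \<in> A" "smooth_on A \<sigma>" "\<sigma> ` A \<subseteq> S"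
      "\<And>w. w \<in> A \<Longrightarrow> p (\<sigma> w) = inv_into U \<phi> w" "\<sigma> (\<phi> (p x)) = x"
    using presented_section[OF M U(1)] by blast
  show "\<exists>A \<sigma>. openin (top_of_set (\<phi> ` V)) A \<and> \<phi> (p x) \<in> A \<and> smooth_on A \<sigma> \<and> \<sigma> ` A \<subseteq> S \<inter> p -` P \<and>
      (\<forall>w\<in>A. p (\<sigma> w) = inv_into V \<phi> w) \<and> \<sigma> (\<phi> (p x)) = x"
  proof (rule exI[of _ "A \<inter> \<phi> ` V"], rule exI[of _ \<sigma>], intro conjI ballI)
    show "openin (top_of_set (\<phi> ` V)) (A \<inter> \<phi> ` V)" using A(1) VU(1) by (auto simp: openin_open)
    show "smooth_on (A \<inter> \<phi> ` V) \<sigma>" using A(3) by (rule smooth_on_subset) auto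
    show eq: "p (\<sigma> w) = inv_into V \<phi> w" if "w \<in> A \<inter> \<phi> ` V" for w
      using that A(5) inv by auto
    show "\<sigma> ` (A \<inter> \<phi> ` V) \<subseteq> S \<inter> p -` P"
      using A(4) eq U(2) inv_into_into[of _ \<phi> V] by fastforce
  qed (use A x in auto)
qed

lemma presented_euclidean_manifold:
  "presented (euclidean_manifold :: ('e::euclidean_space, 'e) charted_space) UNIV id DIM('e)"
proof (rule presentedI)
  fix U and \<phi> :: "'e \<Rightarrow> 'e" assume "(U, \<phi>) \<in> charts euclidean_manifold"
  then have U: "U = UNIV" "\<phi> = id" by (auto simp: euclidean_manifold_def)
  show "is_chart DIM('e) (mtop euclidean_manifold) U \<phi>"
    unfolding U by (rule is_chartI[of _ _ UNIV]) (auto simp: euclidean_manifold_def)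
  show "smooth_on (UNIV \<inter> id -` U) (\<lambda>x. \<phi> (id x))"
    unfolding U by (simp add: smooth_on_id)
  fix x :: 'e
  show "\<exists>A \<sigma>. openin (top_of_set (\<phi> ` U)) A \<and> \<phi> (id x) \<in> A \<and> smooth_on A \<sigma> \<and> \<sigma> ` A \<subseteq> UNIV \<and>
    (\<forall>w\<in>A. id (\<sigma> w) = inv_into U \<phi> w) \<and> \<sigma> (\<phi> (id x)) = x"
    unfolding U by (rule exI[of _ UNIV], rule exI[of _ id]) (simp add: smooth_on_id)
qed (auto simp: euclidean_manifold_def)

lemma presented_product_manifold:
  assumes M: "presented M S p d" and N: "presented N S' p' d'"
  shows "presented (product_manifold M N) (S \<times> S') (map_prod p p') (d + d')"
proof (rule presentedI)
  let ?Q = "product_manifold M N"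
  have top: "mtop ?Q = prod_topology (mtop M) (mtop N)" by (simp add: product_manifold_def)
  have cont: "continuous_map (prod_topology X Y) (prod_topology X' Y') (map_prod f g)"
    if "continuous_map X X' f" "continuous_map Y Y' g" for X Y X' Y' and f :: "'x \<Rightarrow> 'x'" and g :: "'y \<Rightarrow> 'y'"
    using that continuous_map_prod_top[of X Y X' Y' f g] by (simp add: map_prod_def)
  show "open (S \<times> S')" using presentedD(1)[OF M] presentedD(1)[OF N] by (rule open_Times)
  show "continuous_map (top_of_set (S \<times> S')) (mtop ?Q) (map_prod p p')"
    using cont[OF presentedD(2)[OF M] presentedD(2)[OF N]] by (simp add: top)
  show "map_prod p p' ` (S \<times> S') = topspace (mtop ?Q)"
    using presentedD(3)[OF M] presentedD(3)[OF N] by (simp add: top map_prod_surj_on)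
  show "\<exists>U \<phi>. (U, \<phi>) \<in> charts ?Q \<and> y \<in> U" if "y \<in> topspace (mtop ?Q)" for y
  proof -
    obtain a b where ab: "y = (a, b)" by (cases y)
    then have y: "y = (a, b)" "a \<in> topspace (mtop M)" "b \<in> topspace (mtop N)" using that by (auto simp: top)
    obtain U \<phi> where U: "(U, \<phi>) \<in> charts M" "a \<in> U" using presentedD(4)[OF M y(2)] by blast
    obtain V \<psi> where V: "(V, \<psi>) \<in> charts N" "b \<in> V" using presentedD(4)[OF N y(3)] by blast
    have "(U \<times> V, map_prod \<phi> \<psi>) \<in> charts ?Q" using U V by (auto simp: product_manifold_def)
    then show ?thesis using U V y by blast
  qed
  fix T \<theta> assume "(T, \<theta>) \<in> charts ?Q"
  then obtain U \<phi> V \<psi> where U: "(U, \<phi>) \<in> charts M" and V: "(V, \<psi>) \<in> charts N"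
    and T: "T = U \<times> V" "\<theta> = map_prod \<phi> \<psi>" by (auto simp: product_manifold_def)
  obtain W where W: "openin (mtop M) U" "subspace W" "dim W = d" "openin (top_of_set W) (\<phi> ` U)" "inj_on \<phi> U"
    "continuous_map (subtopology (mtop M) U) euclidean \<phi>"
    "continuous_map (top_of_set (\<phi> ` U)) (mtop M) (inv_into U \<phi>)"
    using presentedD(5)[OF M U] by (rule is_chartE) blast
  obtain W' where W': "openin (mtop N) V" "subspace W'" "dim W' = d'" "openin (top_of_set W') (\<psi> ` V)" "inj_on \<psi> V"
    "continuous_map (subtopology (mtop N) V) euclidean \<psi>"
    "continuous_map (top_of_set (\<psi> ` V)) (mtop N) (inv_into V \<psi>)"
    using presentedD(5)[OF N V] by (rule is_chartE) blast
  have im: "map_prod \<phi> \<psi> ` (U \<times> V) = \<phi> ` U \<times> \<psi> ` V" by (simp add: map_prod_surj_on)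
  have injT: "inj_on (map_prod \<phi> \<psi>) (U \<times> V)" using W(5) W'(5) by (rule map_prod_inj_on)
  have inv: "inv_into (U \<times> V) (map_prod \<phi> \<psi>) w = map_prod (inv_into U \<phi>) (inv_into V \<psi>) w"
    if "w \<in> \<phi> ` U \<times> \<psi> ` V" for w
    using that inv_into_f_eq[OF injT, of "map_prod (inv_into U \<phi>) (inv_into V \<psi>) w" w]
    by (auto simp: inv_into_into f_inv_into_f)
  show "is_chart (d + d') (mtop ?Q) T \<theta>"
    unfolding T
  proof (rule is_chartI[of _ _ "W \<times> W'"])
    show "openin (mtop ?Q) (U \<times> V)" using W W' by (simp add: top openin_prod_Times_iff)
    show "subspace (W \<times> W')" using W W' by (simp add: subspace_Times)
    show "dim (W \<times> W') = d + d'" using W W' by (simp add: dim_Times)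
    show "openin (top_of_set (W \<times> W')) (map_prod \<phi> \<psi> ` (U \<times> V))"
      unfolding im using W W' by (intro openin_Times)
    show "inj_on (map_prod \<phi> \<psi>) (U \<times> V)" by (rule injT)
    show "continuous_map (subtopology (mtop ?Q) (U \<times> V)) euclidean (map_prod \<phi> \<psi>)"
      using cont[OF W(6) W'(6)] by (simp add: top subtopology_Times)
    have "continuous_map (top_of_set (\<phi> ` U \<times> \<psi> ` V)) (mtop ?Q) (map_prod (inv_into U \<phi>) (inv_into V \<psi>))"
      using cont[OF W(7) W'(7)] by (simp add: top)
    then show "continuous_map (top_of_set (map_prod \<phi> \<psi> ` (U \<times> V))) (mtop ?Q) (inv_into (U \<times> V) (map_prod \<phi> \<psi>))"
      unfolding im by (rule continuous_map_eq) (simp add: inv)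
  qed
  have pair: "smooth_on (A \<times> B) (\<lambda>z. (f (fst z), g (snd z)))" if "smooth_on A f" "smooth_on B g"
    for A B and f :: "'x::euclidean_space \<Rightarrow> 'u::euclidean_space" and g :: "'y::euclidean_space \<Rightarrow> 'v::euclidean_space"
    by (intro smooth_on_Pair smooth_on_compose[OF that(1)] smooth_on_compose[OF that(2)]
        smooth_on_fst smooth_on_snd smooth_on_id) auto
  have "smooth_on ((S \<inter> p -` U) \<times> (S' \<inter> p' -` V)) (\<lambda>z. (\<phi> (p (fst z)), \<psi> (p' (snd z))))"
    using presentedD(6)[OF M U] presentedD(6)[OF N V] by (rule pair)
  moreover have "(S \<inter> p -` U) \<times> (S' \<inter> p' -` V) = S \<times> S' \<inter> map_prod p p' -` (U \<times> V)" by auto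
  ultimately show "smooth_on (S \<times> S' \<inter> map_prod p p' -` T) (\<lambda>z. \<theta> (map_prod p p' z))"
    unfolding T by (simp add: map_prod_def case_prod_unfold)
  fix z assume z: "z \<in> S \<times> S'" "map_prod p p' z \<in> T"
  then obtain x y where xy: "z = (x, y)" "x \<in> S" "y \<in> S'" "p x \<in> U" "p' y \<in> V" by (auto simp: T)
  obtain A \<sigma> where A: "openin (top_of_set (\<phi> ` U)) A" "\<phi> (p x) \<in> A" "smooth_on A \<sigma>" "\<sigma> ` A \<subseteq> S"
      "\<And>w. w \<in> A \<Longrightarrow> p (\<sigma> w) = inv_into U \<phi> w" "\<sigma> (\<phi> (p x)) = x"
    using presented_section[OF M U xy(2,4)] by blast
  obtain B \<tau> where B: "openin (top_of_set (\<psi> ` V)) B" "\<psi> (p' y) \<in> B" "smooth_on B \<tau>" "\<tau> ` B \<subseteq> S'"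
      "\<And>w. w \<in> B \<Longrightarrow> p' (\<tau> w) = inv_into V \<psi> w" "\<tau> (\<psi> (p' y)) = y"
    using presented_section[OF N V xy(3,5)] by blast
  have sub: "A \<subseteq> \<phi> ` U" "B \<subseteq> \<psi> ` V" using A(1) B(1) openin_imp_subset by blast+
  show "\<exists>A \<sigma>. openin (top_of_set (\<theta> ` T)) A \<and> \<theta> (map_prod p p' z) \<in> A \<and> smooth_on A \<sigma> \<and>
      \<sigma> ` A \<subseteq> S \<times> S' \<and> (\<forall>w\<in>A. map_prod p p' (\<sigma> w) = inv_into T \<theta> w) \<and> \<sigma> (\<theta> (map_prod p p' z)) = z"
    unfolding T im
  proof (rule exI[of _ "A \<times> B"], rule exI[of _ "\<lambda>z. (\<sigma> (fst z), \<tau> (snd z))"], intro conjI ballI)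
    show "openin (top_of_set (\<phi> ` U \<times> \<psi> ` V)) (A \<times> B)" using A B by (intro openin_Times)
    show "smooth_on (A \<times> B) (\<lambda>z. (\<sigma> (fst z), \<tau> (snd z)))" using A(3) B(3) by (rule pair)
    show "map_prod p p' (\<sigma> (fst w), \<tau> (snd w)) = inv_into (U \<times> V) (map_prod \<phi> \<psi>) w" if "w \<in> A \<times> B" for w
      using that A(5) B(5) inv[of w] sub by (cases w) (auto simp: subset_eq)
  qed (use A B xy in auto)
qed

text \<open>Charts of an embedded submanifold have inverses smooth into the ambient space. A section
  \<open>\<tau>\<close> of \<open>\<rho>\<close> defined on all of \<open>Z\<close>, composed with
  such an inverse, is a section over the whole image of the chart. Besides that only the dimension
  is at stake, which the charts from \<open>cover\<close> determine.\<close>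

lemma presented_embedded_submanifold:
  fixes S Z :: "'e::euclidean_space set"
  assumes S: "open S" "S \<noteq> {}" and \<rho>: "smooth_on S \<rho>" "\<rho> ` S = Z"
    and \<tau>: "\<And>x. x \<in> S \<Longrightarrow> \<exists>\<tau>. smooth_on Z \<tau> \<and> \<tau> ` Z \<subseteq> S \<and> (\<forall>z\<in>Z. \<rho> (\<tau> z) = z) \<and> \<tau> (\<rho> x) = x"
    and cover: "\<And>z. z \<in> Z \<Longrightarrow> \<exists>U \<phi>. (U, \<phi>) \<in> charts (embedded_submanifold Z) \<and> z \<in> U \<and> is_chart d (top_of_set Z) U \<phi>"
  shows "presented (embedded_submanifold Z) S \<rho> d"
proof (rule presentedI)
  let ?Z = "embedded_submanifold Z"
  have top: "mtop ?Z = top_of_set Z" by (simp add: embedded_submanifold_def)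
  show "open S" by fact
  show "continuous_map (top_of_set S) (mtop ?Z) \<rho>"
    using smooth_on_continuous[OF \<rho>(1)] \<rho>(2) by (auto simp: top continuous_map_in_subtopology)
  show "\<rho> ` S = topspace (mtop ?Z)" using \<rho>(2) by (simp add: top)
  show "\<exists>U \<phi>. (U, \<phi>) \<in> charts ?Z \<and> y \<in> U" if "y \<in> topspace (mtop ?Z)" for y
    using cover that by (simp add: top) blast
  obtain W :: "'e set" where W: "subspace W" "dim W = d"
  proof -
    obtain x where "x \<in> S" using S by auto
    then have "\<rho> x \<in> Z" using \<rho>(2) by auto
    then obtain U :: "'e set" and \<phi> :: "'e \<Rightarrow> 'e" where "is_chart d (top_of_set Z) U \<phi>" using cover by metis
    then show thesis by (rule is_chartE) (rule that)
  qed
  fix U \<phi> assume U: "(U, \<phi>) \<in> charts ?Z"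
  then obtain d' where d': "is_chart d' (top_of_set Z) U \<phi>"
    and \<phi>: "smooth_on U \<phi>" "smooth_on (\<phi> ` U) (inv_into U \<phi>)" by (auto simp: embedded_submanifold_def)
  have UZ: "U \<subseteq> Z" "inj_on \<phi> U" using d' by (auto elim!: is_chartE dest: openin_imp_subset)
  show "is_chart d (mtop ?Z) U \<phi>"
    unfolding top using d' W
  proof (rule is_chart_change_dim)
    show "\<exists>V (\<psi> :: 'e \<Rightarrow> 'e). x \<in> V \<and> is_chart d (top_of_set Z) V \<psi>" if "x \<in> U" for x
      using cover[of x] UZ that by blast
  qed
  show "smooth_on (S \<inter> \<rho> -` U) (\<lambda>x. \<phi> (\<rho> x))"
    by (rule smooth_on_compose[OF \<phi>(1) smooth_on_subset[OF \<rho>(1)]]) auto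
  fix x assume x: "x \<in> S" "\<rho> x \<in> U"
  obtain \<tau> where \<tau>: "smooth_on Z \<tau>" "\<tau> ` Z \<subseteq> S" "\<forall>z\<in>Z. \<rho> (\<tau> z) = z" "\<tau> (\<rho> x) = x" using \<tau>[OF x(1)] by blast
  have inv: "inv_into U \<phi> w \<in> Z" if "w \<in> \<phi> ` U" for w using inv_into_into[OF that] UZ by auto
  show "\<exists>A \<sigma>. openin (top_of_set (\<phi> ` U)) A \<and> \<phi> (\<rho> x) \<in> A \<and> smooth_on A \<sigma> \<and> \<sigma> ` A \<subseteq> S \<and>
      (\<forall>w\<in>A. \<rho> (\<sigma> w) = inv_into U \<phi> w) \<and> \<sigma> (\<phi> (\<rho> x)) = x"
  proof (rule exI[of _ "\<phi> ` U"], rule exI[of _ "\<lambda>w. \<tau> (inv_into U \<phi> w)"], intro conjI ballI)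
    show "smooth_on (\<phi> ` U) (\<lambda>w. \<tau> (inv_into U \<phi> w))"
      using inv by (intro smooth_on_compose[OF \<tau>(1) \<phi>(2)]) auto
    show "(\<lambda>w. \<tau> (inv_into U \<phi> w)) ` \<phi> ` U \<subseteq> S" using inv \<tau>(2) by blast
  qed (use x \<tau> inv UZ in auto)
qed

section \<open>Slices and quotient manifolds\<close>

text \<open>\<open>h\<close> is a coordinate on the space of fibres: inside \<open>G\<close> it has
  the same fibres as \<open>p\<close>. As \<open>y'\<close> ranges over all of \<open>S\<close> in
  that clause, \<open>G\<close> is also saturated, that is, a union of fibres of
  \<open>p\<close>.\<close>

definition slice ::
  "'a::euclidean_space set \<Rightarrow> ('a \<Rightarrow> 'p) \<Rightarrow> nat \<Rightarrow> 'a set \<Rightarrow> ('a \<Rightarrow> 'a) \<Rightarrow> 'a set \<Rightarrow> bool" where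
  "slice S p d G h W \<longleftrightarrow> open G \<and> G \<subseteq> S \<and> subspace W \<and> dim W = d \<and>
     smooth_on G h \<and> openin (top_of_set W) (h ` G) \<and>
     (\<forall>y\<in>G. \<forall>y'\<in>S. p y' = p y \<longleftrightarrow> y' \<in> G \<and> h y' = h y) \<and>
     (\<forall>y\<in>G. \<exists>\<sigma>. smooth_on (h ` G) \<sigma> \<and> \<sigma> ` h ` G \<subseteq> G \<and> (\<forall>w\<in>h ` G. h (\<sigma> w) = w) \<and> \<sigma> (h y) = y)"

definition sliced :: "'a::euclidean_space set \<Rightarrow> ('a \<Rightarrow> 'p) \<Rightarrow> nat \<Rightarrow> bool" where
  "sliced S p d \<longleftrightarrow> (\<forall>x\<in>S. \<exists>G h W. x \<in> G \<and> slice S p d G h W)"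

lemma sliceD:
  assumes "slice S p d G h W"
  shows "open G" "G \<subseteq> S" "subspace W" "dim W = d" "smooth_on G h" "openin (top_of_set W) (h ` G)"
    and "\<And>y y'. y \<in> G \<Longrightarrow> y' \<in> S \<Longrightarrow> p y' = p y \<longleftrightarrow> y' \<in> G \<and> h y' = h y"
  using assms by (simp_all add: slice_def)

lemma slice_sectionE:
  assumes "slice S p d G h W" "y \<in> G"
  obtains \<sigma> where "smooth_on (h ` G) \<sigma>" "\<sigma> ` h ` G \<subseteq> G" "\<And>w. w \<in> h ` G \<Longrightarrow> h (\<sigma> w) = w" "\<sigma> (h y) = y"
proof -
  have "\<exists>\<sigma>. smooth_on (h ` G) \<sigma> \<and> \<sigma> ` h ` G \<subseteq> G \<and> (\<forall>w\<in>h ` G. h (\<sigma> w) = w) \<and> \<sigma> (h y) = y"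
    using assms by (simp add: slice_def)
  then show thesis using that by (elim exE conjE) blast
qed

text \<open>A slice coordinate is constant on the fibres of \<open>\<rho>\<close>, so
  \<open>h \<circ> \<rho> = h\<close> on \<open>G\<close>. Restricted to \<open>Z\<close>, where
  \<open>\<rho>\<close> is the identity, \<open>h\<close> is therefore injective with the same
  image, and its inverse is \<open>\<rho> \<circ> \<sigma>\<close>: a chart of
  \<open>Z\<close>.\<close>

lemma presented_sliced_retract:
  fixes S Z :: "'e::euclidean_space set"
  assumes S: "open S" "S \<noteq> {}" and \<rho>: "smooth_on S \<rho>" "\<rho> ` S = Z" "Z \<subseteq> S" "\<And>z. z \<in> Z \<Longrightarrow> \<rho> z = z"
    and \<tau>: "\<And>x. x \<in> S \<Longrightarrow> \<exists>\<tau>. smooth_on Z \<tau> \<and> \<tau> ` Z \<subseteq> S \<and> (\<forall>z\<in>Z. \<rho> (\<tau> z) = z) \<and> \<tau> (\<rho> x) = x"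
    and sl: "sliced S \<rho> d"
  shows "presented (embedded_submanifold Z) S \<rho> d"
proof (rule presented_embedded_submanifold[OF S \<rho>(1,2) \<tau>])
  fix z assume z: "z \<in> Z"
  then have "z \<in> S" using \<rho>(3) by auto
  with sl obtain G h W where zG: "z \<in> G" and sl: "slice S \<rho> d G h W"
    unfolding sliced_def by blast
  note G = sliceD(1)[OF sl] zG sliceD(2)[OF sl] and W = sliceD(3,4)[OF sl] and h = sliceD(5-7)[OF sl]
  obtain \<sigma> where \<sigma>: "smooth_on (h ` G) \<sigma>" "\<sigma> ` h ` G \<subseteq> G" "\<And>w. w \<in> h ` G \<Longrightarrow> h (\<sigma> w) = w"
    by (rule slice_sectionE[OF sl zG]) blast
  let ?U = "Z \<inter> G"
  have \<rho>Z: "\<rho> y \<in> Z" if "y \<in> S" for y using that \<rho>(2) by auto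
  have \<rho>G: "\<rho> y \<in> G" "h (\<rho> y) = h y" if "y \<in> G" for y
  proof -
    have y: "y \<in> S" using that G(3) by auto
    have "\<rho> (\<rho> y) = \<rho> y" by (intro \<rho>(4) \<rho>Z y)
    moreover have "\<rho> y \<in> S" using \<rho>(3) \<rho>Z[OF y] by auto
    ultimately show "\<rho> y \<in> G" "h (\<rho> y) = h y" using h(3)[OF that] by auto
  qed
  have hU: "h ` ?U = h ` G"
  proof
    show "h ` G \<subseteq> h ` ?U"
    proof (rule image_subsetI)
      fix y assume y: "y \<in> G"
      then have "\<rho> y \<in> ?U" using \<rho>G(1) \<rho>Z G(3) by auto
      then show "h y \<in> h ` ?U" using \<rho>G(2)[OF y] by (metis imageI)
    qed
  qed auto
  have inj: "inj_on h ?U"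
  proof (rule inj_onI)
    fix a b assume ab: "a \<in> ?U" "b \<in> ?U" "h a = h b"
    then have "\<rho> a = \<rho> b" using h(3)[of b a] G(3) by auto
    then show "a = b" using ab \<rho>(4) by auto
  qed
  have inv: "inv_into ?U h w = \<rho> (\<sigma> w)" if w: "w \<in> h ` G" for w
  proof (rule inv_into_f_eq[OF inj])
    have "\<sigma> w \<in> G" using w \<sigma>(2) by auto
    then show "\<rho> (\<sigma> w) \<in> ?U" "h (\<rho> (\<sigma> w)) = w" using \<rho>G \<rho>Z G(3) \<sigma>(3) w by auto
  qed
  have sm: "smooth_on (h ` G) (inv_into ?U h)"
  proof (rule smooth_on_cong)
    show "smooth_on (h ` G) (\<lambda>w. \<rho> (\<sigma> w))"
      using \<sigma>(2) G(3) by (intro smooth_on_compose[OF \<rho>(1) \<sigma>(1)]) auto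
  qed (simp add: inv)
  have smU: "smooth_on ?U h" using h(1) by (rule smooth_on_subset) auto
  have chart: "is_chart d (top_of_set Z) ?U h"
  proof (rule is_chartI[OF _ W _ inj])
    show "openin (top_of_set Z) ?U" using G(1) by (auto simp: openin_open)
    show "openin (top_of_set W) (h ` ?U)" unfolding hU by (rule h(2))
    show "continuous_map (subtopology (top_of_set Z) ?U) euclidean h"
      using smooth_on_continuous[OF smU] by (simp add: subtopology_subtopology)
    show "continuous_map (top_of_set (h ` ?U)) (top_of_set Z) (inv_into ?U h)"
      unfolding hU using smooth_on_continuous[OF sm] inv_into_into[of _ h ?U] hU
      by (auto simp: continuous_map_in_subtopology)
  qed
  then have "(?U, h) \<in> charts (embedded_submanifold Z)"
    using smU sm hU by (auto simp: embedded_submanifold_def)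
  then show "\<exists>U \<phi>. (U, \<phi>) \<in> charts (embedded_submanifold Z) \<and> z \<in> U \<and> is_chart d (top_of_set Z) U \<phi>"
    using chart z G(2) by blast
qed

text \<open>Slice coordinates descend to charts of the quotient, which shows that the atlas covers
  it and has dimension \<open>d\<close>. For an arbitrary chart \<open>\<psi>\<close> of the atlas
  the slice section \<open>\<sigma>\<close> is transported:
  \<open>\<tau> = \<psi> \<circ> q \<circ> \<sigma>\<close> is the change of coordinates from the
  slice, its inverse \<open>\<kappa>\<close> is smooth because \<open>\<psi>\<close> comes from a
  submersion, and \<open>\<sigma> \<circ> \<kappa>\<close> is the required section.\<close>

lemma presented_quotient_manifold:
  fixes M :: "('p, 'e::euclidean_space) charted_space" and S :: "'e set" and R :: "('p \<times> 'p) set"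
  assumes M: "presented M S p d0" and S: "S \<noteq> {}" and sl: "sliced S (\<lambda>x. R `` {p x}) d"
  shows "presented (quotient_manifold M R) S (\<lambda>x. R `` {p x}) d"
proof -
  let ?Q = "quotient_manifold M R" and ?X = "quotient_topology (mtop M) R"
  define q where "q x = R `` {p x}" for x
  have top: "mtop ?Q = ?X" by (simp add: quotient_manifold_def)
  have So: "open S" by (rule presentedD(1)[OF M])
  have imM: "p ` S = topspace (mtop M)" by (rule presentedD(3)[OF M])
  have topX: "topspace ?X = q ` S"
    unfolding topspace_quotient_topology quotient_def imM[symmetric] q_def by auto
  have q_cont: "continuous_map (top_of_set S) ?X q"
    unfolding continuous_map_def
  proof (intro conjI allI impI)
    show "q \<in> topspace (top_of_set S) \<rightarrow> topspace ?X" by (simp add: topX)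
    fix V assume "openin ?X V"
    then have "openin (mtop M) {x \<in> topspace (mtop M). R `` {x} \<in> V}"
      by (simp add: openin_quotient_topology)
    from presented_open_preimage[OF M this]
    have "open (S \<inter> p -` {x \<in> topspace (mtop M). R `` {x} \<in> V})" .
    moreover have "S \<inter> p -` {x \<in> topspace (mtop M). R `` {x} \<in> V} = {x \<in> S. q x \<in> V}"
      unfolding imM[symmetric] q_def by auto
    ultimately show "openin (top_of_set S) {x \<in> topspace (top_of_set S). q x \<in> V}"
      by (auto intro: open_subset)
  qed
  have q_open: "openin ?X (q ` G) \<and> {m \<in> topspace (mtop M). R `` {m} \<in> q ` G} = p ` G"
    if G: "open G" "G \<subseteq> S" and sat: "\<And>y y'. y \<in> G \<Longrightarrow> y' \<in> S \<Longrightarrow> q y' = q y \<Longrightarrow> y' \<in> G" for G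
  proof -
    have eq: "{m \<in> topspace (mtop M). R `` {m} \<in> q ` G} = p ` G"
    proof
      show "{m \<in> topspace (mtop M). R `` {m} \<in> q ` G} \<subseteq> p ` G"
      proof
        fix m assume "m \<in> {m \<in> topspace (mtop M). R `` {m} \<in> q ` G}"
        then obtain y y' where "y \<in> G" "y' \<in> S" "m = p y'" "R `` {m} = q y" unfolding imM[symmetric] by auto
        then have "y' \<in> G" "m = p y'" using sat[of y y'] by (auto simp: q_def)
        then show "m \<in> p ` G" by blast
      qed
      show "p ` G \<subseteq> {m \<in> topspace (mtop M). R `` {m} \<in> q ` G}"
        unfolding imM[symmetric] q_def using G(2) by auto
    qed
    have "q ` G \<subseteq> topspace (mtop M) // R"
      using topX G(2) by (auto simp: topspace_quotient_topology)
    then show ?thesis using eq presented_open_image[OF M G] by (simp add: openin_quotient_topology)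
  qed
  have slice_chart: "\<exists>\<phi>. (q ` G, \<phi>) \<in> charts ?Q \<and> is_chart d ?X (q ` G) \<phi> \<and> (\<forall>y\<in>G. \<phi> (q y) = h y)"
    if x: "x \<in> G" and sl: "slice S q d G h W" for x G h W
  proof -
    note G = sliceD(1)[OF sl] x sliceD(2)[OF sl] and W = sliceD(3,4)[OF sl] and h = sliceD(5,6)[OF sl]
      and ker = sliceD(7)[OF sl]
    \<comment> \<open>The chosen representative does not matter, since \<open>h\<close> is constant
      on the fibres of \<open>q\<close> in \<open>G\<close>.\<close>
    define \<phi> where "\<phi> c = h (inv_into G q c)" for c
    have \<phi>: "\<phi> (q y) = h y" if "y \<in> G" for y
    proof -
      have "inv_into G q (q y) \<in> G" "q (inv_into G q (q y)) = q y"
        by (intro inv_into_into f_inv_into_f imageI that)+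
      then show ?thesis using ker[OF that, of "inv_into G q (q y)"] G(3) by (auto simp: \<phi>_def)
    qed
    have im: "\<phi> ` q ` G = h ` G" using \<phi> by (force simp: image_image)
    have inj: "inj_on \<phi> (q ` G)"
    proof (rule inj_onI, clarify)
      fix y y' assume "y \<in> G" "y' \<in> G" "\<phi> (q y) = \<phi> (q y')"
      then show "q y = q y'" using \<phi> ker[of y' y] G(3) by auto
    qed
    have sat: "y' \<in> G" if "y \<in> G" "y' \<in> S" "q y' = q y" for y y' using ker that by blast
    obtain \<sigma> where \<sigma>: "smooth_on (h ` G) \<sigma>" "\<sigma> ` h ` G \<subseteq> G" "\<And>w. w \<in> h ` G \<Longrightarrow> h (\<sigma> w) = w"
      by (rule slice_sectionE[OF sl x]) blast
    have inv: "inv_into (q ` G) \<phi> w = q (\<sigma> w)" if w: "w \<in> h ` G" for w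
    proof -
      have "\<sigma> w \<in> G" using w \<sigma>(2) by blast
      then show ?thesis using w \<sigma>(3) \<phi> by (intro inv_into_f_eq[OF inj]) auto
    qed
    have qG: "openin ?X (q ` G) \<and> {m \<in> topspace (mtop M). R `` {m} \<in> q ` G} = p ` G"
      by (rule q_open[OF G(1,3)]) (rule sat)
    then have open_qG: "openin ?X (q ` G)" by blast
    have chart: "is_chart d ?X (q ` G) \<phi>"
    proof (rule is_chartI[OF open_qG W _ inj])
      show "openin (top_of_set W) (\<phi> ` q ` G)" unfolding im by (rule h(2))
      have ts: "topspace (subtopology ?X (q ` G)) = q ` G"
        using openin_subset[OF open_qG] by auto
      show "continuous_map (subtopology ?X (q ` G)) euclidean \<phi>"
        unfolding continuous_map_def ts
      proof (intro conjI allI impI)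
        fix T :: "'e set" assume "openin euclidean T"
        then have T: "open (G \<inter> h -` T)"
          using continuous_open_preimage[OF smooth_on_continuous[OF h(1)] G(1)] by auto
        have "openin ?X (q ` (G \<inter> h -` T))"
          using q_open[OF T] G(3) ker by fastforce
        moreover have "q ` (G \<inter> h -` T) = {c \<in> q ` G. \<phi> c \<in> T}" using \<phi> by auto
        ultimately show "openin (subtopology ?X (q ` G)) {c \<in> q ` G. \<phi> c \<in> T}"
          using open_qG by (auto simp: openin_open_subtopology)
      qed auto
      have "continuous_map (top_of_set (h ` G)) (top_of_set S) \<sigma>"
        using smooth_on_continuous[OF \<sigma>(1)] \<sigma>(2) G(3) by (auto simp: continuous_map_in_subtopology)
      from continuous_map_compose[OF this q_cont]
      have "continuous_map (top_of_set (h ` G)) ?X (\<lambda>w. q (\<sigma> w))" by (simp add: o_def)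
      then show "continuous_map (top_of_set (\<phi> ` q ` G)) ?X (inv_into (q ` G) \<phi>)"
        unfolding im by (rule continuous_map_eq) (simp add: inv)
    qed
    define P where "P = {m \<in> topspace (mtop M). R `` {m} \<in> q ` G}"
    have P: "P = p ` G" unfolding P_def using qG by blast
    have "openin (mtop M) P" unfolding P by (rule presented_open_image[OF M G(1,3)])
    from presented_open_submanifold[OF M this]
    have pG: "presented (open_submanifold M P) G p d0"
    proof -
      have "S \<inter> p -` P = G" unfolding P_def imM[symmetric] using sat G(3) by (auto simp flip: q_def)
      then show ?thesis using presented_open_submanifold[OF M \<open>openin (mtop M) P\<close>] by simp
    qed
    have "submersion (open_submanifold M P) \<lparr>mtop = top_of_set (\<phi> ` q ` G), charts = {(\<phi> ` q ` G, id)}\<rparr>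
        (\<lambda>m. \<phi> (R `` {m}))"
      unfolding im
    proof (rule submersionI_lift[OF pG])
      have *: "\<phi> (R `` {p y}) = h y" if "y \<in> G" for y using \<phi>[OF that] by (simp add: q_def)
      show "smooth_on G (\<lambda>y. \<phi> (R `` {p y}))" by (rule smooth_on_cong[OF h(1)]) (simp add: *)
      show "\<phi> (R `` {p y}) \<in> h ` G" if "y \<in> G" for y using that * by simp
      fix y assume y: "y \<in> G"
      have "((\<lambda>y. \<phi> (R `` {p y})) has_derivative frechet_derivative h (at y)) (at y)"
        by (rule has_derivative_transform_within_open[OF smooth_on_has_derivative[OF h(1) G(1) y] G(1) y])
          (simp add: *)
      then have "frechet_derivative h (at y) = frechet_derivative (\<lambda>y. \<phi> (R `` {p y})) (at y)"
        by (rule frechet_derivative_at)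
      moreover obtain \<sigma> where \<sigma>: "smooth_on (h ` G) \<sigma>" "\<sigma> ` h ` G \<subseteq> G" "\<And>w. w \<in> h ` G \<Longrightarrow> h (\<sigma> w) = w" "\<sigma> (h y) = y"
        by (rule slice_sectionE[OF sl y]) blast
      have "W \<subseteq> range (frechet_derivative h (at y))"
        by (rule section_derivative[OF h(1) G(1) h(2) W(1) \<sigma>(1-3) imageI[OF y] \<sigma>(4)[symmetric]])
      ultimately show "span (h ` G) \<subseteq> range (frechet_derivative (\<lambda>y. \<phi> (R `` {p y})) (at y))"
        using span_openin[OF h(2) W(1)] y by auto
    qed
    then have "(q ` G, \<phi>) \<in> charts ?Q"
      using chart unfolding P_def by (auto simp: quotient_manifold_def)
    then show ?thesis using chart \<phi> by blast
  qed
  have sl': "sliced S q d" using sl by (simp add: q_def[abs_def])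
  have cover: "\<exists>U \<phi>. (U, \<phi>) \<in> charts ?Q \<and> is_chart d ?X U \<phi> \<and> c \<in> U" if c: "c \<in> topspace ?X" for c
  proof -
    from c obtain x where x: "x \<in> S" "c = q x" by (auto simp: topX)
    obtain G h W where "x \<in> G" "slice S q d G h W" using sl' x(1) unfolding sliced_def by blast
    then show ?thesis using slice_chart x(2) by blast
  qed
  have "presented ?Q S q d"
  proof (rule presentedI)
    show "open S" by (rule So)
    show "continuous_map (top_of_set S) (mtop ?Q) q" unfolding top by (rule q_cont)
    show "q ` S = topspace (mtop ?Q)" by (simp add: top topX)
    show "\<exists>U \<phi>. (U, \<phi>) \<in> charts ?Q \<and> c \<in> U" if "c \<in> topspace (mtop ?Q)" for c
      using cover[of c] that unfolding top by blast
    fix V \<psi> assume V: "(V, \<psi>) \<in> charts ?Q"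
    then obtain d' where d': "is_chart d' ?X V \<psi>" by (auto simp: quotient_manifold_def)
    have subm: "submersion (open_submanifold M {m \<in> topspace (mtop M). R `` {m} \<in> V})
         \<lparr>mtop = top_of_set (\<psi> ` V), charts = {(\<psi> ` V, id)}\<rparr> (\<lambda>m. \<psi> (R `` {m}))"
      using V by (auto simp: quotient_manifold_def)
    \<comment> \<open>A subspace of dimension \<open>d\<close> is wanted for the case of an empty
      chart domain \<open>V\<close>.\<close>
    obtain x0 where x0: "x0 \<in> S" using S by blast
    obtain W0 :: "'e set" where W0: "subspace W0" "dim W0 = d"
      using sl' x0 sliceD(3,4) unfolding sliced_def by blast
    have Vo: "openin ?X V" using d' by (rule is_chartE)
    have "is_chart d ?X V \<psi>"
      by (rule is_chart_change_dim[OF d' W0]) (use cover openin_subset[OF Vo] in blast)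
    then show "is_chart d (mtop ?Q) V \<psi>" by (simp add: top)
    then obtain W' where W': "subspace W'" "dim W' = d" "openin (top_of_set W') (\<psi> ` V)" "inj_on \<psi> V"
        "\<And>U. openin ?X U \<Longrightarrow> U \<subseteq> V \<Longrightarrow> openin (top_of_set (\<psi> ` V)) (\<psi> ` U)"
      unfolding top by (rule is_chartE) blast
    define P where "P = {m \<in> topspace (mtop M). R `` {m} \<in> V}"
    have P: "openin (mtop M) P" using Vo unfolding P_def by (simp add: openin_quotient_topology)
    have SP: "S \<inter> p -` P = S \<inter> q -` V" unfolding P_def imM[symmetric] q_def by auto
    have pP: "presented (open_submanifold M P) (S \<inter> q -` V) p d0"
      using presented_open_submanifold[OF M P] by (simp only: SP)
    have SV: "open (S \<inter> q -` V)" using presented_open_preimage[OF M P] by (simp only: SP)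
    have sm: "smooth_on (S \<inter> q -` V) (\<lambda>x. \<psi> (q x))"
      and rng: "\<And>x. x \<in> S \<inter> q -` V \<Longrightarrow> range (frechet_derivative (\<lambda>x. \<psi> (q x)) (at x)) = span (\<psi> ` V)"
      using submersion_lift(1,3)[OF pP subm[folded P_def]] unfolding q_def by blast+
    show "smooth_on (S \<inter> q -` V) (\<lambda>x. \<psi> (q x))" by (rule sm)
    fix x assume x: "x \<in> S" "q x \<in> V"
    obtain G h W where xG: "x \<in> G" and sl: "slice S q d G h W" using sl' x(1) unfolding sliced_def by blast
    note G = sliceD(1)[OF sl] xG sliceD(2)[OF sl] and W = sliceD(3,4)[OF sl] and h = sliceD(5,6)[OF sl]
      and ker = sliceD(7)[OF sl]
    obtain \<phi> where \<phi>: "(q ` G, \<phi>) \<in> charts ?Q" "is_chart d ?X (q ` G) \<phi>" "\<And>y. y \<in> G \<Longrightarrow> \<phi> (q y) = h y"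
      using slice_chart[OF xG sl] by blast
    obtain \<sigma> where \<sigma>: "smooth_on (h ` G) \<sigma>" "\<sigma> ` h ` G \<subseteq> G" "\<And>w. w \<in> h ` G \<Longrightarrow> h (\<sigma> w) = w" "\<sigma> (h x) = x"
      by (rule slice_sectionE[OF sl xG]) blast
    let ?E = "\<lambda>y. frechet_derivative (\<lambda>x. \<psi> (q x)) (at y)"
    define G1 where "G1 = G \<inter> q -` V"
    have G1: "open G1" "G1 \<subseteq> S \<inter> q -` V"
      using open_Int[OF G(1) SV] G(3) by (auto simp: G1_def Int_absorb2 Int_assoc[symmetric])
    \<comment> \<open>The slice and the chart \<open>\<psi>\<close> overlap only partly;
      \<open>A\<close> is the overlap in slice coordinates and \<open>G1\<close> the overlap in the
      covering set.\<close>
    define A where "A = h ` G \<inter> \<sigma> -` (S \<inter> q -` V)"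
    have \<sigma>A: "\<sigma> w \<in> G1" "h (\<sigma> w) = w" if "w \<in> A" for w
      using that \<sigma>(2,3) unfolding A_def G1_def by blast+
    have A: "openin (top_of_set W) A"
      using continuous_openin_preimage_gen[OF smooth_on_continuous[OF \<sigma>(1)] SV] h(2) openin_trans
      unfolding A_def by blast
    define \<tau> where "\<tau> w = \<psi> (q (\<sigma> w))" for w
    define \<kappa> where "\<kappa> w' = \<phi> (inv_into V \<psi> w')" for w'
    have \<tau>: "smooth_on A \<tau>" unfolding \<tau>_def
      by (rule smooth_on_compose[OF sm smooth_on_subset[OF \<sigma>(1)]]) (auto simp: A_def)
    have \<kappa>\<tau>: "\<kappa> (\<tau> w) = w" "inv_into V \<psi> (\<tau> w) = q (\<sigma> w)" if "w \<in> A" for w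
    proof -
      have "q (\<sigma> w) \<in> V" using that by (auto simp: A_def)
      then show "inv_into V \<psi> (\<tau> w) = q (\<sigma> w)" using W'(4) by (simp add: \<tau>_def)
      then show "\<kappa> (\<tau> w) = w" using \<sigma>A[OF that] \<phi>(3) by (simp add: \<kappa>_def G1_def)
    qed
    have hG1: "h y \<in> A" "q (\<sigma> (h y)) = q y" if y: "y \<in> G1" for y
    proof -
      have yG: "y \<in> G" "q y \<in> V" using y by (auto simp: G1_def)
      then have *: "\<sigma> (h y) \<in> G" "h (\<sigma> (h y)) = h y" using \<sigma>(2,3) by blast+
      then show **: "q (\<sigma> (h y)) = q y" using ker[OF yG(1)] G(3) by auto
      then show "h y \<in> A" using yG * G(3) by (auto simp: A_def)
    qed
    have \<tau>A: "\<tau> ` A = \<psi> ` (V \<inter> q ` G)"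
    proof
      show "\<tau> ` A \<subseteq> \<psi> ` (V \<inter> q ` G)" using \<sigma>A by (auto simp: \<tau>_def G1_def)
      show "\<psi> ` (V \<inter> q ` G) \<subseteq> \<tau> ` A"
      proof clarify
        fix y assume "q y \<in> V" "y \<in> G"
        then have y: "y \<in> G1" by (simp add: G1_def)
        then have "\<psi> (q y) = \<tau> (h y)" using hG1 by (simp add: \<tau>_def)
        then show "\<psi> (q y) \<in> \<tau> ` A" using hG1(1)[OF y] by blast
      qed
    qed
    \<comment> \<open>On \<open>G1\<close> the identity
      \<open>\<psi> \<circ> q = \<tau> \<circ> h\<close> holds. The left side has differential onto
      \<open>W'\<close> and the differential of \<open>h\<close> takes values in \<open>W\<close>,
      so the derivative of \<open>\<tau>\<close> maps \<open>W\<close> onto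
      \<open>W'\<close>.\<close>
    have \<kappa>: "smooth_on (\<tau> ` A) \<kappa>"
    proof (rule smooth_on_inverse_map_subspace[OF W(1) W'(1) _ A \<tau> _ \<kappa>\<tau>(1)])
      show "dim W = dim W'" using W W' by simp
      show "\<tau> ` A \<subseteq> W'" unfolding \<tau>A using W'(3) openin_imp_subset by blast
      fix w assume w: "w \<in> A"
      obtain D where D: "(\<tau> has_derivative D) (at w within A)"
        using smooth_on_has_derivative_within[OF \<tau> w] by blast
      define y where "y = \<sigma> w"
      have y: "y \<in> G1" "h y = w" using \<sigma>A[OF w] by (auto simp: y_def)
      let ?H = "frechet_derivative h (at y)"
      have yG: "y \<in> G" using y by (simp add: G1_def)
      have H: "(h has_derivative ?H) (at y)" by (rule smooth_on_has_derivative[OF h(1) G(1) yG])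
      have "((\<lambda>y. \<tau> (h y)) has_derivative (\<lambda>v. D (?H v))) (at y within G1)"
        by (rule has_derivative_in_compose[OF has_derivative_at_withinI[OF H]])
          (rule has_derivative_subset[OF D[folded y(2)]], use hG1 in blast)
      then have "((\<lambda>y. \<tau> (h y)) has_derivative (\<lambda>v. D (?H v))) (at y)"
        by (simp only: at_within_open[OF y(1) G1(1)])
      then have "((\<lambda>y. \<psi> (q y)) has_derivative (\<lambda>v. D (?H v))) (at y)"
        by (rule has_derivative_transform_within_open[OF _ G1(1) y(1)]) (simp add: \<tau>_def hG1(2))
      then have "?E y = (\<lambda>v. D (?H v))" using frechet_derivative_at by metis
      then have "range (?E y) = D ` range ?H" by (metis image_image)
      moreover have "range ?H \<subseteq> W"
        using has_derivative_in_subspace[OF H G(1) yG _ W(1)] h(2) openin_imp_subset by blast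
      moreover have "range (?E y) = W'"
      proof -
        have "y \<in> S \<inter> q -` V" using y G1 by auto
        then show ?thesis using rng span_openin[OF W'(3,1)] by auto
      qed
      ultimately have "W' \<subseteq> D ` W" by auto
      then show "\<exists>D. (\<tau> has_derivative D) (at w within A) \<and> W' \<subseteq> D ` W" using D by blast
    qed
    have xG1: "x \<in> G1" using x G by (auto simp: G1_def)
    have \<tau>x: "\<tau> (h x) = \<psi> (q x)" using \<sigma>(4) by (simp add: \<tau>_def)
    have "openin ?X (q ` G)" using \<phi>(2) by (rule is_chartE)
    then have "openin ?X (V \<inter> q ` G)" using Vo by blast
    then have \<tau>A_open: "openin (top_of_set (\<psi> ` V)) (\<tau> ` A)" unfolding \<tau>A using W'(5) by blast
    show "\<exists>B \<sigma>'. openin (top_of_set (\<psi> ` V)) B \<and> \<psi> (q x) \<in> B \<and> smooth_on B \<sigma>' \<and> \<sigma>' ` B \<subseteq> S \<and>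
        (\<forall>w\<in>B. q (\<sigma>' w) = inv_into V \<psi> w) \<and> \<sigma>' (\<psi> (q x)) = x"
    proof (rule exI[of _ "\<tau> ` A"], rule exI[of _ "\<lambda>w'. \<sigma> (\<kappa> w')"], intro conjI ballI)
      show "\<psi> (q x) \<in> \<tau> ` A" using \<tau>x hG1(1)[OF xG1] by (metis imageI)
      show "smooth_on (\<tau> ` A) (\<lambda>w'. \<sigma> (\<kappa> w'))"
        by (rule smooth_on_compose[OF \<sigma>(1) \<kappa>]) (use \<kappa>\<tau> in \<open>auto simp: A_def\<close>)
      show "\<sigma> (\<kappa> (\<psi> (q x))) = x"
        using \<kappa>\<tau>(1)[OF hG1(1)[OF xG1]] \<sigma>(4) by (simp add: \<tau>x)
      show "(\<lambda>w'. \<sigma> (\<kappa> w')) ` \<tau> ` A \<subseteq> S" using \<kappa>\<tau> by (auto simp: A_def)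
      show "q (\<sigma> (\<kappa> w')) = inv_into V \<psi> w'" if "w' \<in> \<tau> ` A" for w' using that \<kappa>\<tau> by auto
    qed (rule \<tau>A_open)
  qed
  then show ?thesis by (simp add: q_def[abs_def])
qed

section \<open>Configurations, the action and the retraction onto \<open>Z\<close>\<close>

lemma norm_vector_scalar_mult: "norm (a *s q) = norm a * norm (q :: 'a::real_normed_div_algebra ^ 'n::finite)"
  by (simp add: norm_vec_def L2_set_def norm_mult power_mult_distrib real_sqrt_mult flip: sum_distrib_left)

lemma scaleR_eq_of_real_mult: "r *\<^sub>R q = of_real r *s (q :: quat ^ 'n::finite)"
proof -
  have "r *\<^sub>R (q $ i) = of_real r * q $ i" for i by (rule scaleR_conv_of_real)
  then show ?thesis by (simp add: vec_eq_iff)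
qed

lemma \<Phi>_nth [simp]: "\<Phi> \<Lambda> T q $ i = exp (\<Lambda> i \<bullet> T) *\<^sub>R q $ i"
  by (simp add: \<Phi>_def)

lemma \<Phi>_0 [simp]: "\<Phi> \<Lambda> 0 q = q"
  by (simp add: vec_eq_iff)

lemma \<Phi>_\<Phi>: "\<Phi> \<Lambda> S (\<Phi> \<Lambda> T q) = \<Phi> \<Lambda> (S + T) q"
  by (simp add: vec_eq_iff inner_add_right exp_add)

lemma \<Phi>_scalar: "\<Phi> \<Lambda> T (a *s q) = a *s \<Phi> \<Lambda> T q"
  by (simp add: vec_eq_iff)

lemma smooth_on_\<Phi>:
  fixes t :: "'a::euclidean_space \<Rightarrow> real ^ 'd::finite"
  assumes "smooth_on A t" "smooth_on A f"
  shows "smooth_on A (\<lambda>x. \<Phi> \<Lambda> (t x) (f x))"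
  unfolding \<Phi>_def
  by (intro smooth_on_vec_lambda smooth_on_scaleR smooth_on_exp smooth_on_inner smooth_on_const
      smooth_on_vec_nth assms)

lemma smooth_on_scalar_mult:
  fixes f :: "'a::euclidean_space \<Rightarrow> quat ^ 'n::finite"
  assumes "smooth_on A a" "smooth_on A f"
  shows "smooth_on A (\<lambda>x. a x *s f x)"
  unfolding vector_scalar_mult_def
  by (intro smooth_on_vec_lambda smooth_on_mult smooth_on_vec_nth assms)

section \<open>Joint orbits of scalars and flow, and the moment map\<close>

text \<open>The orbits of \<bbbH>* and the vector action together. They turn out to be the fibres
  over \<open>S_set \<Lambda>\<close> of the projections onto both \<open>N\<close> and the orbit
  space of \<open>V\<close>.\<close>

definition orbit_rel :: "('n::finite \<Rightarrow> real ^ 'd::finite) \<Rightarrow> quat ^ 'n \<Rightarrow> quat ^ 'n \<Rightarrow> bool" where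
  "orbit_rel \<Lambda> p q \<longleftrightarrow> (\<exists>a T. a \<noteq> 0 \<and> q = a *s \<Phi> \<Lambda> T p)"

lemma orbit_rel_sym: "orbit_rel \<Lambda> p q \<Longrightarrow> orbit_rel \<Lambda> q p"
proof -
  assume "orbit_rel \<Lambda> p q"
  then obtain a T where "a \<noteq> 0" "q = a *s \<Phi> \<Lambda> T p" by (auto simp: orbit_rel_def)
  then have "inverse a \<noteq> 0" "p = inverse a *s \<Phi> \<Lambda> (- T) q"
    by (simp_all add: \<Phi>_scalar \<Phi>_\<Phi> vector_smult_assoc)
  then show ?thesis unfolding orbit_rel_def by blast
qed

lemma orbit_rel_trans: "orbit_rel \<Lambda> p q \<Longrightarrow> orbit_rel \<Lambda> q r \<Longrightarrow> orbit_rel \<Lambda> p r"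
proof -
  assume "orbit_rel \<Lambda> p q" "orbit_rel \<Lambda> q r"
  then obtain a T b U where "a \<noteq> 0" "q = a *s \<Phi> \<Lambda> T p" "b \<noteq> 0" "r = b *s \<Phi> \<Lambda> U q"
    by (auto simp: orbit_rel_def)
  then have "b * a \<noteq> 0" "r = (b * a) *s \<Phi> \<Lambda> (U + T) p"
    by (simp_all add: \<Phi>_scalar \<Phi>_\<Phi> vector_smult_assoc)
  then show ?thesis unfolding orbit_rel_def by blast
qed

text \<open>Twice this vector is the gradient at \<open>T = 0\<close> of the convex function that
  defines \<open>time\<close>.\<close>

definition moment :: "('n::finite \<Rightarrow> real ^ 'd::finite) \<Rightarrow> quat ^ 'n \<Rightarrow> real ^ 'd" where
  "moment \<Lambda> q = (\<Sum>i\<in>UNIV. (norm (q $ i))\<^sup>2 *\<^sub>R \<Lambda> i)"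

lemma moment_scalar: "moment \<Lambda> (a *s q) = (norm a)\<^sup>2 *\<^sub>R moment \<Lambda> q"
  by (simp add: moment_def norm_mult power_mult_distrib scaleR_sum_right)

lemma moment_scaleR: "moment \<Lambda> (r *\<^sub>R q) = r\<^sup>2 *\<^sub>R moment \<Lambda> q"
  by (simp add: scaleR_eq_of_real_mult moment_scalar)

lemma moment_\<Phi>: "moment \<Lambda> (\<Phi> \<Lambda> T q) = (\<Sum>i\<in>UNIV. (exp (2 * (\<Lambda> i \<bullet> T)) * (norm (q $ i))\<^sup>2) *\<^sub>R \<Lambda> i)"
  by (simp add: moment_def power_mult_distrib flip: exp_double)

lemma Z_set_iff: "q \<in> Z_set \<Lambda> \<longleftrightarrow> moment \<Lambda> q = 0 \<and> norm q = 1"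
proof -
  have "(norm q)\<^sup>2 = (\<Sum>i\<in>UNIV. (norm (q $ i))\<^sup>2)"
    by (simp add: norm_vec_def L2_set_def sum_nonneg)
  moreover have "norm q = 1 \<longleftrightarrow> (norm q)\<^sup>2 = 1"
    using norm_ge_zero[of q] by (auto simp: power2_eq_1_iff simp del: norm_ge_zero)
  ultimately show ?thesis by (auto simp: Z_set_def moment_def)
qed

text \<open>The numbers \<open>(norm (q $ i))\<^sup>2\<close> are themselves the coefficients of a
  convex combination of the supporting weights equal to 0.\<close>

lemma Z_subset_S: "Z_set \<Lambda> \<subseteq> S_set \<Lambda>"
proof
  fix q assume q: "q \<in> Z_set \<Lambda>"
  let ?I = "{i. q $ i \<noteq> 0}"
  have "(\<Sum>i\<in>?I. (norm (q $ i))\<^sup>2 *\<^sub>R \<Lambda> i) \<in> convex hull (\<Lambda> ` ?I)"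
  proof (rule convex_sum)
    have "(\<Sum>i\<in>?I. (norm (q $ i))\<^sup>2) = (\<Sum>i\<in>UNIV. (norm (q $ i))\<^sup>2)"
      by (rule sum.mono_neutral_left) auto
    then show "(\<Sum>i\<in>?I. (norm (q $ i))\<^sup>2) = 1" using q by (simp add: Z_set_def)
  qed (auto intro: hull_inc)
  moreover have "(\<Sum>i\<in>?I. (norm (q $ i))\<^sup>2 *\<^sub>R \<Lambda> i) = (\<Sum>i\<in>UNIV. (norm (q $ i))\<^sup>2 *\<^sub>R \<Lambda> i)"
    by (rule sum.mono_neutral_left) auto
  ultimately show "q \<in> S_set \<Lambda>" using q by (simp add: S_set_def Z_set_def)
qed

lemma S_set_support: "q \<in> S_set \<Lambda> \<Longrightarrow> (\<And>i. q $ i \<noteq> 0 \<Longrightarrow> q' $ i \<noteq> 0) \<Longrightarrow> q' \<in> S_set \<Lambda>"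
  unfolding S_set_def using hull_mono[of "\<Lambda> ` {i. q $ i \<noteq> 0}" "\<Lambda> ` {i. q' $ i \<noteq> 0}" convex] by blast

lemma S_set_orbit: "q \<in> S_set \<Lambda> \<Longrightarrow> a \<noteq> 0 \<Longrightarrow> a *s \<Phi> \<Lambda> T q \<in> S_set \<Lambda>"
  by (erule S_set_support) simp

lemma S_set_\<Phi>: "q \<in> S_set \<Lambda> \<Longrightarrow> \<Phi> \<Lambda> T q \<in> S_set \<Lambda>"
  by (erule S_set_support) simp

lemma S_set_nonzero: "q \<in> S_set \<Lambda> \<Longrightarrow> q \<noteq> 0"
  by (auto simp: S_set_def)

text \<open>Coordinates that are nonzero at \<open>q\<close> stay nonzero nearby, so the support can
  only grow, and membership survives enlarging the support.\<close>

lemma open_S_set: "open (S_set (\<Lambda> :: 'n::finite \<Rightarrow> real ^ 'd::finite))"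
proof (subst openin_subopen[of euclidean, simplified], intro ballI)
  fix q assume q: "q \<in> S_set \<Lambda>"
  let ?V = "\<Inter>i\<in>{i. q $ i \<noteq> 0}. {q' :: quat ^ 'n. q' $ i \<noteq> 0}"
  have "open {q' :: quat ^ 'n. q' $ i \<noteq> 0}" for i
    by (rule open_Collect_neq) (intro continuous_intros)+
  then have "open ?V" by (intro open_INT ballI) auto
  moreover have "?V \<subseteq> S_set \<Lambda>" using S_set_support[OF q] by auto
  ultimately show "\<exists>T. open T \<and> q \<in> T \<and> T \<subseteq> S_set \<Lambda>" by blast
qed

section \<open>Consequences of admissibility: uniqueness and existence of the critical point\<close>

locale configuration =
  fixes \<Lambda> :: "'n::finite \<Rightarrow> real ^ 'd::finite"
  assumes admissible: "admissible \<Lambda>"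
begin

text \<open>By Caratheodory, admissibility forbids \<open>0\<close> to lie on the boundary of the convex hull of the
  \<open>\<Lambda> i\<close> with \<open>q $ i \<noteq> 0\<close>.\<close>

lemma exists_positive:
  assumes q: "q \<in> S_set \<Lambda>" and t: "t \<noteq> 0"
  shows "\<exists>i. q $ i \<noteq> 0 \<and> \<Lambda> i \<bullet> t > 0"
proof (rule ccontr)
  assume neg: "\<nexists>i. q $ i \<noteq> 0 \<and> \<Lambda> i \<bullet> t > 0"
  let ?P = "\<Lambda> ` {i. q $ i \<noteq> 0}"
  have fin: "finite ?P" by simp
  have "0 \<in> convex hull ?P" using q by (simp add: S_set_def)
  then obtain u where u: "\<forall>v\<in>?P. 0 \<le> u v" "sum u ?P = 1" "(\<Sum>v\<in>?P. u v *\<^sub>R v) = 0"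
    unfolding convex_hull_finite[OF fin] by blast
  \<comment> \<open>Under the contrary assumption no supporting weight has positive product with
    \<open>t\<close>, while the weighted sum of these products is 0. Hence the coefficients live on
    the weights orthogonal to \<open>t\<close>.\<close>
  let ?Q = "?P \<inter> {v. t \<bullet> v = 0}"
  have "(\<Sum>v\<in>?P. u v * - (t \<bullet> v)) = - (t \<bullet> (\<Sum>v\<in>?P. u v *\<^sub>R v))"
    by (simp add: inner_sum_right sum_negf)
  then have sum0: "(\<Sum>v\<in>?P. u v * - (t \<bullet> v)) = 0" using u(3) by simp
  have "\<forall>v\<in>?P. u v * - (t \<bullet> v) = 0"
  proof (rule iffD1[OF sum_nonneg_eq_0_iff[OF fin] sum0])
    show "0 \<le> u v * - (t \<bullet> v)" if "v \<in> ?P" for v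
      using that u(1) neg by (intro mult_nonneg_nonneg) (auto simp: inner_commute not_less)
  qed
  then have z: "u v = 0" if "v \<in> ?P - ?Q" for v using that by auto
  have "(\<Sum>v\<in>?Q. u v *\<^sub>R v) \<in> convex hull ?Q"
  proof (rule convex_sum)
    have "sum u ?Q = sum u ?P" by (rule sum.mono_neutral_left) (use fin z in auto)
    then show "sum u ?Q = 1" using u(2) by simp
  qed (use u(1) in \<open>auto intro: hull_inc\<close>)
  moreover have "(\<Sum>v\<in>?Q. u v *\<^sub>R v) = (\<Sum>v\<in>?P. u v *\<^sub>R v)"
    by (rule sum.mono_neutral_left) (use fin z in auto)
  ultimately have "0 \<in> convex hull ?Q" using u(3) by simp
  \<comment> \<open>\<open>?Q\<close> lies in a hyperplane, of dimension \<open>d - 1\<close>, so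
    Caratheodory yields at most \<open>d\<close> points, whereas admissibility asks for more than
    \<open>d\<close> indices.\<close>
  then obtain C where C: "finite C" "C \<subseteq> ?Q" "int (card C) \<le> aff_dim ?Q + 1" "0 \<in> convex hull C"
    using caratheodory_aff_dim[of ?Q] by blast
  have "aff_dim ?Q \<le> aff_dim {v. t \<bullet> v = 0}" by (rule aff_dim_subset) auto
  also have "\<dots> = int CARD('d) - 1" using aff_dim_hyperplane[OF t, of 0] by simp
  finally have "card C \<le> CARD('d)" using C(3) by simp
  \<comment> \<open>Different indices may carry equal weights; picking one index per point makes the
    number of indices equal to the number of points.\<close>
  moreover obtain I where I: "inj_on \<Lambda> I" "C = \<Lambda> ` I"
    using C(2) subset_image_inj[of C \<Lambda> UNIV] by (metis Int_lower1 image_mono order_trans top_greatest)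
  ultimately have "card I \<le> CARD('d)" by (simp add: card_image)
  moreover have "card I > CARD('d)"
    using admissible C(4) I(2) by (simp add: admissible_def)
  ultimately show False by simp
qed

text \<open>If \<open>t\<close> were nonzero, \<open>exists_positive\<close> for \<open>t\<close>
  and for \<open>- t\<close> would give supporting weights with products of both signs, but all
  these products equal \<open>- c\<close>. Hence the weights in the support affinely span the whole
  space.\<close>

lemma orthogonal_support:
  assumes "q \<in> S_set \<Lambda>" "\<And>i. q $ i \<noteq> 0 \<Longrightarrow> \<Lambda> i \<bullet> t + c = 0"
  shows "t = 0" "c = 0"
proof -
  show t: "t = 0"
  proof (rule ccontr)
    assume "t \<noteq> 0"
    then obtain i j where "q $ i \<noteq> 0" "\<Lambda> i \<bullet> t > 0" "q $ j \<noteq> 0" "\<Lambda> j \<bullet> (- t) > 0"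
      using exists_positive[OF assms(1), of t] exists_positive[OF assms(1), of "- t"] by auto
    then show False using assms(2)[of i] assms(2)[of j] by simp
  qed
  obtain i where "q $ i \<noteq> 0" using S_set_nonzero[OF assms(1)] by (auto simp: vec_eq_iff)
  then show "c = 0" using assms(2)[of i] t by simp
qed

text \<open>Strict monotonicity of the gradient of a convex function: pairing the difference of the
  moments with \<open>T - T'\<close> gives a sum of terms \<open>(exp a - exp b) * (a - b)\<close>
  with nonnegative factors. All of them vanish, so \<open>T - T'\<close> is orthogonal to the
  weights in the support.\<close>

lemma moment_\<Phi>_inj:
  assumes q: "q \<in> S_set \<Lambda>" and eq: "moment \<Lambda> (\<Phi> \<Lambda> T q) = moment \<Lambda> (\<Phi> \<Lambda> T' q)"
  shows "T = T'"
proof -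
  let ?t = "T - T'"
  let ?s = "\<lambda>i. (norm (q $ i))\<^sup>2 * ((exp (2 * (\<Lambda> i \<bullet> T)) - exp (2 * (\<Lambda> i \<bullet> T'))) * (\<Lambda> i \<bullet> ?t))"
  have "(moment \<Lambda> (\<Phi> \<Lambda> T q) - moment \<Lambda> (\<Phi> \<Lambda> T' q)) \<bullet> ?t = (\<Sum>i\<in>UNIV. ?s i)"
    unfolding moment_\<Phi> sum_subtractf[symmetric] inner_sum_left
    by (rule sum.cong) (simp_all add: inner_diff_left inner_diff_right algebra_simps)
  then have sum0: "(\<Sum>i\<in>UNIV. ?s i) = 0" using eq by simp
  have "\<forall>i\<in>UNIV. ?s i = 0"
  proof (rule iffD1[OF sum_nonneg_eq_0_iff sum0])
    fix i
    have "(exp (2 * (\<Lambda> i \<bullet> T)) - exp (2 * (\<Lambda> i \<bullet> T'))) * (\<Lambda> i \<bullet> ?t) \<ge> 0"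
      by (cases "\<Lambda> i \<bullet> T \<le> \<Lambda> i \<bullet> T'")
        (auto simp: inner_diff_right intro: mult_nonneg_nonneg mult_nonpos_nonpos)
    then show "?s i \<ge> 0" by (rule mult_nonneg_nonneg[OF zero_le_power2])
  qed simp
  then have "\<Lambda> i \<bullet> ?t + 0 = 0" if "q $ i \<noteq> 0" for i
    using that by (auto simp: inner_diff_right)
  then have "?t = 0" by (rule orthogonal_support(1)[OF q])
  then show ?thesis by simp
qed

text \<open>A zero of \<open>T \<mapsto> moment \<Lambda> (\<Phi> \<Lambda> T q)\<close> is a critical point of the coercive function
  \<open>T \<mapsto> \<Sum>i. e\<^bsup>2\<langle>\<Lambda> i, T\<rangle>\<^esup> |q i|\<^sup>2\<close>, so its minimum provides one.\<close>

lemma moment_\<Phi>_zero: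
  assumes q: "q \<in> S_set \<Lambda>"
  shows "\<exists>T. moment \<Lambda> (\<Phi> \<Lambda> T q) = 0"
proof -
  define f where "f T = (\<Sum>i\<in>UNIV. exp (2 * (\<Lambda> i \<bullet> T)) * (norm (q $ i))\<^sup>2)" for T
  \<comment> \<open>A minorant of \<open>f\<close> that is positively homogeneous of degree 1; its
    minimum on the unit sphere, positive by \<open>exists_positive\<close>, gives linear growth of
    \<open>f\<close>.\<close>
  define m where "m t = (\<Sum>i\<in>UNIV. max 0 (2 * (\<Lambda> i \<bullet> t)) * (norm (q $ i))\<^sup>2)" for t
  have m_pos: "m t > 0" if t: "t \<noteq> 0" for t
  proof -
    obtain i where "q $ i \<noteq> 0" "\<Lambda> i \<bullet> t > 0" using exists_positive[OF q t] by blast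
    then show ?thesis unfolding m_def by (intro sum_pos2[of UNIV i]) auto
  qed
  have fm: "f T \<ge> m T" for T unfolding f_def m_def
  proof (intro sum_mono mult_right_mono)
    show "max 0 (2 * (\<Lambda> i \<bullet> T)) \<le> exp (2 * (\<Lambda> i \<bullet> T))" for i
    proof -
      have "2 * (\<Lambda> i \<bullet> T) \<le> exp (2 * (\<Lambda> i \<bullet> T))"
        using exp_ge_add_one_self[of "2 * (\<Lambda> i \<bullet> T)"] by linarith
      then show ?thesis by simp
    qed
  qed simp
  have "continuous_on (sphere 0 1) m" unfolding m_def by (intro continuous_intros)
  moreover have "sphere (0 :: real ^ 'd) 1 \<noteq> {}" by simp
  ultimately obtain t0 where t0: "t0 \<in> sphere 0 1" "\<And>t. t \<in> sphere 0 1 \<Longrightarrow> m t0 \<le> m t"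
    using continuous_attains_inf[OF compact_sphere] by metis
  define \<delta> where "\<delta> = m t0"
  have \<delta>: "\<delta> > 0" unfolding \<delta>_def by (rule m_pos) (use t0 in auto)
  have m_ge: "m T \<ge> \<delta> * norm T" for T
  proof (cases "T = 0")
    case False
    have "m T = norm T * m (T /\<^sub>R norm T)"
      unfolding m_def sum_distrib_left
    proof (rule sum.cong[OF refl])
      fix i
      have "max 0 (2 * (\<Lambda> i \<bullet> T)) = norm T * max 0 (2 * (\<Lambda> i \<bullet> (T /\<^sub>R norm T)))"
        using False by (auto simp: max_def divide_simps zero_le_mult_iff)
      then show "max 0 (2 * (\<Lambda> i \<bullet> T)) * (norm (q $ i))\<^sup>2 =
          norm T * (max 0 (2 * (\<Lambda> i \<bullet> (T /\<^sub>R norm T))) * (norm (q $ i))\<^sup>2)" by simp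
    qed
    moreover have "m (T /\<^sub>R norm T) \<ge> \<delta>" unfolding \<delta>_def using False by (intro t0) simp
    ultimately show ?thesis by (metis mult.commute mult_left_mono norm_ge_zero)
  qed (simp add: m_def)
  \<comment> \<open>Outside this radius the bound \<open>\<delta> * norm T\<close> already exceeds
    \<open>f 0\<close>, so a minimum over the ball is global.\<close>
  let ?K = "cball (0 :: real ^ 'd) (f 0 / \<delta>)"
  have f0: "f 0 \<ge> 0" unfolding f_def by (intro sum_nonneg) simp
  have "continuous_on ?K f" unfolding f_def by (intro continuous_intros)
  moreover have "0 \<in> ?K" using f0 \<delta> by simp
  ultimately obtain T where T: "T \<in> ?K" "\<And>T'. T' \<in> ?K \<Longrightarrow> f T \<le> f T'"
    using continuous_attains_inf[OF compact_cball, of 0 "f 0 / \<delta>" f] by blast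
  have min: "f T \<le> f T'" for T'
  proof (cases "T' \<in> ?K")
    case False
    then have "f 0 / \<delta> < norm T'" by simp
    then have "f 0 < \<delta> * norm T'" using \<delta> by (metis pos_divide_less_eq mult.commute)
    then show ?thesis using m_ge[of T'] fm[of T'] T(2)[OF \<open>0 \<in> ?K\<close>] by linarith
  qed (rule T)
  have "(f has_derivative (\<lambda>h. \<Sum>i\<in>UNIV. exp (2 * (\<Lambda> i \<bullet> T)) * (2 * (\<Lambda> i \<bullet> h)) * (norm (q $ i))\<^sup>2)) (at T)"
    unfolding f_def by (auto intro!: derivative_eq_intros simp: mult.commute mult.left_commute)
  then have "(\<lambda>h. \<Sum>i\<in>UNIV. exp (2 * (\<Lambda> i \<bullet> T)) * (2 * (\<Lambda> i \<bullet> h)) * (norm (q $ i))\<^sup>2) = (\<lambda>h. 0)"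
    by (rule has_derivative_local_min) (simp add: min)
  then have "(\<Sum>i\<in>UNIV. exp (2 * (\<Lambda> i \<bullet> T)) * (2 * (\<Lambda> i \<bullet> h)) * (norm (q $ i))\<^sup>2) = 0" for h
    by (rule fun_cong)
  moreover have "(\<Sum>i\<in>UNIV. exp (2 * (\<Lambda> i \<bullet> T)) * (2 * (\<Lambda> i \<bullet> h)) * (norm (q $ i))\<^sup>2) =
      2 * (moment \<Lambda> (\<Phi> \<Lambda> T q) \<bullet> h)" for h
    by (simp add: moment_\<Phi> inner_sum_left sum_distrib_left mult_ac)
  \<comment> \<open>The vanishing derivative is evaluated in the direction of the moment
    itself.\<close>
  ultimately have "moment \<Lambda> (\<Phi> \<Lambda> T q) \<bullet> moment \<Lambda> (\<Phi> \<Lambda> T q) = 0" by simp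
  then show ?thesis by auto
qed

section \<open>The time of arrival at the critical point and its smoothness\<close>

definition time :: "quat ^ 'n \<Rightarrow> real ^ 'd" where
  "time q = (THE T. moment \<Lambda> (\<Phi> \<Lambda> T q) = 0)"

lemma time_eqI: "q \<in> S_set \<Lambda> \<Longrightarrow> moment \<Lambda> (\<Phi> \<Lambda> T q) = 0 \<Longrightarrow> time q = T"
  unfolding time_def using moment_\<Phi>_inj by (intro the_equality) auto

lemma moment_time: "q \<in> S_set \<Lambda> \<Longrightarrow> moment \<Lambda> (\<Phi> \<Lambda> (time q) q) = 0"
  using moment_\<Phi>_zero time_eqI by metis

text \<open>Scalars multiply the moment by a positive number and leave its zero in place; flowing
  for \<open>T\<close> shortens the remaining time by \<open>T\<close>.\<close>

lemma time_orbit: "q \<in> S_set \<Lambda> \<Longrightarrow> a \<noteq> 0 \<Longrightarrow> time (a *s \<Phi> \<Lambda> T q) = time q - T"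
  by (intro time_eqI S_set_orbit) (simp_all add: \<Phi>_scalar \<Phi>_\<Phi> moment_scalar moment_time)

text \<open>Implicit function theorem: \<open>(q, T) \<mapsto> (q, moment \<Lambda> (\<Phi> \<Lambda> T q))\<close> is an injective local
  diffeomorphism.\<close>

lemma smooth_time: "smooth_on (S_set \<Lambda>) time"
proof -
  define F where "F z = (fst z, moment \<Lambda> (\<Phi> \<Lambda> (snd z) (fst z)))" for z
  let ?U = "S_set \<Lambda> \<times> (UNIV :: (real ^ 'd) set)"
  have U: "open ?U" by (intro open_Times open_S_set open_UNIV)
  have F: "smooth_on ?U F"
    unfolding F_def moment_def power2_norm_eq_inner
    by (intro smooth_on_Pair smooth_on_fst smooth_on_snd smooth_on_sum smooth_on_scaleR smooth_on_inner
        smooth_on_vec_nth smooth_on_\<Phi> smooth_on_id smooth_on_const)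
  have injF: "inj_on F ?U"
  proof (rule inj_onI)
    fix z z' assume z: "z \<in> ?U" "z' \<in> ?U" "F z = F z'"
    then have fst: "fst z = fst z'" by (simp add: F_def)
    have "snd z = snd z'"
    proof (rule moment_\<Phi>_inj)
      show "fst z \<in> S_set \<Lambda>" using z by auto
      show "moment \<Lambda> (\<Phi> \<Lambda> (snd z) (fst z)) = moment \<Lambda> (\<Phi> \<Lambda> (snd z') (fst z))"
        using z(3) fst by (simp add: F_def)
    qed
    then show "z = z'" using fst by (simp add: prod_eq_iff)
  qed
  have der: "inj (frechet_derivative F (at z))" if z: "z \<in> ?U" for z
  proof -
    let ?E = "frechet_derivative F (at z)"
    obtain q T where qT: "z = (q, T)" "q \<in> S_set \<Lambda>" using z by auto
    have E: "(F has_derivative ?E) (at z)" by (rule smooth_on_has_derivative[OF F U z])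
    have fstE: "fst (?E v) = fst v" for v
    proof -
      have "((\<lambda>z. fst (F z)) has_derivative (\<lambda>v. fst (?E v))) (at z)" by (rule has_derivative_fst[OF E])
      then have "(fst has_derivative (\<lambda>v. fst (?E v))) (at z)" by (simp add: F_def)
      moreover have "(fst has_derivative fst) (at z)"
        by (rule has_derivative_fst[OF has_derivative_ident])
      ultimately have "(\<lambda>v. fst (?E v)) = fst" by (rule has_derivative_unique)
      then show ?thesis by metis
    qed
    \<comment> \<open>Differentiation along the line \<open>T + s k\<close> computes the partial
      derivative in \<open>T\<close>, which is half the Hessian of the convex function applied to
      \<open>k\<close>.\<close>
    have sndE: "snd (?E (0, k)) = (\<Sum>i\<in>UNIV. (2 * (\<Lambda> i \<bullet> k) * exp (2 * (\<Lambda> i \<bullet> T)) * (norm (q $ i))\<^sup>2) *\<^sub>R \<Lambda> i)" for k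
    proof -
      let ?c = "\<lambda>s :: real. (q, T + s *\<^sub>R k)"
      have c: "(?c has_derivative (\<lambda>s. (0, s *\<^sub>R k))) (at 0)" by (auto intro!: derivative_eq_intros)
      have "(F has_derivative ?E) (at (?c 0))" using E qT by simp
      from has_derivative_snd[OF has_derivative_compose[OF c this]]
      have 1: "((\<lambda>s. snd (F (?c s))) has_derivative (\<lambda>s. snd (?E (0, s *\<^sub>R k)))) (at 0)" .
      have "((\<lambda>s. \<Sum>i\<in>UNIV. (exp (2 * (\<Lambda> i \<bullet> (T + s *\<^sub>R k))) * (norm (q $ i))\<^sup>2) *\<^sub>R \<Lambda> i) has_derivative
          (\<lambda>s. \<Sum>i\<in>UNIV. (exp (2 * (\<Lambda> i \<bullet> T)) * (2 * (\<Lambda> i \<bullet> (s *\<^sub>R k))) * (norm (q $ i))\<^sup>2) *\<^sub>R \<Lambda> i)) (at 0)"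
        by (auto intro!: derivative_eq_intros simp del: inner_scaleR_right scaleR_scaleR simp: mult.commute mult.left_commute)
      then have 2: "((\<lambda>s. snd (F (?c s))) has_derivative
          (\<lambda>s. \<Sum>i\<in>UNIV. (exp (2 * (\<Lambda> i \<bullet> T)) * (2 * (\<Lambda> i \<bullet> (s *\<^sub>R k))) * (norm (q $ i))\<^sup>2) *\<^sub>R \<Lambda> i)) (at 0)"
        by (simp add: F_def moment_\<Phi>)
      from fun_cong[OF has_derivative_unique[OF 1 2], of 1] show ?thesis by (simp add: mult_ac)
    qed
    have "v = 0" if "?E v = 0" for v
    proof -
      have v1: "fst v = 0" using fstE[of v] that by simp
      define k where "k = snd v"
      have v: "v = (0, k)" using v1 by (simp add: k_def prod_eq_iff)
      \<comment> \<open>Pairing with \<open>k\<close> turns the kernel condition into a vanishing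
        sum of nonnegative terms, so \<open>k\<close> is orthogonal to every weight in the
        support.\<close>
      let ?s = "\<lambda>i. 2 * (\<Lambda> i \<bullet> k) * exp (2 * (\<Lambda> i \<bullet> T)) * (norm (q $ i))\<^sup>2 * (\<Lambda> i \<bullet> k)"
      have "(\<Sum>i\<in>UNIV. (2 * (\<Lambda> i \<bullet> k) * exp (2 * (\<Lambda> i \<bullet> T)) * (norm (q $ i))\<^sup>2) *\<^sub>R \<Lambda> i) = 0"
        using sndE[of k] that v by simp
      then have "(\<Sum>i\<in>UNIV. (2 * (\<Lambda> i \<bullet> k) * exp (2 * (\<Lambda> i \<bullet> T)) * (norm (q $ i))\<^sup>2) *\<^sub>R \<Lambda> i) \<bullet> k = 0" by simp
      then have sum0: "(\<Sum>i\<in>UNIV. ?s i) = 0" by (simp add: inner_sum_left)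
      have "\<forall>i\<in>UNIV. ?s i = 0"
      proof (rule iffD1[OF sum_nonneg_eq_0_iff sum0])
        fix i
        have "?s i = 2 * (exp (2 * (\<Lambda> i \<bullet> T)) * (norm (q $ i))\<^sup>2) * (\<Lambda> i \<bullet> k)\<^sup>2"
          by (simp only: power2_eq_square mult_ac)
        moreover have "\<dots> \<ge> 0" by simp
        ultimately show "?s i \<ge> 0" by linarith
      qed simp
      then have "\<Lambda> i \<bullet> k + 0 = 0" if "q $ i \<noteq> 0" for i using that by auto
      then have "k = 0" by (rule orthogonal_support(1)[OF qT(2)])
      then show ?thesis using v by (simp add: zero_prod_def)
    qed
    then show ?thesis using linear_injective_0[OF has_derivative_linear[OF E]] by blast
  qed
  have smF: "smooth_on (F ` ?U) (inv_into ?U F)"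
    by (rule smooth_on_inverse_map(2)[OF U F _ der]) (simp add: inv_into_f_f[OF injF])
  have Ft: "F (q, time q) = (q, 0)" if "q \<in> S_set \<Lambda>" for q
    using moment_time[OF that] by (simp add: F_def)
  \<comment> \<open>The graph of \<open>time\<close> is the zero level of the second component of
    \<open>F\<close>, so the inverse of \<open>F\<close> on the points \<open>(q, 0)\<close>
    recovers it smoothly.\<close>
  have im: "(\<lambda>q. (q, 0)) ` S_set \<Lambda> \<subseteq> F ` ?U"
  proof (rule image_subsetI)
    fix q assume "q \<in> S_set \<Lambda>"
    then show "(q, 0) \<in> F ` ?U" using Ft[of q] by (intro image_eqI[of _ _ "(q, time q)"]) auto
  qed
  have "smooth_on (S_set \<Lambda>) (\<lambda>q. snd (inv_into ?U F (q, 0)))"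
    by (rule smooth_on_snd[OF smooth_on_compose[OF smF smooth_on_Pair[OF smooth_on_id(1) smooth_on_const] im]])
  then show ?thesis
  proof (rule smooth_on_cong)
    fix q assume q: "q \<in> S_set \<Lambda>"
    have "inv_into ?U F (q, 0) = (q, time q)"
      by (rule inv_into_f_eq[OF injF]) (use q Ft in auto)
    then show "snd (inv_into ?U F (q, 0)) = time q" by simp
  qed
qed

section \<open>The retraction and its fibres\<close>

definition retr :: "quat ^ 'n \<Rightarrow> quat ^ 'n" where
  "retr q = \<Phi> \<Lambda> (time q) q /\<^sub>R norm (\<Phi> \<Lambda> (time q) q)"

lemma smooth_retr: "smooth_on (S_set \<Lambda>) retr"
  unfolding retr_def
  using S_set_nonzero[OF S_set_\<Phi>]
  by (intro smooth_on_scaleR smooth_on_inverse smooth_on_norm smooth_on_\<Phi> smooth_time smooth_on_id) auto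

lemma retr_in_Z: "q \<in> S_set \<Lambda> \<Longrightarrow> retr q \<in> Z_set \<Lambda>"
  using S_set_nonzero[OF S_set_\<Phi>, of q \<Lambda> "time q"]
  by (simp add: Z_set_iff retr_def moment_time moment_scaleR)

lemma retr_Z: "q \<in> Z_set \<Lambda> \<Longrightarrow> retr q = q"
proof -
  assume q: "q \<in> Z_set \<Lambda>"
  then have "q \<in> S_set \<Lambda>" using Z_subset_S by blast
  then have "time q = 0" using q by (intro time_eqI) (simp_all add: Z_set_iff)
  then show ?thesis using q by (simp add: retr_def Z_set_iff)
qed

lemma retr_image: "retr ` S_set \<Lambda> = Z_set \<Lambda>"
proof
  show "retr ` S_set \<Lambda> \<subseteq> Z_set \<Lambda>" using retr_in_Z by auto
  show "Z_set \<Lambda> \<subseteq> retr ` S_set \<Lambda>"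
  proof
    fix q assume "q \<in> Z_set \<Lambda>"
    then show "q \<in> retr ` S_set \<Lambda>" using retr_Z[of q] Z_subset_S by (intro image_eqI[of _ _ q]) auto
  qed
qed

text \<open>The shift of \<open>time\<close> cancels the flow and the normalisation cancels
  \<open>norm a\<close>; only the unit part of \<open>a\<close> survives. This is how \<bbbH>* on
  \<open>S_set \<Lambda>\<close> becomes Sp(1) on \<open>Z_set \<Lambda>\<close>.\<close>

lemma retr_orbit:
  assumes "q \<in> S_set \<Lambda>" "a \<noteq> 0"
  shows "retr (a *s \<Phi> \<Lambda> T q) = (a /\<^sub>R norm a) *s retr q"
  using assms by (simp add: retr_def time_orbit \<Phi>_scalar \<Phi>_\<Phi> norm_vector_scalar_mult vec_eq_iff mult_ac)

text \<open>Flowing back for \<open>time q\<close> and undoing the normalisation recovers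
  \<open>q\<close>. With \<open>r\<close> and \<open>T\<close> held fixed,
  \<open>z \<mapsto> r *\<^sub>R \<Phi> \<Lambda> T z\<close> becomes a global section of
  \<open>retr\<close> over \<open>Z_set \<Lambda>\<close> passing through \<open>q\<close>.\<close>

lemma retr_sectionE:
  assumes "q \<in> S_set \<Lambda>"
  obtains r T where "r > 0" "q = r *\<^sub>R \<Phi> \<Lambda> T (retr q)"
proof (rule that)
  have nz: "norm (\<Phi> \<Lambda> (time q) q) \<noteq> 0" using S_set_nonzero[OF S_set_\<Phi>[OF assms]] by simp
  then show "norm (\<Phi> \<Lambda> (time q) q) > 0" by simp
  have "\<Phi> \<Lambda> (- time q) (retr q) = q /\<^sub>R norm (\<Phi> \<Lambda> (time q) q)"
    by (simp add: retr_def scaleR_eq_of_real_mult \<Phi>_scalar \<Phi>_\<Phi>)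
  then show "q = norm (\<Phi> \<Lambda> (time q) q) *\<^sub>R \<Phi> \<Lambda> (- time q) (retr q)" using nz by simp
qed

lemma retr_pos_orbit:
  assumes "q \<in> S_set \<Lambda>" "r > 0"
  shows "retr (r *\<^sub>R \<Phi> \<Lambda> T q) = retr q"
proof -
  have "of_real r /\<^sub>R r = (1 :: quat)"
    using assms(2) by (simp add: scaleR_conv_of_real)
  then show ?thesis using assms by (simp add: scaleR_eq_of_real_mult retr_orbit)
qed

lemma retr_eq_iff:
  assumes "q \<in> S_set \<Lambda>" "q' \<in> S_set \<Lambda>"
  shows "retr q' = retr q \<longleftrightarrow> (\<exists>r T. r > 0 \<and> q' = r *\<^sub>R \<Phi> \<Lambda> T q)"
proof
  assume eq: "retr q' = retr q"
  obtain r T where q: "r > 0" "q = r *\<^sub>R \<Phi> \<Lambda> T (retr q)" by (rule retr_sectionE[OF assms(1)])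
  obtain r' T' where q': "r' > 0" "q' = r' *\<^sub>R \<Phi> \<Lambda> T' (retr q')" by (rule retr_sectionE[OF assms(2)])
  have "\<Phi> \<Lambda> (T' - T) q = r *\<^sub>R \<Phi> \<Lambda> T' (retr q)"
    by (subst q(2)) (simp add: scaleR_eq_of_real_mult \<Phi>_scalar \<Phi>_\<Phi>)
  then have "q' = (r' / r) *\<^sub>R \<Phi> \<Lambda> (T' - T) q" using q(1) q'(2) eq by simp
  then show "\<exists>r T. r > 0 \<and> q' = r *\<^sub>R \<Phi> \<Lambda> T q" using q q' by (metis divide_pos_pos)
next
  assume "\<exists>r T. r > 0 \<and> q' = r *\<^sub>R \<Phi> \<Lambda> T q"
  then show "retr q' = retr q" using retr_pos_orbit[OF assms(1)] by blast
qed

text \<open>A positive scalar together with an element of Sp(1) makes up a general nonzero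
  quaternion: the former accounts for the fibres of \<open>retr\<close>, the latter for the
  remaining quotient.\<close>

lemma Sp1_retr_eq_iff:
  assumes "q \<in> S_set \<Lambda>" "q' \<in> S_set \<Lambda>"
  shows "Sp1_rel `` {retr q'} = Sp1_rel `` {retr q} \<longleftrightarrow> orbit_rel \<Lambda> q q'"
proof
  assume "Sp1_rel `` {retr q'} = Sp1_rel `` {retr q}"
  moreover have "retr q' \<in> Sp1_rel `` {retr q'}" by (auto simp: Sp1_rel_def intro: exI[of _ 1])
  ultimately obtain a where a: "norm a = 1" "retr q' = a *s retr q" by (auto simp: Sp1_rel_def)
  obtain r T where q: "r > 0" "q = r *\<^sub>R \<Phi> \<Lambda> T (retr q)" by (rule retr_sectionE[OF assms(1)])
  obtain r' T' where q': "r' > 0" "q' = r' *\<^sub>R \<Phi> \<Lambda> T' (retr q')" by (rule retr_sectionE[OF assms(2)])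
  have "orbit_rel \<Lambda> (retr q) q"
    unfolding orbit_rel_def using q by (intro exI[of _ "of_real r"] exI[of _ T]) (simp flip: scaleR_eq_of_real_mult)
  moreover have "orbit_rel \<Lambda> (retr q) q'"
    unfolding orbit_rel_def
  proof (intro exI conjI)
    show "of_real r' * a \<noteq> 0" using a q' by auto
    show "q' = (of_real r' * a) *s \<Phi> \<Lambda> T' (retr q)"
      by (subst q'(2)) (simp add: a(2) scaleR_eq_of_real_mult \<Phi>_scalar vector_smult_assoc)
  qed
  ultimately show "orbit_rel \<Lambda> q q'" using orbit_rel_sym orbit_rel_trans by blast
next
  assume "orbit_rel \<Lambda> q q'"
  then obtain a T where a: "a \<noteq> 0" "q' = a *s \<Phi> \<Lambda> T q" by (auto simp: orbit_rel_def)
  define b where "b = a /\<^sub>R norm a"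
  have b: "norm b = 1" using a(1) by (simp add: b_def)
  have eq: "retr q' = b *s retr q" unfolding b_def a(2) by (rule retr_orbit[OF assms(1) a(1)])
  have "b \<noteq> 0" using b by auto
  have nrm: "norm (c * b) = 1" "norm (c * inverse b) = 1" if "norm c = 1" for c
    using that b by (simp_all add: norm_mult norm_inverse)
  have cls: "c *s retr q' = (c * b) *s retr q" "c *s retr q = (c * inverse b) *s retr q'" for c
    using \<open>b \<noteq> 0\<close> by (auto simp: eq vector_smult_assoc mult.assoc)
  have im: "Sp1_rel `` {p} = (\<lambda>c. c *s p) ` {c. norm c = 1}" for p :: "quat ^ 'n"
    by (auto simp: Sp1_rel_def)
  show "Sp1_rel `` {retr q'} = Sp1_rel `` {retr q}"
    unfolding im
  proof (intro equalityI image_subsetI)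
    fix c :: quat assume c: "c \<in> {c. norm c = 1}"
    show "c *s retr q' \<in> (\<lambda>c. c *s retr q) ` {c. norm c = 1}"
      by (rule image_eqI[of _ _ "c * b"]) (use c nrm cls in auto)
    show "c *s retr q \<in> (\<lambda>c. c *s retr q') ` {c. norm c = 1}"
      by (rule image_eqI[of _ _ "c * inverse b"]) (use c nrm cls in auto)
  qed
qed

end

section \<open>Slices for the group actions\<close>

text \<open>\<open>N\<close> moves the points of \<open>G\<close> along the fibres of \<open>p\<close> into the affine slice \<open>x + W\<close>.\<close>

definition normaliser ::
  "'a::euclidean_space set \<Rightarrow> ('a \<Rightarrow> 'p) \<Rightarrow> 'a \<Rightarrow> 'a set \<Rightarrow> ('a \<Rightarrow> 'a) \<Rightarrow> 'a set \<Rightarrow> bool" where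
  "normaliser S p x G N W \<longleftrightarrow> open G \<and> x \<in> G \<and> G \<subseteq> S \<and> subspace W \<and> smooth_on G N \<and> (\<forall>y\<in>G. N y \<in> G) \<and>
    (\<forall>y\<in>G. N y - x \<in> W) \<and> (\<forall>w\<in>W. x + w \<in> G \<longrightarrow> N (x + w) = x + w) \<and>
    (\<forall>y\<in>G. \<forall>y'\<in>S. p y' = p y \<longleftrightarrow> y' \<in> G \<and> N y' = N y) \<and>
    (\<forall>y\<in>G. \<exists>\<tau>. smooth_on G \<tau> \<and> \<tau> ` G \<subseteq> G \<and> (\<forall>z\<in>G. N (\<tau> z) = N z) \<and> \<tau> (N y) = y)"

text \<open>The slice coordinate is \<open>N y - x\<close>. Its image consists of the
  \<open>w\<close> in \<open>W\<close> with \<open>x + w\<close> in \<open>G\<close>, because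
  \<open>N\<close> fixes those points; this makes it relatively open. Each \<open>\<tau>\<close>
  moves along fibres, so \<open>w \<mapsto> \<tau> (x + w)\<close> is a section, chosen to pass
  through the given \<open>y\<close>.\<close>

lemma slicedI:
  assumes "\<And>x. x \<in> S \<Longrightarrow> \<exists>G N W. normaliser S p x G N W \<and> dim W = d"
  shows "sliced S p d"
  unfolding sliced_def
proof
  fix x assume "x \<in> S"
  from assms[OF this] obtain G N W where n: "normaliser S p x G N W" and d: "dim W = d" by blast
  from n have G: "open G" "x \<in> G" "G \<subseteq> S" and W: "subspace W" "dim W = d"
    and N: "smooth_on G N" "N ` G \<subseteq> G" "\<forall>y\<in>G. N y - x \<in> W" "\<forall>w\<in>W. x + w \<in> G \<longrightarrow> N (x + w) = x + w"
    and ker: "\<forall>y\<in>G. \<forall>y'\<in>S. p y' = p y \<longleftrightarrow> y' \<in> G \<and> N y' = N y"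
    and sec: "\<forall>y\<in>G. \<exists>\<tau>. smooth_on G \<tau> \<and> \<tau> ` G \<subseteq> G \<and> (\<forall>z\<in>G. N (\<tau> z) = N z) \<and> \<tau> (N y) = y"
    by (simp_all add: normaliser_def image_subset_iff d)
  define h where "h y = N y - x" for y
  have NN: "N (N y) = N y" if "y \<in> G" for y
  proof -
    have "N (x + (N y - x)) = x + (N y - x)" by (rule N(4)[rule_format]) (use N(2,3) that in auto)
    then show ?thesis by simp
  qed
  have hG: "h ` G = W \<inter> (\<lambda>w. x + w) -` G"
  proof
    show "h ` G \<subseteq> W \<inter> (\<lambda>w. x + w) -` G" using N(2,3) by (auto simp: h_def)
    show "W \<inter> (\<lambda>w. x + w) -` G \<subseteq> h ` G"
    proof
      fix w assume w: "w \<in> W \<inter> (\<lambda>w. x + w) -` G"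
      then have "h (x + w) = w" using N(4) by (simp add: h_def)
      then show "w \<in> h ` G" using w by (intro image_eqI[of _ _ "x + w"]) auto
    qed
  qed
  have op: "openin (top_of_set W) (h ` G)"
    unfolding hG by (intro continuous_openin_preimage_gen continuous_intros G(1))
  have sec': "\<exists>\<sigma>. smooth_on (h ` G) \<sigma> \<and> \<sigma> ` h ` G \<subseteq> G \<and> (\<forall>w\<in>h ` G. h (\<sigma> w) = w) \<and> \<sigma> (h y) = y" if y: "y \<in> G" for y
  proof -
    obtain \<tau> where \<tau>: "smooth_on G \<tau>" "\<tau> ` G \<subseteq> G" "\<forall>z\<in>G. N (\<tau> z) = N z" "\<tau> (N y) = y" using sec y by blast
    have xh: "x + h z = N z" for z by (simp add: h_def)
    show ?thesis
    proof (rule exI[of _ "\<lambda>w. \<tau> (x + w)"], intro conjI ballI)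
      show "smooth_on (h ` G) (\<lambda>w. \<tau> (x + w))"
        by (rule smooth_on_compose[OF \<tau>(1) smooth_on_add[OF smooth_on_const smooth_on_id(1)]])
          (use hG in auto)
      show "(\<lambda>w. \<tau> (x + w)) ` h ` G \<subseteq> G" using \<tau>(2) N(2) by (auto simp: xh image_subset_iff)
      show "h (\<tau> (x + w)) = w" if w: "w \<in> h ` G" for w
      proof -
        obtain z where z: "z \<in> G" "w = h z" using w by blast
        then have "N (\<tau> (N z)) = N z" using \<tau>(3) N(2) NN by auto
        then show ?thesis using z(2) by (simp add: xh) (simp add: h_def)
      qed
    qed (simp add: xh \<tau>(4))
  qed
  have smh: "smooth_on G h" unfolding h_def by (rule smooth_on_diff[OF N(1) smooth_on_const])
  have ker': "\<forall>y\<in>G. \<forall>y'\<in>S. p y' = p y \<longleftrightarrow> y' \<in> G \<and> h y' = h y" using ker by (simp add: h_def)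
  have "slice S p d G h W"
    unfolding slice_def using G(1,3) W smh op ker' sec' by (intro conjI ballI) blast+
  then show "\<exists>G h W. x \<in> G \<and> slice S p d G h W" using G(2) by blast
qed

lemma dim_orthogonal_complement:
  fixes B :: "'a::euclidean_space set"
  assumes "pairwise orthogonal B" "0 \<notin> B"
  shows "subspace {w. \<forall>b\<in>B. b \<bullet> w = 0}" "dim {w. \<forall>b\<in>B. b \<bullet> w = 0} = DIM('a) - card B"
proof -
  have eq: "{w. \<forall>b\<in>B. b \<bullet> w = 0} = {y \<in> UNIV. \<forall>x\<in>span B. orthogonal x y}"
  proof (intro set_eqI iffI; clarsimp)
    fix w x assume "\<forall>b\<in>B. b \<bullet> w = 0" "x \<in> span B"
    then show "orthogonal x w"
      by (metis orthogonal_commute orthogonal_def orthogonal_to_span)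
  qed (auto simp: orthogonal_def intro: span_base)
  show "subspace {w. \<forall>b\<in>B. b \<bullet> w = 0}"
    by (auto simp: subspace_def inner_add_right)
  have "dim (span B) = card B"
    using pairwise_orthogonal_independent[OF assms] by (simp add: dim_eq_card_independent)
  then show "dim {w. \<forall>b\<in>B. b \<bullet> w = 0} = DIM('a) - card B"
    unfolding eq using dim_subspace_orthogonal_to_vectors[of "span B" UNIV] by simp
qed

lemma orthogonal_axis: "orthogonal (axis i a) (axis j b) \<longleftrightarrow> i \<noteq> j \<or> orthogonal a b"
  by (auto simp: orthogonal_def inner_axis_axis)

section \<open>Slices for quaternionic projective space\<close>

lemma equiv_Hstar_rel: "equiv UNIV (Hstar_rel :: ((quat ^ 'n::finite) \<times> (quat ^ 'n)) set)"
proof (rule equivI)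
  let ?R = "Hstar_rel :: ((quat ^ 'n) \<times> (quat ^ 'n)) set"
  show "refl ?R" by (auto simp: Hstar_rel_def refl_on_def intro!: exI[of _ 1])
  show "sym ?R"
  proof (rule symI)
    fix p q :: "quat ^ 'n" assume "(p, q) \<in> Hstar_rel"
    then obtain a where "a \<noteq> 0" "q = a *s p" by (auto simp: Hstar_rel_def)
    then show "(q, p) \<in> Hstar_rel"
      by (auto simp: Hstar_rel_def vector_smult_assoc intro!: exI[of _ "inverse a"])
  qed
  show "trans ?R"
  proof (rule transI)
    fix p q r :: "quat ^ 'n" assume "(p, q) \<in> Hstar_rel" "(q, r) \<in> Hstar_rel"
    then obtain a b where "a \<noteq> 0" "b \<noteq> 0" "r = (b * a) *s p" by (auto simp: Hstar_rel_def vector_smult_assoc)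
    then show "(p, r) \<in> Hstar_rel" by (auto simp: Hstar_rel_def intro!: exI[of _ "b * a"])
  qed
qed auto

lemma Hstar_class_eq_iff: "Hstar_rel `` {p} = Hstar_rel `` {q} \<longleftrightarrow> (\<exists>a. a \<noteq> 0 \<and> q = a *s p)"
  using eq_equiv_class_iff[OF equiv_Hstar_rel, of p q] by (simp add: Hstar_rel_def)

text \<open>This is the affine chart: the coordinate \<open>i\<close>, nonzero at \<open>x\<close>,
  is normalised to the value \<open>x $ i\<close>, and \<open>W\<close> consists of the vectors
  whose coordinate \<open>i\<close> is 0.\<close>

lemma sliced_projective:
  "sliced (UNIV - {0} :: (quat ^ 'n::finite) set) (\<lambda>q. Hstar_rel `` {q}) (DIM(quat ^ 'n) - DIM(quat))"
proof (rule slicedI)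
  fix x :: "quat ^ 'n" assume "x \<in> UNIV - {0}"
  then obtain i where i: "x $ i \<noteq> 0" by (auto simp: vec_eq_iff)
  define G where "G = {q :: quat ^ 'n. q $ i \<noteq> 0}"
  \<comment> \<open>Scalars act on the left, so the factor must have \<open>inverse (q $ i)\<close>
    on its right in order to cancel.\<close>
  define N where "N q = (x $ i * inverse (q $ i)) *s q" for q :: "quat ^ 'n"
  define B where "B = axis i ` (Basis :: quat set)"
  define W where "W = {w :: quat ^ 'n. \<forall>b\<in>B. b \<bullet> w = 0}"
  have B: "pairwise orthogonal B" "0 \<notin> B"
    by (auto simp: B_def pairwise_def orthogonal_axis axis_eq_axis orthogonal_def inner_Basis axis_eq_0_iff)
  have "card B = DIM(quat)" unfolding B_def by (rule card_image) (auto simp: inj_on_def axis_eq_axis)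
  then have W: "subspace W" "dim W = DIM(quat ^ 'n) - DIM(quat)"
    using dim_orthogonal_complement[OF B] by (simp_all only: W_def)
  have W_iff: "w \<in> W \<longleftrightarrow> w $ i = 0" for w
    using euclidean_all_zero_iff[of "w $ i"] by (simp add: W_def B_def inner_axis' inner_commute[of _ "w $ i"])
  have Ni: "N q $ i = x $ i" if "q \<in> G" for q using that by (simp add: N_def G_def mult.assoc)
  have Nx: "N q = q" if "q $ i = x $ i" for q using that i by (simp add: N_def)
  have N_scalar: "a *s q \<in> G" "N (a *s q) = N q" if "q \<in> G" "a \<noteq> 0" for a q
    using that by (simp_all add: N_def G_def vector_smult_assoc nonzero_inverse_mult_distrib mult.assoc)
  have NG: "N q \<in> G" if "q \<in> G" for q using Ni[OF that] i by (simp add: G_def)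
  have Nq: "x $ i * inverse (q $ i) \<noteq> 0" if "q \<in> G" for q using that i by (simp add: G_def)
  have "open G" unfolding G_def by (rule open_Collect_neq) (intro continuous_intros)+
  moreover have "x \<in> G" "G \<subseteq> UNIV - {0}" using i by (auto simp: G_def)
  moreover have "smooth_on G N" unfolding N_def
    by (intro smooth_on_scalar_mult smooth_on_mult smooth_on_const smooth_on_quat_inverse smooth_on_vec_nth smooth_on_id)
      (auto simp: G_def)
  moreover have "\<forall>y\<in>G. N y - x \<in> W" using Ni by (simp add: W_iff)
  moreover have "\<forall>w\<in>W. x + w \<in> G \<longrightarrow> N (x + w) = x + w" using Nx by (simp add: W_iff)
  moreover have "\<forall>y\<in>G. \<forall>y'\<in>UNIV - {0}. Hstar_rel `` {y'} = Hstar_rel `` {y} \<longleftrightarrow> y' \<in> G \<and> N y' = N y"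
  proof (intro ballI iffI)
    fix y y' assume y: "y \<in> G"
    {
      assume "Hstar_rel `` {y'} = Hstar_rel `` {y}"
      then obtain a where "a \<noteq> 0" "y' = a *s y" using Hstar_class_eq_iff[of y y'] by auto
      then show "y' \<in> G \<and> N y' = N y" using N_scalar[OF y] by simp
    next
      assume y': "y' \<in> G \<and> N y' = N y"
      have "Hstar_rel `` {z} = Hstar_rel `` {N z}" if "z \<in> G" for z
        unfolding Hstar_class_eq_iff N_def using Nq[OF that] by blast
      then show "Hstar_rel `` {y'} = Hstar_rel `` {y}" using y y' by metis
    }
  qed
  moreover have "\<forall>y\<in>G. \<exists>\<tau>. smooth_on G \<tau> \<and> \<tau> ` G \<subseteq> G \<and> (\<forall>z\<in>G. N (\<tau> z) = N z) \<and> \<tau> (N y) = y"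
  proof
    fix y assume y: "y \<in> G"
    \<comment> \<open>The constant scalar that carries \<open>N y\<close> back to \<open>y\<close>;
      multiplication by it preserves all lines.\<close>
    define a where "a = inverse (x $ i * inverse (y $ i))"
    have a: "a \<noteq> 0" using Nq[OF y] by (simp add: a_def)
    show "\<exists>\<tau>. smooth_on G \<tau> \<and> \<tau> ` G \<subseteq> G \<and> (\<forall>z\<in>G. N (\<tau> z) = N z) \<and> \<tau> (N y) = y"
    proof (rule exI[of _ "\<lambda>z. a *s z"], intro conjI ballI)
      show "smooth_on G ((*s) a)" by (intro smooth_on_scalar_mult smooth_on_const smooth_on_id)
      show "a *s N y = y" unfolding N_def vector_smult_assoc a_def using Nq[OF y] by simp
    qed (use N_scalar a in auto)
  qed
  ultimately have "normaliser (UNIV - {0}) (\<lambda>q. Hstar_rel `` {q}) x G N W"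
    unfolding normaliser_def using W NG by (intro conjI) blast+
  then show "\<exists>G N W. normaliser (UNIV - {0}) (\<lambda>q. Hstar_rel `` {q}) x G N W \<and>
      dim W = DIM(quat ^ 'n) - DIM(quat)" using W(2) by blast
qed

section \<open>Normal forms and slices for scaling, flow and scalars\<close>

context configuration
begin

text \<open>The vectors \<open>(\<Lambda> i, 1)\<close> with \<open>i\<close> in the support span a
  space of dimension \<open>d + 1\<close>. \<open>J\<close> indexes a basis among them, and the
  pairs \<open>(t j, c j)\<close> form the dual basis. The last conclusion says that no nonzero
  affine functional vanishes on the chosen weights.\<close>

lemma support_basisE:
  assumes x: "x \<in> S_set \<Lambda>"
  obtains J t c where "J \<subseteq> {i. x $ i \<noteq> 0}" "card J = Suc CARD('d)"
    "\<And>i j. i \<in> J \<Longrightarrow> j \<in> J \<Longrightarrow> \<Lambda> i \<bullet> t j + c j = (if i = j then 1 else 0 :: real)"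
    "\<And>T s. (\<And>j. j \<in> J \<Longrightarrow> \<Lambda> j \<bullet> T + s = 0) \<Longrightarrow> T = 0 \<and> s = 0"
proof -
  define l where "l i = (\<Lambda> i, 1 :: real)" for i
  let ?A = "l ` {i. x $ i \<noteq> 0}"
  have A: "span ?A = UNIV"
  proof -
    obtain P where P: "\<And>y. P y \<in> span ?A" "\<And>y w. w \<in> span ?A \<Longrightarrow> (y - P y) \<bullet> w = 0"
      by (rule orthogonal_projection[OF subspace_span[of ?A]]) blast
    have "y \<in> span ?A" for y
    proof -
      \<comment> \<open>A vector orthogonal to all \<open>l i\<close> is an affine functional
        vanishing on the supporting weights, hence 0.\<close>
      have "\<Lambda> i \<bullet> fst (y - P y) + snd (y - P y) = 0" if "x $ i \<noteq> 0" for i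
      proof -
        have "(y - P y) \<bullet> l i = 0" by (rule P(2)) (use that in \<open>auto intro: span_base\<close>)
        then show ?thesis by (simp add: l_def inner_prod_def inner_commute)
      qed
      then have "fst (y - P y) = 0 \<and> snd (y - P y) = 0" using orthogonal_support[OF x] by blast
      then have "y - P y = 0" by (simp add: prod_eq_iff)
      then show ?thesis using P(1)[of y] by simp
    qed
    then show ?thesis by blast
  qed
  obtain B where B: "B \<subseteq> ?A" "independent B" "?A \<subseteq> span B" "card B = dim ?A"
    using maximal_independent_subset[of ?A] by (metis basis_exists)
  have spanB: "span B = UNIV" using A B(3) span_minimal[OF B(3) subspace_span] by auto
  have cardB: "card B = Suc CARD('d)"
    using B(4) dim_span[of ?A] A by simp
  from iffD1[OF subset_image_inj B(1)]
  obtain J where J: "J \<subseteq> {i. x $ i \<noteq> 0}" "inj_on l J" "B = l ` J"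
    by (elim exE conjE)
  have "\<exists>z. \<forall>i\<in>J. l i \<bullet> z = (if i = j then 1 else 0)" if j: "j \<in> J" for j
  proof -
    obtain g where g: "linear g" "\<forall>b\<in>B. g b = (if b = l j then 1 else 0 :: real)"
      using linear_independent_extend[OF B(2), of "\<lambda>b. if b = l j then 1 else 0"] by blast
    \<comment> \<open>The vector that represents the dual functional \<open>g\<close> by the inner
      product.\<close>
    define z where "z = (\<Sum>b\<in>Basis. g b *\<^sub>R b)"
    have gz: "g v = v \<bullet> z" for v
    proof -
      have "g v = (\<Sum>b\<in>Basis. (v \<bullet> b) *\<^sub>R g b)" by (rule linear_eq_sum_Basis[OF g(1)])
      also have "\<dots> = v \<bullet> z" unfolding z_def inner_sum_right by (rule sum.cong) simp_all
      finally show ?thesis .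
    qed
    have "l i \<bullet> z = (if i = j then 1 else 0)" if "i \<in> J" for i
      using g(2)[rule_format, of "l i"] J(3) that inj_on_eq_iff[OF J(2) that j] by (simp add: gz)
    then show ?thesis by blast
  qed
  then obtain z where z: "\<And>i j. i \<in> J \<Longrightarrow> j \<in> J \<Longrightarrow> l i \<bullet> z j = (if i = j then 1 else 0)" by metis
  show thesis
  proof (rule that[OF J(1)])
    show "card J = Suc CARD('d)" using cardB J by (simp add: card_image)
    show "\<Lambda> i \<bullet> fst (z j) + snd (z j) = (if i = j then 1 else 0)" if "i \<in> J" "j \<in> J" for i j
      using z[OF that] by (simp add: l_def inner_prod_def)
    show "T = 0 \<and> s = 0" if "\<And>j. j \<in> J \<Longrightarrow> \<Lambda> j \<bullet> T + s = 0" for T s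
    proof -
      have "B \<subseteq> {v. (T, s) \<bullet> v = 0}"
        unfolding J(3) using that by (auto simp: l_def inner_prod_def inner_commute)
      then have "span B \<subseteq> {v. (T, s) \<bullet> v = 0}" by (intro span_minimal subspace_hyperplane)
      then have "(T, s) \<bullet> (T, s) = 0" using spanB by blast
      then have "(T, s) = 0" by (simp only: inner_eq_zero_iff)
      then show ?thesis by (simp add: zero_prod_def)
    qed
  qed
qed

text \<open>With \<open>d + 1\<close> affinely independent weights in the support of \<open>x\<close>, positive scaling and the
  \<open>\<real>\<^sup>d\<close>-action can normalise the real numbers \<open>q $ j \<bullet> x $ j\<close> for those weights.\<close>

lemma normal_formE:
  assumes x: "x \<in> S_set \<Lambda>"
  obtains J N where "J \<subseteq> {i. x $ i \<noteq> 0}" "card J = Suc CARD('d)"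
    "smooth_on {q. \<forall>j\<in>J. 0 < q $ j \<bullet> x $ j} N"
    "\<And>q. \<exists>r T. r > 0 \<and> N q = r *\<^sub>R \<Phi> \<Lambda> T q"
    "\<And>q j. (\<forall>j\<in>J. 0 < q $ j \<bullet> x $ j) \<Longrightarrow> j \<in> J \<Longrightarrow> N q $ j \<bullet> x $ j = x $ j \<bullet> x $ j"
    "\<And>q r T. r > 0 \<Longrightarrow> (\<forall>j\<in>J. 0 < q $ j \<bullet> x $ j) \<Longrightarrow> N (r *\<^sub>R \<Phi> \<Lambda> T q) = N q"
    "\<And>q. (\<forall>j\<in>J. q $ j \<bullet> x $ j = x $ j \<bullet> x $ j) \<Longrightarrow> N q = q"
proof -
  obtain J t c where J: "J \<subseteq> {i. x $ i \<noteq> 0}" "card J = Suc CARD('d)"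
    and tc: "\<And>i j. i \<in> J \<Longrightarrow> j \<in> J \<Longrightarrow> \<Lambda> i \<bullet> t j + c j = (if i = j then 1 else 0 :: real)"
    and ind: "\<And>T s. (\<And>j. j \<in> J \<Longrightarrow> \<Lambda> j \<bullet> T + s = 0) \<Longrightarrow> T = 0 \<and> s = 0"
    by (rule support_basisE[OF x]) blast
  \<comment> \<open>The real number \<open>q $ j \<bullet> x $ j\<close> is used rather than the
    norm of \<open>q $ j\<close> because it is linear in \<open>q\<close>: the normalised points
    then form part of an affine subspace through \<open>x\<close>.\<close>
  define L where "L j q = ln (q $ j \<bullet> x $ j / (x $ j \<bullet> x $ j))" for j and q :: "quat ^ 'n"
  \<comment> \<open>By duality of \<open>(t, c)\<close> the total exponent acting on coordinate
    \<open>j\<close> in \<open>J\<close> is \<open>- L j q\<close>, precisely what sends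
    \<open>q $ j \<bullet> x $ j\<close> to \<open>x $ j \<bullet> x $ j\<close>.\<close>
  define N where "N q = exp (- (\<Sum>j\<in>J. L j q * c j)) *\<^sub>R \<Phi> \<Lambda> (- (\<Sum>j\<in>J. L j q *\<^sub>R t j)) q" for q
  let ?pos = "\<lambda>q :: quat ^ 'n. \<forall>j\<in>J. 0 < q $ j \<bullet> x $ j"
  have xj: "0 < x $ j \<bullet> x $ j" if "j \<in> J" for j using that J by auto
  have Nj: "N q $ j \<bullet> x $ j = x $ j \<bullet> x $ j" if q: "?pos q" and j: "j \<in> J" for q j
  proof -
    have "(\<Sum>k\<in>J. L k q * c k) + (\<Sum>k\<in>J. L k q * (\<Lambda> j \<bullet> t k)) = (\<Sum>k\<in>J. L k q * (\<Lambda> j \<bullet> t k + c k))"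
      by (simp add: sum.distrib algebra_simps)
    also have "\<dots> = (\<Sum>k\<in>J. if j = k then L k q else 0)"
      by (rule sum.cong) (simp_all add: tc[OF j])
    also have "\<dots> = L j q" using j by simp
    finally have "exp (- (\<Sum>k\<in>J. L k q * c k)) * exp (- (\<Sum>k\<in>J. L k q * (\<Lambda> j \<bullet> t k))) = exp (- L j q)"
      by (simp flip: exp_add add: algebra_simps)
    then have "N q $ j \<bullet> x $ j = exp (- L j q) * (q $ j \<bullet> x $ j)"
      by (simp add: N_def inner_sum_right flip: mult.assoc)
    moreover have "exp (- L j q) = (x $ j \<bullet> x $ j) / (q $ j \<bullet> x $ j)"
      using q xj[OF j] j by (simp add: L_def exp_minus)
    moreover have "q $ j \<bullet> x $ j \<noteq> 0" using q j by fastforce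
    ultimately show ?thesis by simp
  qed
  \<comment> \<open>If scaling by \<open>r\<close> and flowing for \<open>T\<close> keep all the
    numbers indexed by \<open>J\<close>, the affine functional with linear part \<open>T\<close> and
    constant \<open>ln r\<close> vanishes on \<open>d + 1\<close> affinely independent weights. So
    an orbit meets the normalised set at most once.\<close>
  have unique: "q' = q" if r: "r > 0" and q': "q' = r *\<^sub>R \<Phi> \<Lambda> T q" and q: "?pos q"
    and eq: "\<And>j. j \<in> J \<Longrightarrow> q' $ j \<bullet> x $ j = q $ j \<bullet> x $ j" for q q' r T
  proof -
    have "\<Lambda> j \<bullet> T + ln r = 0" if j: "j \<in> J" for j
    proof -
      have "(r * exp (\<Lambda> j \<bullet> T)) * (q $ j \<bullet> x $ j) = q $ j \<bullet> x $ j" using eq[OF j] by (simp add: q')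
      moreover have "q $ j \<bullet> x $ j \<noteq> 0" using q j by fastforce
      ultimately have "r * exp (\<Lambda> j \<bullet> T) = 1" by simp
      then have "ln (r * exp (\<Lambda> j \<bullet> T)) = 0" by simp
      then show ?thesis using r by (simp add: ln_mult)
    qed
    then have "T = 0 \<and> ln r = 0" by (rule ind)
    then have "T = 0" "r = 1" using r by auto
    then show ?thesis by (simp add: q')
  qed
  have N: "\<exists>r T. r > 0 \<and> N q = r *\<^sub>R \<Phi> \<Lambda> T q" for q
    unfolding N_def by (intro exI conjI) (rule exp_gt_zero, rule refl)
  show thesis
  proof (rule that[OF J])
    show "smooth_on {q. ?pos q} N" unfolding N_def L_def
      by (intro smooth_on_scaleR smooth_on_exp smooth_on_minus smooth_on_sum smooth_on_mult smooth_on_const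
        smooth_on_\<Phi> smooth_on_id smooth_on_ln smooth_on_inner smooth_on_vec_nth
        smooth_on_bounded_linear[OF bounded_linear_divide, THEN smooth_on_compose[of UNIV]])
        (use xj in \<open>auto intro: divide_pos_pos\<close>)
    show "\<exists>r T. r > 0 \<and> N q = r *\<^sub>R \<Phi> \<Lambda> T q" for q by (rule N)
    show "N q $ j \<bullet> x $ j = x $ j \<bullet> x $ j" if "?pos q" "j \<in> J" for q j using that by (rule Nj)
    show "N (r *\<^sub>R \<Phi> \<Lambda> T q) = N q" if r: "r > 0" and q: "?pos q" for q r T
    proof -
      let ?q = "r *\<^sub>R \<Phi> \<Lambda> T q"
      have q': "?pos ?q" using r q by simp
      obtain r1 T1 where 1: "r1 > 0" "N q = r1 *\<^sub>R \<Phi> \<Lambda> T1 q" using N by blast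
      obtain r2 T2 where 2: "r2 > 0" "N ?q = r2 *\<^sub>R \<Phi> \<Lambda> T2 ?q" using N by blast
      show ?thesis
      proof (rule unique)
        show "r2 * r / r1 > 0" using r 1 2 by simp
        show "N ?q = (r2 * r / r1) *\<^sub>R \<Phi> \<Lambda> (T2 + T - T1) (N q)"
          unfolding 2(2) 1(2) using 1(1)
          by (simp add: vec_eq_iff exp_add exp_diff inner_add_right inner_diff_right)
        show "?pos (N q)" using Nj[OF q] xj by simp
        show "N ?q $ j \<bullet> x $ j = N q $ j \<bullet> x $ j" if "j \<in> J" for j
          using Nj[OF q that] Nj[OF q' that] by simp
      qed
    qed
    show "N q = q" if q: "\<forall>j\<in>J. q $ j \<bullet> x $ j = x $ j \<bullet> x $ j" for q
    proof -
      have pos: "?pos q" using q xj by simp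
      obtain r T where "r > 0" "N q = r *\<^sub>R \<Phi> \<Lambda> T q" using N by blast
      then show ?thesis by (rule unique) (use pos q Nj[OF pos] in auto)
    qed
  qed
qed

text \<open>The fibres of \<open>retr\<close> are the orbits of positive scaling and the flow, and
  the normal form picks one point on each. It imposes one real condition for each of the
  \<open>d + 1\<close> indices in \<open>J\<close>.\<close>

lemma sliced_retr: "sliced (S_set \<Lambda>) retr (DIM(quat ^ 'n) - Suc CARD('d))"
proof (rule slicedI)
  fix x assume x: "x \<in> S_set \<Lambda>"
  obtain J N where J: "J \<subseteq> {i. x $ i \<noteq> 0}" "card J = Suc CARD('d)"
    and N: "smooth_on {q. \<forall>j\<in>J. 0 < q $ j \<bullet> x $ j} N"
      "\<And>q. \<exists>r T. r > 0 \<and> N q = r *\<^sub>R \<Phi> \<Lambda> T q"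
      "\<And>q j. (\<forall>j\<in>J. 0 < q $ j \<bullet> x $ j) \<Longrightarrow> j \<in> J \<Longrightarrow> N q $ j \<bullet> x $ j = x $ j \<bullet> x $ j"
      "\<And>q r T. r > 0 \<Longrightarrow> (\<forall>j\<in>J. 0 < q $ j \<bullet> x $ j) \<Longrightarrow> N (r *\<^sub>R \<Phi> \<Lambda> T q) = N q"
      "\<And>q. (\<forall>j\<in>J. q $ j \<bullet> x $ j = x $ j \<bullet> x $ j) \<Longrightarrow> N q = q"
    by (rule normal_formE[OF x]) blast
  define G where "G = S_set \<Lambda> \<inter> {q. \<forall>j\<in>J. 0 < q $ j \<bullet> x $ j}"
  define B where "B = (\<lambda>j. axis j (x $ j)) ` J"
  define W where "W = {w :: quat ^ 'n. \<forall>b\<in>B. b \<bullet> w = 0}"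
  have xj: "0 < x $ j \<bullet> x $ j" if "j \<in> J" for j using that J by auto
  have B: "pairwise orthogonal B" "0 \<notin> B"
    using xj by (auto simp: B_def pairwise_def orthogonal_axis axis_eq_0_iff)
  have "card B = Suc CARD('d)"
    unfolding B_def J(2)[symmetric]
  proof (rule card_image)
    show "inj_on (\<lambda>j. axis j (x $ j)) J" using xj by (fastforce simp: inj_on_def axis_eq_axis)
  qed
  then have W: "subspace W" "dim W = DIM(quat ^ 'n) - Suc CARD('d)"
    using dim_orthogonal_complement[OF B] by (simp_all only: W_def)
  have W_iff: "w \<in> W \<longleftrightarrow> (\<forall>j\<in>J. w $ j \<bullet> x $ j = 0)" for w
    by (simp add: W_def B_def inner_axis' inner_commute[of _ "w $ _"])
  have orbit: "r *\<^sub>R \<Phi> \<Lambda> T q \<in> G \<and> N (r *\<^sub>R \<Phi> \<Lambda> T q) = N q" if q: "q \<in> G" and r: "r > 0" for q r T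
  proof -
    have "r *\<^sub>R \<Phi> \<Lambda> T q \<in> S_set \<Lambda>"
      using q r unfolding scaleR_eq_of_real_mult by (intro S_set_orbit) (auto simp: G_def)
    then show ?thesis using q r N(4)[of r q T] by (simp add: G_def)
  qed
  have NG: "N q \<in> G" if "q \<in> G" for q using orbit[OF that] N(2)[of q] by auto
  have "open {q :: quat ^ 'n. \<forall>j\<in>J. 0 < q $ j \<bullet> x $ j}"
  proof -
    have "open {q :: quat ^ 'n. 0 < q $ j \<bullet> x $ j}" for j
      by (rule open_Collect_less) (intro continuous_intros)+
    moreover have "{q :: quat ^ 'n. \<forall>j\<in>J. 0 < q $ j \<bullet> x $ j} = (\<Inter>j\<in>J. {q. 0 < q $ j \<bullet> x $ j})" by auto
    ultimately show ?thesis by (simp add: open_INT)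
  qed
  then have "open G" unfolding G_def by (intro open_Int open_S_set)
  moreover have "x \<in> G" using x xj by (simp add: G_def)
  moreover have "G \<subseteq> S_set \<Lambda>" by (simp add: G_def)
  moreover have "smooth_on G N" using N(1) by (rule smooth_on_subset) (simp add: G_def)
  moreover have "\<forall>y\<in>G. N y - x \<in> W" using N(3) by (simp add: W_iff G_def inner_diff_left)
  moreover have "\<forall>w\<in>W. x + w \<in> G \<longrightarrow> N (x + w) = x + w" using N(5) by (simp add: W_iff inner_add_left)
  moreover have "\<forall>y\<in>G. \<forall>y'\<in>S_set \<Lambda>. retr y' = retr y \<longleftrightarrow> y' \<in> G \<and> N y' = N y"
  proof (intro ballI iffI)
    fix y y' assume y: "y \<in> G" and y'S: "y' \<in> S_set \<Lambda>"
    have yS: "y \<in> S_set \<Lambda>" using y by (simp add: G_def)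
    {
      assume "retr y' = retr y"
      then obtain r T where "r > 0" "y' = r *\<^sub>R \<Phi> \<Lambda> T y" using retr_eq_iff[OF yS y'S] by blast
      then show "y' \<in> G \<and> N y' = N y" using orbit[OF y] by simp
    next
      assume y': "y' \<in> G \<and> N y' = N y"
      have "retr (N z) = retr z" if "z \<in> S_set \<Lambda>" for z
        using N(2)[of z] retr_pos_orbit[OF that] by auto
      then show "retr y' = retr y" using yS y'S y' by metis
    }
  qed
  moreover have "\<forall>y\<in>G. \<exists>\<tau>. smooth_on G \<tau> \<and> \<tau> ` G \<subseteq> G \<and> (\<forall>z\<in>G. N (\<tau> z) = N z) \<and> \<tau> (N y) = y"
  proof
    fix y assume y: "y \<in> G"
    obtain r T where r: "r > 0" "N y = r *\<^sub>R \<Phi> \<Lambda> T y" using N(2) by blast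
    show "\<exists>\<tau>. smooth_on G \<tau> \<and> \<tau> ` G \<subseteq> G \<and> (\<forall>z\<in>G. N (\<tau> z) = N z) \<and> \<tau> (N y) = y"
    proof (rule exI[of _ "\<lambda>z. (1 / r) *\<^sub>R \<Phi> \<Lambda> (- T) z"], intro conjI ballI)
      show "smooth_on G (\<lambda>z. (1 / r) *\<^sub>R \<Phi> \<Lambda> (- T) z)"
        by (intro smooth_on_scaleR smooth_on_\<Phi> smooth_on_const smooth_on_id)
      show "(1 / r) *\<^sub>R \<Phi> \<Lambda> (- T) (N y) = y"
        using r(1) unfolding r(2) by (simp add: vec_eq_iff exp_minus)
    qed (use orbit r in auto)
  qed
  ultimately have "normaliser (S_set \<Lambda>) retr x G N W"
    unfolding normaliser_def using W NG by (intro conjI) blast+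
  then show "\<exists>G N W. normaliser (S_set \<Lambda>) retr x G N W \<and> dim W = DIM(quat ^ 'n) - Suc CARD('d)"
    using W(2) by blast
qed

text \<open>Normalisation in two stages: \<open>A\<close> uses a quaternionic scalar to make
  coordinate \<open>k\<close> equal to \<open>x $ k\<close>, then the normal form uses positive
  scaling and the flow. Coordinate \<open>k\<close> contributes four real conditions and each of the
  other \<open>d\<close> indices of \<open>J\<close> one. The map \<open>p\<close> is left open so
  that the same slices serve both \<open>N\<close> and the orbit space of \<open>V\<close>.\<close>

lemma sliced_orbit:
  assumes p: "\<And>q q'. q \<in> S_set \<Lambda> \<Longrightarrow> q' \<in> S_set \<Lambda> \<Longrightarrow> p q' = p q \<longleftrightarrow> orbit_rel \<Lambda> q q'"
  shows "sliced (S_set \<Lambda>) p (DIM(quat ^ 'n) - (DIM(quat) + CARD('d)))"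
proof (rule slicedI)
  fix x assume x: "x \<in> S_set \<Lambda>"
  obtain J N where J: "J \<subseteq> {i. x $ i \<noteq> 0}" "card J = Suc CARD('d)"
    and N: "smooth_on {q. \<forall>j\<in>J. 0 < q $ j \<bullet> x $ j} N"
      "\<And>q. \<exists>r T. r > 0 \<and> N q = r *\<^sub>R \<Phi> \<Lambda> T q"
      "\<And>q j. (\<forall>j\<in>J. 0 < q $ j \<bullet> x $ j) \<Longrightarrow> j \<in> J \<Longrightarrow> N q $ j \<bullet> x $ j = x $ j \<bullet> x $ j"
      "\<And>q r T. r > 0 \<Longrightarrow> (\<forall>j\<in>J. 0 < q $ j \<bullet> x $ j) \<Longrightarrow> N (r *\<^sub>R \<Phi> \<Lambda> T q) = N q"
      "\<And>q. (\<forall>j\<in>J. q $ j \<bullet> x $ j = x $ j \<bullet> x $ j) \<Longrightarrow> N q = q"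
    by (rule normal_formE[OF x]) blast
  have finJ: "finite J" by simp
  obtain k where k: "k \<in> J" using J(2) by (metis card.empty ex_in_conv nat.distinct(1))
  have xk: "x $ k \<noteq> 0" using J k by auto
  have xj: "0 < x $ j \<bullet> x $ j" if "j \<in> J" for j using that J by auto
  define A where "A q = (x $ k * inverse (q $ k)) *s q" for q :: "quat ^ 'n"
  \<comment> \<open>Positivity is tested after \<open>A\<close>, because a general left scalar does
    not preserve the signs of \<open>q $ j \<bullet> x $ j\<close>.\<close>
  define G where "G = S_set \<Lambda> \<inter> {q. q $ k \<noteq> 0 \<and> (\<forall>j\<in>J. 0 < A q $ j \<bullet> x $ j)}"
  define M where "M q = N (A q)" for q
  define B where "B = axis k ` (Basis :: quat set) \<union> (\<lambda>j. axis j (x $ j)) ` (J - {k})"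
  define W where "W = {w :: quat ^ 'n. \<forall>b\<in>B. b \<bullet> w = 0}"
  have "orthogonal b b'" if "b \<in> Basis" "b' \<in> Basis" "b \<noteq> b'" for b b' :: quat
    using that by (simp add: orthogonal_def inner_not_same_Basis)
  then have B: "pairwise orthogonal B" "0 \<notin> B"
    using xj by (auto simp: B_def pairwise_def orthogonal_axis axis_eq_axis axis_eq_0_iff)
  have "card B = DIM(quat) + CARD('d)"
  proof -
    have "card B = card (axis k ` (Basis :: quat set)) + card ((\<lambda>j. axis j (x $ j)) ` (J - {k}))"
      unfolding B_def using xj by (intro card_Un_disjoint) (auto simp: axis_eq_axis)
    also have "card (axis k ` (Basis :: quat set)) = DIM(quat)"
      by (rule card_image) (auto simp: inj_on_def axis_eq_axis)
    also have "card ((\<lambda>j. axis j (x $ j)) ` (J - {k})) = card (J - {k})"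
      by (rule card_image) (use xj in \<open>fastforce simp: inj_on_def axis_eq_axis\<close>)
    also have "card (J - {k}) = CARD('d)" using J(2) k by simp
    finally show ?thesis .
  qed
  then have W: "subspace W" "dim W = DIM(quat ^ 'n) - (DIM(quat) + CARD('d))"
    using dim_orthogonal_complement[OF B] by (simp_all only: W_def)
  have W_iff: "w \<in> W \<longleftrightarrow> w $ k = 0 \<and> (\<forall>j\<in>J. w $ j \<bullet> x $ j = 0)" for w
  proof -
    have "w \<in> W \<longleftrightarrow> (\<forall>b\<in>Basis. w $ k \<bullet> b = 0) \<and> (\<forall>j\<in>J - {k}. w $ j \<bullet> x $ j = 0)"
      by (simp add: W_def B_def ball_Un inner_axis' inner_commute[of _ "w $ _"])
    then show ?thesis using euclidean_all_zero_iff[of "w $ k"] by auto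
  qed
  have Ak: "A q $ k = x $ k" if "q $ k \<noteq> 0" for q using that by (simp add: A_def mult.assoc)
  have Ax: "A q = q" if "q $ k = x $ k" for q using that xk by (simp add: A_def)
  \<comment> \<open>Along a joint orbit \<open>A\<close> changes only by a positive scaling and the
    flow, which the second stage does not see.\<close>
  have A_orbit: "A (a *s \<Phi> \<Lambda> T q) = exp (- (\<Lambda> k \<bullet> T)) *\<^sub>R \<Phi> \<Lambda> T (A q)" if "a \<noteq> 0" "q $ k \<noteq> 0" for a T q
  proof -
    have "inverse a * (a * b) = b" for b using that(1) by (simp flip: mult.assoc)
    then show ?thesis
      using that by (simp add: A_def vec_eq_iff nonzero_inverse_mult_distrib inverse_scaleR_distrib exp_minus mult.assoc)
  qed
  have M_orbit: "orbit_rel \<Lambda> q (M q)" if "q $ k \<noteq> 0" for q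
  proof -
    obtain r T where r: "r > 0" "N (A q) = r *\<^sub>R \<Phi> \<Lambda> T (A q)" using N(2) by blast
    show ?thesis unfolding orbit_rel_def
    proof (intro exI conjI)
      show "of_real r * (x $ k * inverse (q $ k)) \<noteq> 0" using r that xk by simp
      show "M q = (of_real r * (x $ k * inverse (q $ k))) *s \<Phi> \<Lambda> T q"
        unfolding M_def r(2) unfolding A_def by (simp add: scaleR_eq_of_real_mult \<Phi>_scalar vector_smult_assoc)
    qed
  qed
  \<comment> \<open>The second stage multiplies coordinate \<open>k\<close>, already equal to
    \<open>x $ k\<close>, by a positive real number; the condition at the index \<open>k\<close> in
    \<open>J\<close> forces this number to be 1.\<close>
  have Mk: "M q $ k = x $ k" if q: "q \<in> G" for q
  proof -
    have q': "q $ k \<noteq> 0" "\<forall>j\<in>J. 0 < A q $ j \<bullet> x $ j" using q by (auto simp: G_def)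
    obtain r T where r: "r > 0" "N (A q) = r *\<^sub>R \<Phi> \<Lambda> T (A q)" using N(2) by blast
    have "M q $ k = (r * exp (\<Lambda> k \<bullet> T)) *\<^sub>R x $ k" by (simp add: M_def r(2) Ak[OF q'(1)])
    moreover have "M q $ k \<bullet> x $ k = x $ k \<bullet> x $ k" unfolding M_def by (rule N(3)[OF q'(2) k])
    ultimately show ?thesis using xj[OF k] by auto
  qed
  have Mj: "M q $ j \<bullet> x $ j = x $ j \<bullet> x $ j" if "q \<in> G" "j \<in> J" for q j
    unfolding M_def using that by (intro N(3)) (auto simp: G_def)
  have orbit: "y' \<in> G \<and> M y' = M y" if y: "y \<in> G" and o: "orbit_rel \<Lambda> y y'" for y y'
  proof -
    obtain a T where a: "a \<noteq> 0" "y' = a *s \<Phi> \<Lambda> T y" using o by (auto simp: orbit_rel_def)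
    have yk: "y $ k \<noteq> 0" and pos: "\<forall>j\<in>J. 0 < A y $ j \<bullet> x $ j" and yS: "y \<in> S_set \<Lambda>"
      using y by (auto simp: G_def)
    have A: "A y' = exp (- (\<Lambda> k \<bullet> T)) *\<^sub>R \<Phi> \<Lambda> T (A y)" unfolding a(2) by (rule A_orbit[OF a(1) yk])
    have "y' \<in> S_set \<Lambda>" unfolding a(2) by (rule S_set_orbit[OF yS a(1)])
    moreover have "y' $ k \<noteq> 0" using a yk by simp
    moreover have "M y' = M y" unfolding M_def A by (rule N(4)[OF exp_gt_zero pos])
    ultimately show ?thesis using pos by (simp add: G_def A)
  qed
  have MG: "M q \<in> G" if "q \<in> G" for q using orbit[OF that M_orbit] that by (simp add: G_def)
  have smA: "smooth_on {q. q $ k \<noteq> 0} A" unfolding A_def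
    by (intro smooth_on_scalar_mult smooth_on_mult smooth_on_const smooth_on_quat_inverse smooth_on_vec_nth smooth_on_id) auto
  have "open {q :: quat ^ 'n. q $ k \<noteq> 0}" by (rule open_Collect_neq) (intro continuous_intros)+
  moreover have "open {q :: quat ^ 'n. \<forall>j\<in>J. 0 < q $ j \<bullet> x $ j}"
  proof -
    have "open {q :: quat ^ 'n. 0 < q $ j \<bullet> x $ j}" for j
      by (rule open_Collect_less) (intro continuous_intros)+
    moreover have "{q :: quat ^ 'n. \<forall>j\<in>J. 0 < q $ j \<bullet> x $ j} = (\<Inter>j\<in>J. {q. 0 < q $ j \<bullet> x $ j})" by auto
    ultimately show ?thesis by (simp add: open_INT)
  qed
  ultimately have "open ({q. q $ k \<noteq> 0} \<inter> A -` {q. \<forall>j\<in>J. 0 < q $ j \<bullet> x $ j})"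
    using smooth_on_continuous[OF smA] by (intro continuous_open_preimage)
  then have "open (S_set \<Lambda> \<inter> ({q. q $ k \<noteq> 0} \<inter> A -` {q. \<forall>j\<in>J. 0 < q $ j \<bullet> x $ j}))"
    by (rule open_Int[OF open_S_set])
  moreover have "S_set \<Lambda> \<inter> ({q. q $ k \<noteq> 0} \<inter> A -` {q. \<forall>j\<in>J. 0 < q $ j \<bullet> x $ j}) = G"
    by (auto simp: G_def)
  ultimately have "open G" by simp
  moreover have "x \<in> G" using x xj xk Ax[of x] by (simp add: G_def)
  moreover have "G \<subseteq> S_set \<Lambda>" by (simp add: G_def)
  moreover have "smooth_on G M" unfolding M_def
    by (rule smooth_on_compose[OF N(1) smooth_on_subset[OF smA]]) (auto simp: G_def)
  moreover have "\<forall>y\<in>G. M y - x \<in> W" using Mk Mj by (simp add: W_iff inner_diff_left)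
  moreover have "\<forall>w\<in>W. x + w \<in> G \<longrightarrow> M (x + w) = x + w"
    using N(5) Ax by (simp add: W_iff M_def inner_add_left)
  moreover have "\<forall>y\<in>G. \<forall>y'\<in>S_set \<Lambda>. p y' = p y \<longleftrightarrow> y' \<in> G \<and> M y' = M y"
  proof (intro ballI iffI)
    fix y y' assume y: "y \<in> G" and y'S: "y' \<in> S_set \<Lambda>"
    have yS: "y \<in> S_set \<Lambda>" using y by (simp add: G_def)
    {
      assume "p y' = p y"
      then show "y' \<in> G \<and> M y' = M y" using p[OF yS y'S] orbit[OF y] by simp
    next
      assume y': "y' \<in> G \<and> M y' = M y"
      have Mo: "orbit_rel \<Lambda> z (M z)" if "z \<in> G" for z using that by (intro M_orbit) (simp add: G_def)
      have "orbit_rel \<Lambda> y' (M y)" using Mo[of y'] y' by simp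
      then have "orbit_rel \<Lambda> y y'" by (rule orbit_rel_trans[OF Mo[OF y] orbit_rel_sym])
      then show "p y' = p y" using p[OF yS y'S] by simp
    }
  qed
  moreover have "\<forall>y\<in>G. \<exists>\<tau>. smooth_on G \<tau> \<and> \<tau> ` G \<subseteq> G \<and> (\<forall>z\<in>G. M (\<tau> z) = M z) \<and> \<tau> (M y) = y"
  proof
    fix y assume y: "y \<in> G"
    then have "y $ k \<noteq> 0" by (simp add: G_def)
    then have "orbit_rel \<Lambda> (M y) y" by (rule orbit_rel_sym[OF M_orbit])
    then obtain a T where a: "a \<noteq> 0" "y = a *s \<Phi> \<Lambda> T (M y)" by (auto simp: orbit_rel_def)
    have o: "a *s \<Phi> \<Lambda> T z \<in> G \<and> M (a *s \<Phi> \<Lambda> T z) = M z" if "z \<in> G" for z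
      using orbit[OF that] a(1) unfolding orbit_rel_def by blast
    show "\<exists>\<tau>. smooth_on G \<tau> \<and> \<tau> ` G \<subseteq> G \<and> (\<forall>z\<in>G. M (\<tau> z) = M z) \<and> \<tau> (M y) = y"
    proof (rule exI[of _ "\<lambda>z. a *s \<Phi> \<Lambda> T z"], intro conjI ballI)
      show "smooth_on G (\<lambda>z. a *s \<Phi> \<Lambda> T z)"
        by (intro smooth_on_scalar_mult smooth_on_\<Phi> smooth_on_const smooth_on_id)
      show "a *s \<Phi> \<Lambda> T (M y) = y" using a(2) by (rule sym)
    qed (use o in auto)
  qed
  ultimately have "normaliser (S_set \<Lambda>) p x G M W"
    unfolding normaliser_def using W MG by (intro conjI) blast+
  then show "\<exists>G N W. normaliser (S_set \<Lambda>) p x G N W \<and>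
      dim W = DIM(quat ^ 'n) - (DIM(quat) + CARD('d))" using W(2) by blast
qed

end

section \<open>Hausdorff quotients\<close>

text \<open>\<open>F\<close> induces a continuous injection of the quotient into a Hausdorff space.
  Disjoint neighbourhoods are pulled back by \<open>F\<close> and pushed forward by the open map
  \<open>p\<close>; they stay disjoint since \<open>F\<close> is constant on fibres.\<close>

lemma presented_Hausdorff_space:
  fixes F :: "'a::euclidean_space \<Rightarrow> 'b::t2_space"
  assumes M: "presented M S p d" and F: "continuous_on S F"
    and sep: "\<And>x y. x \<in> S \<Longrightarrow> y \<in> S \<Longrightarrow> F x = F y \<longleftrightarrow> p x = p y"
  shows "Hausdorff_space (mtop M)"
  unfolding Hausdorff_space_def
proof (intro allI impI, elim conjE)
  fix a b assume "a \<in> topspace (mtop M)" "b \<in> topspace (mtop M)" and ab: "a \<noteq> b"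
  then have "a \<in> p ` S" "b \<in> p ` S" using presentedD(3)[OF M] by auto
  then obtain x y where xy: "x \<in> S" "a = p x" "y \<in> S" "b = p y" by blast
  then have "F x \<noteq> F y" using sep ab by simp
  from hausdorff[OF this]
  obtain U V where UV: "open U" "open V" "F x \<in> U" "F y \<in> V" "U \<inter> V = {}" by (elim exE conjE)
  have op: "openin (mtop M) (p ` (S \<inter> F -` T))" if "open T" for T
    using continuous_open_preimage[OF F presentedD(1)[OF M] that] by (intro presented_open_image[OF M]) auto
  have "disjnt (p ` (S \<inter> F -` U)) (p ` (S \<inter> F -` V))"
    unfolding disjnt_iff
  proof (intro allI notI, elim conjE imageE)
    fix c u v assume "u \<in> S \<inter> F -` U" "c = p u" "v \<in> S \<inter> F -` V" "c = p v"
    then have "F u = F v" "F u \<in> U" "F v \<in> V" using sep[of u v] by auto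
    then show False using UV(5) by auto
  qed
  moreover have "a \<in> p ` (S \<inter> F -` U)" "b \<in> p ` (S \<inter> F -` V)" using xy UV by auto
  ultimately show "\<exists>U V. openin (mtop M) U \<and> openin (mtop M) V \<and> a \<in> U \<and> b \<in> V \<and> disjnt U V"
    using op[OF UV(1)] op[OF UV(2)] by blast
qed

section \<open>A continuous invariant separating quaternionic lines\<close>

definition quat_cnj :: "quat \<Rightarrow> quat" where
  "quat_cnj q = (2 * (q \<bullet> 1)) *\<^sub>R 1 - q"

lemma quat_cnj_mult: "quat_cnj (a * b) = quat_cnj b * quat_cnj a"
  and quat_cnj_mult_self: "quat_cnj a * a = ((norm a)\<^sup>2) *\<^sub>R 1"
  unfolding power2_norm_eq_inner
  by (simp_all add: quat_cnj_def quat_eq_iff quat_vector_defs one_quat_def inner_quat_def times_quat_def algebra_simps)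

text \<open>The entries of the Hermitian matrix of the projection onto the quaternionic line through \<open>q\<close>
  separate the points of the projective space.\<close>

definition line_matrix :: "quat ^ 'n::finite \<Rightarrow> quat ^ 'n ^ 'n" where
  "line_matrix q = (\<chi> i j. (quat_cnj (q $ i) * q $ j) /\<^sub>R (norm q)\<^sup>2)"

lemma continuous_on_line_matrix: "continuous_on (UNIV - {0}) line_matrix"
  unfolding line_matrix_def quat_cnj_def
  by (intro continuous_on_vec_lambda continuous_intros) auto

text \<open>A left factor \<open>a\<close> enters each product as \<open>quat_cnj a * a\<close>, a
  real number cancelled by the norm. Conversely, row \<open>i\<close> with \<open>p $ i\<close>
  nonzero determines the vector up to a left factor.\<close>

lemma line_matrix_eq_iff:
  assumes "p \<noteq> 0" "q \<noteq> 0"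
  shows "line_matrix p = line_matrix q \<longleftrightarrow> Hstar_rel `` {p} = Hstar_rel `` {q}"
  unfolding Hstar_class_eq_iff
proof
  assume eq: "line_matrix p = line_matrix q"
  then have eq': "(quat_cnj (p $ i) * p $ j) /\<^sub>R (norm p)\<^sup>2 = (quat_cnj (q $ i) * q $ j) /\<^sub>R (norm q)\<^sup>2" for i j
    by (simp add: line_matrix_def vec_eq_iff)
  obtain i where i: "p $ i \<noteq> 0" using assms(1) by (auto simp: vec_eq_iff)
  have cnj0: "quat_cnj a \<noteq> 0" if "a \<noteq> 0" for a
    using quat_cnj_mult_self[of a] that by auto
  have "q $ i \<noteq> 0"
  proof
    assume "q $ i = 0"
    then have "(quat_cnj (p $ i) * p $ i) /\<^sub>R (norm p)\<^sup>2 = 0" using eq'[of i i] by simp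
    then show False using i assms(1) cnj0[OF i] by simp
  qed
  note c = cnj0[OF this]
  \<comment> \<open>Obtained by solving the equality of the entries in row \<open>i\<close> for
    \<open>q $ j\<close>; the factor does not depend on \<open>j\<close>.\<close>
  define a where "a = ((norm q)\<^sup>2 / (norm p)\<^sup>2) *\<^sub>R (inverse (quat_cnj (q $ i)) * quat_cnj (p $ i))"
  have "a \<noteq> 0" using assms c cnj0[OF i] by (simp add: a_def)
  moreover have "q $ j = a * p $ j" for j
  proof -
    have "quat_cnj (q $ i) * q $ j = (norm q)\<^sup>2 *\<^sub>R ((quat_cnj (p $ i) * p $ j) /\<^sub>R (norm p)\<^sup>2)"
      using eq'[of i j] assms(2) by simp
    then have "inverse (quat_cnj (q $ i)) * (quat_cnj (q $ i) * q $ j) =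
        inverse (quat_cnj (q $ i)) * ((norm q)\<^sup>2 *\<^sub>R ((quat_cnj (p $ i) * p $ j) /\<^sub>R (norm p)\<^sup>2))" by simp
    then show ?thesis using c by (simp add: a_def mult.assoc[symmetric] divide_inverse)
  qed
  ultimately show "\<exists>a. a \<noteq> 0 \<and> q = a *s p" by (intro exI[of _ a]) (simp add: vec_eq_iff)
next
  assume "\<exists>a. a \<noteq> 0 \<and> q = a *s p"
  then obtain a where a: "a \<noteq> 0" "q = a *s p" by blast
  have "quat_cnj (a * b) * (a * c) = (norm a)\<^sup>2 *\<^sub>R (quat_cnj b * c)" for b c
  proof -
    have "quat_cnj (a * b) * (a * c) = quat_cnj b * (quat_cnj a * a) * c"
      by (simp add: quat_cnj_mult mult.assoc)
    then show ?thesis by (simp add: quat_cnj_mult_self)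
  qed
  then show "line_matrix p = line_matrix q"
    unfolding a(2) using a(1) by (simp add: line_matrix_def vec_eq_iff norm_vector_scalar_mult power_mult_distrib)
qed

section \<open>Diffeomorphisms from lifts\<close>

text \<open>The lifts need to respect fibres and to be inverse to each other only modulo fibres. The
  two open sets may thus have dimensions different from those of the manifolds and from each
  other.\<close>

lemma diffeomorphic_lift:
  assumes M: "presented M S p d" "Hausdorff_space (mtop M)" and N: "presented N S' p' d'" "Hausdorff_space (mtop N)"
    and F: "smooth_on S F" "F ` S \<subseteq> S'" "\<And>x y. x \<in> S \<Longrightarrow> y \<in> S \<Longrightarrow> p x = p y \<Longrightarrow> p' (F x) = p' (F y)"
    and F': "smooth_on S' F'" "F' ` S' \<subseteq> S" "\<And>x y. x \<in> S' \<Longrightarrow> y \<in> S' \<Longrightarrow> p' x = p' y \<Longrightarrow> p (F' x) = p (F' y)"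
    and inv: "\<And>x. x \<in> S \<Longrightarrow> p (F' (F x)) = p x" "\<And>y. y \<in> S' \<Longrightarrow> p' (F (F' y)) = p' y"
  shows "diffeomorphic M N"
proof -
  have imM: "topspace (mtop M) = p ` S" and imN: "topspace (mtop N) = p' ` S'"
    using presentedD(3)[OF M(1)] presentedD(3)[OF N(1)] by auto
  define f where "f m = p' (F (inv_into S p m))" for m
  have f: "f (p x) = p' (F x)" if "x \<in> S" for x
    unfolding f_def using that by (intro F(3)) (auto intro: inv_into_into f_inv_into_f)
  have bij: "bij_betw f (topspace (mtop M)) (topspace (mtop N))"
  proof (rule bij_betwI')
    fix a b assume ab: "a \<in> topspace (mtop M)" "b \<in> topspace (mtop M)"
    then obtain x y where xy: "x \<in> S" "a = p x" "y \<in> S" "b = p y" unfolding imM by blast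
    show "f a = f b \<longleftrightarrow> a = b"
    proof
      assume "f a = f b"
      then have "p' (F x) = p' (F y)" using f xy by simp
      then have "p (F' (F x)) = p (F' (F y))" using F(2) xy by (intro F'(3)) auto
      then show "a = b" using inv(1) xy by simp
    qed simp
  next
    fix a assume "a \<in> topspace (mtop M)"
    then show "f a \<in> topspace (mtop N)" unfolding imM imN using f F(2) by auto
  next
    fix b assume "b \<in> topspace (mtop N)"
    then obtain y where y: "y \<in> S'" "b = p' y" unfolding imN by blast
    then have "F' y \<in> S" using F'(2) by auto
    then have "p (F' y) \<in> topspace (mtop M)" "b = f (p (F' y))" using f inv(2) y by (auto simp: imM)
    then show "\<exists>a\<in>topspace (mtop M). b = f a" by blast
  qed
  have g: "inv_into (topspace (mtop M)) f (p' y) = p (F' y)" if "y \<in> S'" for y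
  proof (rule inv_into_f_eq[OF bij_betw_imp_inj_on[OF bij]])
    have "F' y \<in> S" using F'(2) that by auto
    then show "p (F' y) \<in> topspace (mtop M)" "f (p (F' y)) = p' y" using f inv(2) that by (auto simp: imM)
  qed
  have "smooth_map M N f" by (rule smooth_map_lift[OF M(1) N(1) F(1,2) f])
  moreover have "smooth_map N M (inv_into (topspace (mtop M)) f)"
    by (rule smooth_map_lift[OF N(1) M(1) F'(1,2) g])
  ultimately have "diffeomorphism M N f" using bij by (simp add: diffeomorphism_def)
  then show ?thesis
    using presented_smooth_manifold[OF M] presented_smooth_manifold[OF N] by (auto simp: diffeomorphic_def)
qed

section \<open>The manifolds of a configuration\<close>

lemma presented_HP: "presented HP (UNIV - {0}) (\<lambda>q :: quat ^ 'n::finite. Hstar_rel `` {q}) (DIM(quat ^ 'n) - DIM(quat))"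
proof -
  let ?E = "UNIV - {0} :: (quat ^ 'n) set"
  have ne: "?E \<noteq> {}" using UNIV_I[of "axis undefined (1 :: quat) :: quat ^ 'n"] by (auto simp: axis_eq_0_iff)
  have op: "open ?E" by (simp add: open_delete)
  have id: "inv_into ?E id w = w" if "w \<in> ?E" for w using that by (intro inv_into_f_eq) auto
  have chart: "is_chart DIM(quat ^ 'n) (top_of_set ?E) ?E id"
  proof (rule is_chartI[of _ _ UNIV])
    show "openin (top_of_set UNIV) (id ` ?E)" using op by simp
    show "continuous_map (top_of_set (id ` ?E)) (top_of_set ?E) (inv_into ?E id)"
      by (rule continuous_map_eq[of _ _ id]) (auto simp: id)
    show "continuous_map (subtopology (top_of_set ?E) ?E) euclidean id"
      by (simp add: subtopology_subtopology)
  qed auto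
  have "presented (embedded_submanifold ?E) ?E id DIM(quat ^ 'n)"
  proof (rule presented_embedded_submanifold[OF op ne])
    show "smooth_on ?E id" by (rule smooth_on_id)
    show "\<exists>\<tau>. smooth_on ?E \<tau> \<and> \<tau> ` ?E \<subseteq> ?E \<and> (\<forall>z\<in>?E. id (\<tau> z) = z) \<and> \<tau> (id x) = x" for x
      by (rule exI[of _ id]) (simp add: smooth_on_id)
    fix z assume z: "z \<in> ?E"
    have "smooth_on (id ` ?E) (inv_into ?E id)"
      by (rule smooth_on_cong[OF smooth_on_id(1)]) (simp add: id)
    then have "(?E, id) \<in> charts (embedded_submanifold ?E)"
      using chart smooth_on_id by (auto simp: embedded_submanifold_def)
    then show "\<exists>U \<phi>. (U, \<phi>) \<in> charts (embedded_submanifold ?E) \<and> z \<in> U \<and> is_chart DIM(quat ^ 'n) (top_of_set ?E) U \<phi>"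
      using chart z by blast
  qed simp
  then show ?thesis
    unfolding HP_def using presented_quotient_manifold[of "embedded_submanifold ?E" ?E id, OF _ ne]
      sliced_projective by simp
qed

context configuration
begin

text \<open>A vector with full support belongs to the set because 0 is a convex combination of all
  weights.\<close>

lemma S_set_nonempty: "S_set \<Lambda> \<noteq> {}"
proof -
  have "0 \<in> convex hull (range \<Lambda>)" using admissible by (simp add: admissible_def)
  then have "(\<chi> i. 1) \<in> S_set \<Lambda>" by (simp add: S_set_def)
  then show ?thesis by blast
qed

lemma presented_V: "presented (V_manifold \<Lambda>) (S_set \<Lambda>) (\<lambda>q. Hstar_rel `` {q}) (DIM(quat ^ 'n) - DIM(quat))"
proof -
  let ?c = "\<lambda>q :: quat ^ 'n. Hstar_rel `` {q}"
  have im: "S_set \<Lambda> // Hstar_rel = ?c ` S_set \<Lambda>" by (auto simp: quotient_def)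
  have sub: "S_set \<Lambda> \<subseteq> UNIV - {0}" using S_set_nonzero by auto
  have "openin (mtop HP) (S_set \<Lambda> // Hstar_rel)"
    unfolding im by (rule presented_open_image[OF presented_HP open_S_set sub])
  from presented_open_submanifold[OF presented_HP this]
  have "presented (V_manifold \<Lambda>) ((UNIV - {0}) \<inter> ?c -` (S_set \<Lambda> // Hstar_rel)) ?c (DIM(quat ^ 'n) - DIM(quat))"
    by (simp add: V_manifold_def)
  moreover have "(UNIV - {0}) \<inter> ?c -` (S_set \<Lambda> // Hstar_rel) = S_set \<Lambda>"
  proof
    show "S_set \<Lambda> \<subseteq> (UNIV - {0}) \<inter> ?c -` (S_set \<Lambda> // Hstar_rel)" using sub by (auto simp: im)
    show "(UNIV - {0}) \<inter> ?c -` (S_set \<Lambda> // Hstar_rel) \<subseteq> S_set \<Lambda>"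
    proof
      fix q assume "q \<in> (UNIV - {0}) \<inter> ?c -` (S_set \<Lambda> // Hstar_rel)"
      then obtain p where "p \<in> S_set \<Lambda>" "?c p = ?c q" unfolding im by auto
      then obtain a where "a \<noteq> 0" "q = a *s p" "p \<in> S_set \<Lambda>" using Hstar_class_eq_iff by blast
      then show "q \<in> S_set \<Lambda>" using S_set_orbit[of p \<Lambda> a 0] by simp
    qed
  qed
  ultimately show ?thesis by simp
qed

lemma Hausdorff_V: "Hausdorff_space (mtop (V_manifold \<Lambda>))"
proof (rule presented_Hausdorff_space[OF presented_V, of line_matrix])
  show "continuous_on (S_set \<Lambda>) line_matrix"
    using continuous_on_line_matrix by (rule continuous_on_subset) (use S_set_nonzero in auto)
qed (use line_matrix_eq_iff S_set_nonzero in blast)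

text \<open>Along a joint orbit \<open>retr\<close> changes by a unit scalar, so the quaternionic
  line through \<open>retr q\<close> is a complete invariant of the orbit. Together with
  \<open>line_matrix\<close> it gives the Hausdorff property of \<open>N\<close> and of the orbit
  space of \<open>V\<close> by one argument.\<close>

lemma Hstar_retr_eq_iff:
  assumes "q \<in> S_set \<Lambda>" "q' \<in> S_set \<Lambda>"
  shows "Hstar_rel `` {retr q} = Hstar_rel `` {retr q'} \<longleftrightarrow> orbit_rel \<Lambda> q q'"
proof -
  have r: "orbit_rel \<Lambda> x (retr x)" if "x \<in> S_set \<Lambda>" for x
  proof -
    have "of_real (inverse (norm (\<Phi> \<Lambda> (time x) x))) \<noteq> (0 :: quat)"
      using S_set_nonzero[OF S_set_\<Phi>[OF that]] by simp
    then show ?thesis unfolding orbit_rel_def retr_def scaleR_eq_of_real_mult by blast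
  qed
  show ?thesis
  proof
    assume "Hstar_rel `` {retr q} = Hstar_rel `` {retr q'}"
    then obtain a where "a \<noteq> 0" "retr q' = a *s \<Phi> \<Lambda> 0 (retr q)" unfolding Hstar_class_eq_iff by auto
    then have "orbit_rel \<Lambda> (retr q) (retr q')" unfolding orbit_rel_def by blast
    then show "orbit_rel \<Lambda> q q'" using r[OF assms(1)] r[OF assms(2)] orbit_rel_sym orbit_rel_trans by blast
  next
    assume "orbit_rel \<Lambda> q q'"
    then obtain a T where a: "a \<noteq> 0" "q' = a *s \<Phi> \<Lambda> T q" by (auto simp: orbit_rel_def)
    have "retr q' = (a /\<^sub>R norm a) *s retr q" unfolding a(2) by (rule retr_orbit[OF assms(1) a(1)])
    moreover have "a /\<^sub>R norm a \<noteq> 0" using a(1) by simp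
    ultimately show "Hstar_rel `` {retr q} = Hstar_rel `` {retr q'}" unfolding Hstar_class_eq_iff by blast
  qed
qed

lemma Hausdorff_orbit_space:
  assumes M: "presented M (S_set \<Lambda>) p d"
    and p: "\<And>q q'. q \<in> S_set \<Lambda> \<Longrightarrow> q' \<in> S_set \<Lambda> \<Longrightarrow> p q' = p q \<longleftrightarrow> orbit_rel \<Lambda> q q'"
  shows "Hausdorff_space (mtop M)"
proof (rule presented_Hausdorff_space[OF M, of "\<lambda>q. line_matrix (retr q)"])
  have nz: "retr q \<noteq> 0" if "q \<in> S_set \<Lambda>" for q
    using retr_in_Z[OF that] by (auto simp: Z_set_iff)
  show "continuous_on (S_set \<Lambda>) (\<lambda>q. line_matrix (retr q))"
    by (rule continuous_on_compose2[OF continuous_on_line_matrix smooth_on_continuous[OF smooth_retr]])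
      (use nz in auto)
  show "line_matrix (retr x) = line_matrix (retr y) \<longleftrightarrow> p x = p y" if "x \<in> S_set \<Lambda>" "y \<in> S_set \<Lambda>" for x y
    using line_matrix_eq_iff[OF nz[OF that(1)] nz[OF that(2)]] Hstar_retr_eq_iff[OF that] p[OF that] by auto
qed

lemma presented_Z: "presented (embedded_submanifold (Z_set \<Lambda>)) (S_set \<Lambda>) retr (DIM(quat ^ 'n) - Suc CARD('d))"
proof (rule presented_sliced_retract[OF open_S_set S_set_nonempty smooth_retr retr_image Z_subset_S retr_Z _ sliced_retr])
  fix x assume "x \<in> S_set \<Lambda>"
  then obtain r T where r: "r > 0" "x = r *\<^sub>R \<Phi> \<Lambda> T (retr x)" by (rule retr_sectionE)
  show "\<exists>\<tau>. smooth_on (Z_set \<Lambda>) \<tau> \<and> \<tau> ` Z_set \<Lambda> \<subseteq> S_set \<Lambda> \<and> (\<forall>z\<in>Z_set \<Lambda>. retr (\<tau> z) = z) \<and> \<tau> (retr x) = x"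
  proof (rule exI[of _ "\<lambda>z. r *\<^sub>R \<Phi> \<Lambda> T z"], intro conjI ballI)
    show "smooth_on (Z_set \<Lambda>) (\<lambda>z. r *\<^sub>R \<Phi> \<Lambda> T z)"
      by (intro smooth_on_scaleR smooth_on_\<Phi> smooth_on_const smooth_on_id)
    show "(\<lambda>z. r *\<^sub>R \<Phi> \<Lambda> T z) ` Z_set \<Lambda> \<subseteq> S_set \<Lambda>"
      unfolding scaleR_eq_of_real_mult using Z_subset_S r(1) by (auto intro!: S_set_orbit)
    show "retr (r *\<^sub>R \<Phi> \<Lambda> T z) = z" if "z \<in> Z_set \<Lambda>" for z
      using retr_pos_orbit[of z r T] retr_Z[OF that] Z_subset_S that r(1) by auto
  qed (use r in simp)
qed

lemma presented_N:
  "presented (N_manifold \<Lambda>) (S_set \<Lambda>) (\<lambda>q. Sp1_rel `` {retr q}) (DIM(quat ^ 'n) - (DIM(quat) + CARD('d)))"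
  unfolding N_manifold_def
  by (intro presented_quotient_manifold[OF presented_Z S_set_nonempty] sliced_orbit Sp1_retr_eq_iff)

lemma Hausdorff_N: "Hausdorff_space (mtop (N_manifold \<Lambda>))"
  by (rule Hausdorff_orbit_space[OF presented_N Sp1_retr_eq_iff])

section \<open>The action on classes and the two diffeomorphisms\<close>

text \<open>A class is moved as a set, by direct image. No representative is chosen, and the laws of
  an action hold for all sets of vectors, so \<open>action_rel\<close> is an equivalence relation on
  the whole type.\<close>

abbreviation \<Psi> :: "real ^ 'd \<Rightarrow> (quat ^ 'n) set \<Rightarrow> (quat ^ 'n) set" where
  "\<Psi> T \<equiv> (`) (\<Phi> \<Lambda> T)"

lemma \<Psi>_class: "\<Psi> T (Hstar_rel `` {q}) = Hstar_rel `` {\<Phi> \<Lambda> T q}"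
proof -
  have "Hstar_rel `` {p} = (\<lambda>a. a *s p) ` {a. a \<noteq> 0}" for p :: "quat ^ 'n"
    by (auto simp: Hstar_rel_def)
  then show ?thesis by (simp add: image_image \<Phi>_scalar)
qed

lemma \<Psi>_0: "\<Psi> 0 C = C" and \<Psi>_add: "\<Psi> (S + T) C = \<Psi> S (\<Psi> T C)"
  by (simp_all add: image_image \<Phi>_\<Phi>)

lemma smooth_vector_action_\<Psi>: "smooth_vector_action (V_manifold \<Lambda>) \<Psi>"
  unfolding smooth_vector_action_def
proof (intro conjI allI ballI)
  show "smooth_map (product_manifold euclidean_manifold (V_manifold \<Lambda>)) (V_manifold \<Lambda>) (\<lambda>(T, x). \<Psi> T x)"
  proof (rule smooth_map_lift[OF presented_product_manifold[OF presented_euclidean_manifold presented_V] presented_V])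
    show "smooth_on (UNIV \<times> S_set \<Lambda>) (\<lambda>z. \<Phi> \<Lambda> (fst z) (snd z))"
      by (intro smooth_on_\<Phi> smooth_on_fst smooth_on_snd smooth_on_id)
    show "(\<lambda>z. \<Phi> \<Lambda> (fst z) (snd z)) ` (UNIV \<times> S_set \<Lambda>) \<subseteq> S_set \<Lambda>" by (auto intro: S_set_\<Phi>)
    show "(\<lambda>(T, x). \<Psi> T x) (map_prod id (\<lambda>q. Hstar_rel `` {q}) z) = Hstar_rel `` {\<Phi> \<Lambda> (fst z) (snd z)}" for z
      by (cases z) (simp only: map_prod_simp prod.case \<Psi>_class id_apply fst_conv snd_conv)
  qed
qed (simp_all add: \<Psi>_0 \<Psi>_add)

lemma action_class_eq_iff:
  "action_rel \<Psi> `` {Hstar_rel `` {q'}} = action_rel \<Psi> `` {Hstar_rel `` {q}} \<longleftrightarrow> orbit_rel \<Lambda> q q'"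
proof -
  have equiv: "equiv UNIV (action_rel \<Psi>)"
  proof (rule equivI)
    show "refl (action_rel \<Psi>)" unfolding refl_on_def action_rel_def using \<Psi>_0 by blast
    show "sym (action_rel \<Psi>)"
    proof (rule symI)
      fix C D assume "(C, D) \<in> action_rel \<Psi>"
      then obtain T where "D = \<Psi> T C" by (auto simp: action_rel_def)
      then have "C = \<Psi> (- T) D" using \<Psi>_add[of "- T" T C] \<Psi>_0 by simp
      then show "(D, C) \<in> action_rel \<Psi>" unfolding action_rel_def by blast
    qed
    show "trans (action_rel \<Psi>)"
    proof (rule transI)
      fix C D E assume "(C, D) \<in> action_rel \<Psi>" "(D, E) \<in> action_rel \<Psi>"
      then obtain T U where "D = \<Psi> T C" "E = \<Psi> U D" by (auto simp: action_rel_def)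
      then have "E = \<Psi> (U + T) C" using \<Psi>_add by simp
      then show "(C, E) \<in> action_rel \<Psi>" unfolding action_rel_def by blast
    qed
  qed auto
  have "action_rel \<Psi> `` {Hstar_rel `` {q'}} = action_rel \<Psi> `` {Hstar_rel `` {q}} \<longleftrightarrow>
      (Hstar_rel `` {q}, Hstar_rel `` {q'}) \<in> action_rel \<Psi>"
    using eq_equiv_class_iff[OF equiv UNIV_I UNIV_I, of "Hstar_rel `` {q}" "Hstar_rel `` {q'}"]
    by (auto simp del: Image_singleton_iff)
  also have "\<dots> \<longleftrightarrow> (\<exists>T. Hstar_rel `` {\<Phi> \<Lambda> T q} = Hstar_rel `` {q'})"
    unfolding action_rel_def mem_Collect_eq prod.case \<Psi>_class by (metis)
  also have "\<dots> \<longleftrightarrow> orbit_rel \<Lambda> q q'" unfolding Hstar_class_eq_iff orbit_rel_def by blast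
  finally show ?thesis .
qed

text \<open>Both manifolds are presented by \<open>S_set \<Lambda>\<close> with the joint orbits as
  fibres, so the identity of \<open>S_set \<Lambda>\<close> is a lift in either direction.\<close>

lemma diffeomorphic_quotient: "diffeomorphic (quotient_manifold (V_manifold \<Lambda>) (action_rel \<Psi>)) (N_manifold \<Lambda>)"
proof -
  let ?Q = "quotient_manifold (V_manifold \<Lambda>) (action_rel \<Psi>)"
  have Q: "presented ?Q (S_set \<Lambda>) (\<lambda>q. action_rel \<Psi> `` {Hstar_rel `` {q}}) (DIM(quat ^ 'n) - (DIM(quat) + CARD('d)))"
    by (intro presented_quotient_manifold[OF presented_V S_set_nonempty] sliced_orbit action_class_eq_iff)
  show ?thesis
    by (rule diffeomorphic_lift[OF Q Hausdorff_orbit_space[OF Q action_class_eq_iff] presented_N Hausdorff_N,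
          of "\<lambda>q. q" "\<lambda>q. q"])
      (simp_all add: smooth_on_id action_class_eq_iff Sp1_retr_eq_iff)
qed

text \<open>The inverse lift takes \<open>(q, T)\<close> to the point on the flow line of
  \<open>q\<close> whose remaining time is \<open>T\<close>, which is reached by flowing for
  \<open>time q - T\<close>. Replacing \<open>q\<close> by another point of its joint orbit changes
  that point only by a scalar, so its class is well defined.\<close>

lemma diffeomorphic_product:
  "diffeomorphic (V_manifold \<Lambda>) (product_manifold (N_manifold \<Lambda>) (euclidean_manifold :: (real ^ 'd, real ^ 'd) charted_space))"
proof (rule diffeomorphic_lift[OF presented_V Hausdorff_V presented_product_manifold[OF presented_N presented_euclidean_manifold],
      of "\<lambda>q. (q, time q)" "\<lambda>z. \<Phi> \<Lambda> (time (fst z) - snd z) (fst z)"])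
  show "Hausdorff_space (mtop (product_manifold (N_manifold \<Lambda>) (euclidean_manifold :: (real ^ 'd, real ^ 'd) charted_space)))"
    using Hausdorff_N Hausdorff_space_euclidean by (simp add: product_manifold_def euclidean_manifold_def Hausdorff_space_prod_topology)
  show "smooth_on (S_set \<Lambda>) (\<lambda>q. (q, time q))"
    by (intro smooth_on_Pair smooth_on_id smooth_time)
  show "(\<lambda>q. (q, time q)) ` S_set \<Lambda> \<subseteq> S_set \<Lambda> \<times> UNIV" by auto
  show "smooth_on (S_set \<Lambda> \<times> (UNIV :: (real ^ 'd) set)) (\<lambda>z. \<Phi> \<Lambda> (time (fst z) - snd z) (fst z))"
    by (intro smooth_on_\<Phi> smooth_on_diff smooth_on_compose[OF smooth_time] smooth_on_fst smooth_on_snd smooth_on_id) auto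
  show "(\<lambda>z. \<Phi> \<Lambda> (time (fst z) - snd z) (fst z)) ` (S_set \<Lambda> \<times> UNIV) \<subseteq> S_set \<Lambda>"
    by (auto intro: S_set_\<Phi>)
  let ?p = "map_prod (\<lambda>q. Sp1_rel `` {retr q}) (id :: real ^ 'd \<Rightarrow> real ^ 'd)"
  show "?p (x, time x) = ?p (y, time y)"
    if x: "x \<in> S_set \<Lambda>" and y: "y \<in> S_set \<Lambda>" and eq: "Hstar_rel `` {x} = Hstar_rel `` {y}" for x y
  proof -
    obtain a where a: "a \<noteq> 0" "y = a *s \<Phi> \<Lambda> 0 x" using eq unfolding Hstar_class_eq_iff by auto
    then have "orbit_rel \<Lambda> x y" unfolding orbit_rel_def by blast
    moreover have "time y = time x" unfolding a(2) using time_orbit[OF x a(1), of 0] by simp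
    ultimately show ?thesis using Sp1_retr_eq_iff[OF x y] by simp
  qed
  show "Hstar_rel `` {\<Phi> \<Lambda> (time (fst z) - snd z) (fst z)} = Hstar_rel `` {\<Phi> \<Lambda> (time (fst z') - snd z') (fst z')}"
    if z: "z \<in> S_set \<Lambda> \<times> UNIV" "z' \<in> S_set \<Lambda> \<times> UNIV" and eq: "?p z = ?p z'" for z z'
  proof -
    obtain x y T where xy: "z = (x, T)" "z' = (y, T)" "x \<in> S_set \<Lambda>" "y \<in> S_set \<Lambda>"
      and "Sp1_rel `` {retr y} = Sp1_rel `` {retr x}" using z eq by (cases z; cases z') auto
    then have "orbit_rel \<Lambda> x y" using Sp1_retr_eq_iff by blast
    then obtain a s where a: "a \<noteq> 0" "y = a *s \<Phi> \<Lambda> s x" by (auto simp: orbit_rel_def)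
    have "time y = time x - s" unfolding a(2) by (rule time_orbit[OF xy(3) a(1)])
    then have "\<Phi> \<Lambda> (time y - T) y = a *s \<Phi> \<Lambda> (time x - T) x"
      unfolding a(2) by (simp add: \<Phi>_scalar \<Phi>_\<Phi>)
    then show ?thesis unfolding Hstar_class_eq_iff xy using a(1) by auto
  qed
  show "Hstar_rel `` {\<Phi> \<Lambda> (time (fst (x, time x)) - snd (x, time x)) (fst (x, time x))} = Hstar_rel `` {x}" for x
    by simp
  show "?p (\<Phi> \<Lambda> (time (fst z) - snd z) (fst z), time (\<Phi> \<Lambda> (time (fst z) - snd z) (fst z))) = ?p z"
    if z: "z \<in> S_set \<Lambda> \<times> UNIV" for z
  proof -
    obtain x T where xT: "z = (x, T)" "x \<in> S_set \<Lambda>" using z by auto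
    let ?y = "\<Phi> \<Lambda> (time x - T) x"
    have y: "?y = 1 *s \<Phi> \<Lambda> (time x - T) x" by simp
    have "orbit_rel \<Lambda> x ?y" unfolding orbit_rel_def using y zero_neq_one by metis
    moreover have "time ?y = T" using time_orbit[OF xT(2), of 1 "time x - T"] by simp
    ultimately show ?thesis using Sp1_retr_eq_iff[OF xT(2) S_set_\<Phi>[OF xT(2)]] by (simp add: xT(1))
  qed
qed

end

theorem theorem5p1:
  fixes m :: nat and \<Lambda> :: "'n::finite \<Rightarrow> real ^ 'd::finite"
  assumes "m \<ge> 1" and "CARD('d) = 4 * m"
    and "admissible \<Lambda>"
    and "affine hull (range \<Lambda>) = UNIV"
  shows "(\<exists>\<Psi> :: real ^ 'd \<Rightarrow> (quat ^ 'n) set \<Rightarrow> (quat ^ 'n) set.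
            smooth_vector_action (V_manifold \<Lambda>) \<Psi> \<and>
            (\<forall>T. \<forall>q\<in>S_set \<Lambda>. \<Psi> T (Hstar_rel `` {q}) = Hstar_rel `` {\<Phi> \<Lambda> T q}) \<and>
            diffeomorphic (quotient_manifold (V_manifold \<Lambda>) (action_rel \<Psi>)) (N_manifold \<Lambda>)) \<and>
         diffeomorphic (V_manifold \<Lambda>)
           (product_manifold (N_manifold \<Lambda>) (euclidean_manifold :: (real ^ 'd, real ^ 'd) charted_space))"
proof -
  interpret configuration \<Lambda> using assms(3) by unfold_locales
  show ?thesis
  proof (rule conjI, rule exI[of _ "\<lambda>T. (`) (\<Phi> \<Lambda> T)"], intro conjI allI ballI)
    show "smooth_vector_action (V_manifold \<Lambda>) (\<lambda>T. (`) (\<Phi> \<Lambda> T))"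
      by (rule smooth_vector_action_\<Psi>)
    show "diffeomorphic (quotient_manifold (V_manifold \<Lambda>) (action_rel (\<lambda>T. (`) (\<Phi> \<Lambda> T)))) (N_manifold \<Lambda>)"
      by (rule diffeomorphic_quotient)
    show "\<Phi> \<Lambda> T ` Hstar_rel `` {q} = Hstar_rel `` {\<Phi> \<Lambda> T q}" for T q
      by (rule \<Psi>_class)
  qed (rule diffeomorphic_product)
qed

end
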